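(* Let $n\ge 3$ and let $V:\mathbb{R}^n\to\mathbb{R}$ be a measurable potential satisfying both of the following conditions. (i) $V=V_+-V_-$ with $V_+=\max\{V,0\}$, where $V_+$ is of Kato class and $\|V_-\|_K<4\pi^{n/2}/\Gamma(\frac n2-1)$. (ii) Writing $V_R(x)=R^2V(Rx)$ for $R>0$, there are constants $a_k,b_k>0$ ($k=0,1,2$), independent of $R>0$, with $0<a_0<1$, such that $$\|((x\cdot\nabla)^kV_R)f\|\le \frac{a_k}{2}\|\Delta f\|+b_k\|f\|\quad\text{for all } R>0,\ k=0,1,2,\ f\in H^2(\mathbb{R}^n),$$ and $-(x\cdot\nabla)V_R\ge 0$ for all $R>0$. Let $H=-\Delta+V$. Then there exist a fixed constant $\sigma>0$ and a large but fixed number $T_0>0$ such that the following holds. Let $u_0\in L^2(\mathbb{R}^n)$ and let $u(x,t)=(e^{-itH}u_0)(x)$ be the solution of $i\partial_tu=Hu$, $u(x,0)=u_0(x)$. If for some $r>0$ and some $t>r^2$, $$\operatorname{supp}u_0\subset B(0,r/\sqrt{T_0})\quad\text{and}\quad \operatorname{supp}u(\cdot,t)\subset B(0,\sqrt{T_0}\,\sigma t/r),$$ then $u\equiv 0$.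
   Context: $\|\cdot\|$ is the norm of $L^2(\mathbb{R}^n)$ and $B(0,\rho)$ is the ball of radius $\rho$ centered at the origin. For $n\ge 3$, a real measurable function $W$ on $\mathbb{R}^n$ is of Kato class if $\lim_{\delta\to0}\sup_{x\in\mathbb{R}^n}\int_{|x-y|<\delta}\frac{|W(y)|}{|x-y|^{n-2}}\,dy=0$. The global Kato norm is $\|W\|_K=\sup_{x\in\mathbb{R}^n}\int_{\mathbb{R}^n}\frac{|W(y)|}{|x-y|^{n-2}}\,dy$. Under condition (i), $-\Delta+V$ defined on $C_0^\infty(\mathbb{R}^n)$ extends to a unique nonnegative self-adjoint operator on $L^2(\mathbb{R}^n)$, which is denoted $H=-\Delta+V$. In condition (ii), $(x\cdot\nabla)^kV_R$ is the function obtained by applying the differential operator $x\cdot\nabla$ to $V_R$ $k$ times, acting on $f$ by multiplication. *)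

theory Defs
  imports "HOL-Analysis.Analysis"
begin

subsection \<open>Square-integrable functions\<close>

text \<open>Elements of $L^2$ are represented by functions; equality in $L^2$ is equality almost
  everywhere. Because the Bochner integral of a non-integrable function is 0,
  \<open>l2_norm\<close> and \<open>l2_inner\<close> are meaningful only together with membership in \<open>L2\<close>.\<close>

definition L2 :: "('a::euclidean_space \<Rightarrow> complex) set" where
  "L2 = {f. f \<in> borel_measurable lebesgue \<and> integrable lebesgue (\<lambda>x. (cmod (f x))\<^sup>2)}"

definition l2_norm :: "('a::euclidean_space \<Rightarrow> complex) \<Rightarrow> real" where
  "l2_norm f = sqrt (LINT x|lebesgue. (cmod (f x))\<^sup>2)"

definition l2_inner :: "('a::euclidean_space \<Rightarrow> complex) \<Rightarrow> ('a \<Rightarrow> complex) \<Rightarrow> complex" where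
  "l2_inner f g = (LINT x|lebesgue. f x * cnj (g x))"

definition l2_dense :: "('a::euclidean_space \<Rightarrow> complex) set \<Rightarrow> bool" where
  "l2_dense D \<longleftrightarrow> D \<subseteq> L2 \<and> (\<forall>f\<in>L2. \<forall>\<epsilon>>0. \<exists>g\<in>D. l2_norm (\<lambda>x. f x - g x) < \<epsilon>)"

text \<open>Support of an element of $L^2$: the complement of the largest open set on which the
  function vanishes almost everywhere.\<close>

definition ess_support :: "('a::euclidean_space \<Rightarrow> complex) \<Rightarrow> 'a set" where
  "ess_support f = {x. \<forall>\<epsilon>>0. \<not> (AE y in lebesgue. y \<in> ball x \<epsilon> \<longrightarrow> f y = 0)}"


subsection \<open>Kato class and global Kato norm\<close>

definition kato_class :: "('a::euclidean_space \<Rightarrow> real) \<Rightarrow> bool" where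
  "kato_class W \<longleftrightarrow> W \<in> borel_measurable lebesgue \<and>
     ((\<lambda>\<delta>. SUP x. \<integral>\<^sup>+y\<in>ball x \<delta>. ennreal (\<bar>W y\<bar> / dist x y ^ (DIM('a) - 2)) \<partial>lebesgue)
        \<longlongrightarrow> 0) (at_right 0)"

definition kato_norm :: "('a::euclidean_space \<Rightarrow> real) \<Rightarrow> ennreal" where
  "kato_norm W = (SUP x. \<integral>\<^sup>+y. ennreal (\<bar>W y\<bar> / dist x y ^ (DIM('a) - 2)) \<partial>lebesgue)"


subsection \<open>Test functions\<close>

definition dir_deriv :: "'a::euclidean_space \<Rightarrow> ('a \<Rightarrow> 'b::real_normed_vector) \<Rightarrow> 'a \<Rightarrow> 'b" where
  "dir_deriv v f = (\<lambda>x. frechet_derivative f (at x) v)"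

text \<open>\<open>C_k k f\<close>: \<open>f\<close> is \<open>k\<close> times continuously differentiable on the whole space.\<close>

fun C_k :: "nat \<Rightarrow> ('a::euclidean_space \<Rightarrow> 'b::real_normed_vector) \<Rightarrow> bool" where
  "C_k 0 f \<longleftrightarrow> continuous_on UNIV f"
| "C_k (Suc k) f \<longleftrightarrow> f differentiable_on UNIV \<and> (\<forall>b\<in>Basis. C_k k (dir_deriv b f))"

definition test_functions :: "('a::euclidean_space \<Rightarrow> 'b::real_normed_vector) set" where
  "test_functions = {\<phi>. (\<forall>k. C_k k \<phi>) \<and> compact (closure {x. \<phi> x \<noteq> 0})}"

definition laplacian :: "('a::euclidean_space \<Rightarrow> 'b::real_normed_vector) \<Rightarrow> 'a \<Rightarrow> 'b" where
  "laplacian f x = (\<Sum>b\<in>Basis. dir_deriv b (dir_deriv b f) x)"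


subsection \<open>Weak derivatives and the Sobolev space $H^2$\<close>

definition locally_integrable :: "('a::euclidean_space \<Rightarrow> 'b::euclidean_space) \<Rightarrow> bool" where
  "locally_integrable f \<longleftrightarrow> (\<forall>K. compact K \<longrightarrow> f absolutely_integrable_on K)"

definition weak_dir_deriv ::
    "'a::euclidean_space \<Rightarrow> ('a \<Rightarrow> 'b::euclidean_space) \<Rightarrow> ('a \<Rightarrow> 'b) \<Rightarrow> bool" where
  "weak_dir_deriv v f g \<longleftrightarrow> locally_integrable f \<and> locally_integrable g \<and>
     (\<forall>\<phi> :: 'a \<Rightarrow> real. \<phi> \<in> test_functions \<longrightarrow>
        (LINT x|lebesgue. \<phi> x *\<^sub>R g x) = - (LINT x|lebesgue. dir_deriv v \<phi> x *\<^sub>R f x))"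

definition weak_laplacian ::
    "('a::euclidean_space \<Rightarrow> 'b::euclidean_space) \<Rightarrow> ('a \<Rightarrow> 'b) \<Rightarrow> bool" where
  "weak_laplacian f g \<longleftrightarrow> locally_integrable f \<and> locally_integrable g \<and>
     (\<forall>\<phi> :: 'a \<Rightarrow> real. \<phi> \<in> test_functions \<longrightarrow>
        (LINT x|lebesgue. \<phi> x *\<^sub>R g x) = (LINT x|lebesgue. laplacian \<phi> x *\<^sub>R f x))"

definition H2 :: "('a::euclidean_space \<Rightarrow> complex) set" where
  "H2 = {f \<in> L2. \<forall>b\<in>Basis. \<exists>g\<in>L2. weak_dir_deriv b f g \<and>
                  (\<forall>c\<in>Basis. \<exists>h\<in>L2. weak_dir_deriv c g h)}"

text \<open>\<open>weak_radial W W'\<close>: the distribution $(x\cdot\nabla)W$ is the function \<open>W'\<close>. The formal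
  transpose of $x\cdot\nabla$ is
  $\varphi \mapsto -\nabla\cdot(x\varphi) = -(n\varphi + x\cdot\nabla\varphi)$.
  Such a \<open>W'\<close> is unique up to a null set, and \<open>weak_radial ^^ k\<close> is the \<open>k\<close>-fold application
  of $x\cdot\nabla$.\<close>

definition weak_radial :: "('a::euclidean_space \<Rightarrow> real) \<Rightarrow> ('a \<Rightarrow> real) \<Rightarrow> bool" where
  "weak_radial W W' \<longleftrightarrow> locally_integrable W \<and> locally_integrable W' \<and>
     (\<forall>\<phi> :: 'a \<Rightarrow> real. \<phi> \<in> test_functions \<longrightarrow>
        (LINT x|lebesgue. \<phi> x * W' x)
          = - (LINT x|lebesgue. (real DIM('a) * \<phi> x + dir_deriv x \<phi> x) * W x))"


subsection \<open>Unbounded operators, $-\Delta+V$ and the group $e^{-itH}$\<close>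

text \<open>An unbounded operator on $L^2$ is represented by its graph, saturated under equality almost
  everywhere. \<open>l2_adjoint\<close> is then always saturated, and the adjoint of a densely defined
  operator is single-valued up to null sets.\<close>

type_synonym 'a l2_operator = "(('a \<Rightarrow> complex) \<times> ('a \<Rightarrow> complex)) set"

definition l2_adjoint :: "'a::euclidean_space l2_operator \<Rightarrow> 'a l2_operator" where
  "l2_adjoint A = {(f, g). f \<in> L2 \<and> g \<in> L2 \<and>
                     (\<forall>(\<phi>, \<psi>)\<in>A. l2_inner \<psi> f = l2_inner \<phi> g)}"

definition self_adjoint :: "'a::euclidean_space l2_operator \<Rightarrow> bool" where
  "self_adjoint A \<longleftrightarrow> l2_dense (Domain A) \<and> l2_adjoint A = A"

definition nonnegative_op :: "'a::euclidean_space l2_operator \<Rightarrow> bool" where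
  "nonnegative_op A \<longleftrightarrow> (\<forall>(f, g)\<in>A. l2_inner g f \<in> \<real>\<^sub>\<ge>\<^sub>0)"

text \<open>\<open>H\<close> is the nonnegative self-adjoint extension of $-\Delta+V$ on $C_0^\infty$.\<close>

definition schrodinger_operator ::
    "('a::euclidean_space \<Rightarrow> real) \<Rightarrow> 'a l2_operator \<Rightarrow> bool" where
  "schrodinger_operator V H \<longleftrightarrow> self_adjoint H \<and> nonnegative_op H \<and>
     (\<forall>\<phi>\<in>test_functions. (\<phi>, \<lambda>x. - laplacian \<phi> x + complex_of_real (V x) * \<phi> x) \<in> H)"

text \<open>\<open>unitary_group H U\<close>: $U(t) = e^{-itH}$, i.e. \<open>U\<close> is the strongly continuous one-parameter
  unitary group on $L^2$ with infinitesimal generator $-iH$ (with the natural domain of the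
  generator). Linearity and isometry make \<open>U t\<close> respect equality almost everywhere.\<close>

definition unitary_group ::
    "'a::euclidean_space l2_operator \<Rightarrow> (real \<Rightarrow> ('a \<Rightarrow> complex) \<Rightarrow> 'a \<Rightarrow> complex) \<Rightarrow> bool" where
  "unitary_group H U \<longleftrightarrow>
     (\<forall>t. \<forall>f\<in>L2. U t f \<in> L2 \<and> l2_norm (U t f) = l2_norm f) \<and>
     (\<forall>t c. \<forall>f\<in>L2. \<forall>g\<in>L2.
        AE x in lebesgue. U t (\<lambda>y. f y + c * g y) x = U t f x + c * U t g x) \<and>
     (\<forall>f\<in>L2. AE x in lebesgue. U 0 f x = f x) \<and>
     (\<forall>s t. \<forall>f\<in>L2. AE x in lebesgue. U (s + t) f x = U s (U t f) x) \<and>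
     (\<forall>f\<in>L2. ((\<lambda>t. l2_norm (\<lambda>x. U t f x - f x)) \<longlongrightarrow> 0) (at 0)) \<and>
     (\<forall>f\<in>L2. \<forall>g\<in>L2. (f, g) \<in> H \<longleftrightarrow>
        ((\<lambda>t. l2_norm (\<lambda>x. (U t f x - f x) / complex_of_real t - (- \<i> * g x)))
           \<longlongrightarrow> 0) (at 0))"


text \<open>The rescaled potential $V_R$.\<close>

definition rescale :: "real \<Rightarrow> ('a::euclidean_space \<Rightarrow> real) \<Rightarrow> 'a \<Rightarrow> real" where
  "rescale R V x = R\<^sup>2 * V (R *\<^sub>R x)"

end

theory Submission
  imports Defs
begin

text \<open>Applying (ii) with $k = 0$ to dilates and letting $R \to \infty$ gives
  $\|Vf\| \le \frac{a_0}{2}\|\Delta f\|$ without lower-order term. Hence test functions are a core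
  for $H$ (Kato--Rellich) and the energy $E = \langle Hf, f\rangle$ is comparable to
  $\|\nabla f\|^2$. Since $-(x\cdot\nabla)V \ge 0$, the dilation generator $A$ satisfies
  $i[H, A] \ge 2(-\Delta)$, so $\langle Au, u\rangle$ grows at least like $tE$ along the flow,
  while $|\langle Au, u\rangle| \le C\,\||x|u\|\sqrt{E}$ at times $0$ and $t$. With the Heisenberg
  inequality $\|u\|^2 \le C\,\||x|u_0\|\sqrt{E}$ this yields
  $t\|u\|^2 \le 4n\,r_0(r_0 + r_1)\|u\|^2$ when $u_0$ and $u(t)$ live in balls of radii $r_0$ and
  $r_1$, which is impossible for $u \ne 0$ if $r_0 = r/\sqrt{T_0}$, $r_1 = \sqrt{T_0}\sigma t/r$,
  $t > r^2$, $T_0 = 16n$ and $\sigma = 1/(16n)$.\<close>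

subsection \<open>The Hilbert space $L^2$\<close>

text \<open>The obstacle is regularity. The datum need not have finite energy, it is localised only
  at the times 0 and \<open>t\<close>, and the dilation generator is unbounded. Two regularisations
  make the virial argument legitimate. In space, \<open>x\<close> becomes a bounded field whose
  derivatives are bounded uniformly in the cutoff, so that the cutoff can be removed by dominated
  convergence. In energy, the datum is smoothed by a resolvent. They are compatible because a
  localisation formula for the resolvent controls weighted norms with an error independent of the
  cutoff.

  The bound \<open>a 0 / 2 < 1 / 2\<close> leaves room for the couplings 2 and -1: nonnegativity of
  the forms of \<open>-Laplacian + 2V\<close> and \<open>-Laplacian - V\<close> is exactly the
  two-sided comparison of energy and Dirichlet integral. Nonnegativity itself is extracted from an
  operator bound by monotonicity of resolvents.

  The work takes place in a real Hilbert space of classes, with multiplication by the imaginary unit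
  as a skew isometry \<open>J\<close>. Elements of the operator domain carry a gradient obtained as
  a limit along test functions.\<close>

lemma measurable_cnj:
  assumes "f \<in> borel_measurable M"
  shows "(\<lambda>x. cnj (f x)) \<in> borel_measurable M"
  by (rule measurable_compose[OF assms borel_measurable_continuous_onI]) (intro continuous_intros)

lemma L2_measurable: "f \<in> L2 \<Longrightarrow> f \<in> borel_measurable lebesgue"
  by (simp add: L2_def)

lemma L2_integrable: "f \<in> L2 \<Longrightarrow> integrable lebesgue (\<lambda>x. (cmod (f x))\<^sup>2)"
  by (simp add: L2_def)

lemma L2_integrable_mult:
  assumes "f \<in> L2" "g \<in> L2"
  shows "integrable lebesgue (\<lambda>x. f x * cnj (g x))"
proof (rule Bochner_Integration.integrable_bound)
  show "integrable lebesgue (\<lambda>x. (cmod (f x))\<^sup>2 + (cmod (g x))\<^sup>2)"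
    using assms by (auto simp: L2_def)
  show "(\<lambda>x. f x * cnj (g x)) \<in> borel_measurable lebesgue"
    using L2_measurable[OF assms(1)] L2_measurable[OF assms(2)] by (intro borel_measurable_times measurable_cnj)
  have "a * b \<le> a\<^sup>2 + b\<^sup>2" if "0 \<le> a" "0 \<le> b" for a b :: real
    using sum_squares_bound[of a b] mult_nonneg_nonneg[OF that] by linarith
  then show "AE x in lebesgue. norm (f x * cnj (g x)) \<le> norm ((cmod (f x))\<^sup>2 + (cmod (g x))\<^sup>2)"
    by (auto simp: norm_mult)
qed

lemma L2_add:
  assumes "f \<in> L2" "g \<in> L2"
  shows "(\<lambda>x. f x + g x) \<in> L2"
proof -
  have m: "(\<lambda>x. f x + g x) \<in> borel_measurable lebesgue"
    using assms by (auto dest!: L2_measurable)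
  have "integrable lebesgue (\<lambda>x. (cmod (f x + g x))\<^sup>2)"
  proof (rule Bochner_Integration.integrable_bound)
    show "integrable lebesgue (\<lambda>x. 2 * (cmod (f x))\<^sup>2 + 2 * (cmod (g x))\<^sup>2)"
      using assms by (auto simp: L2_def)
    show "(\<lambda>x. (cmod (f x + g x))\<^sup>2) \<in> borel_measurable lebesgue"
      using m by auto
    have "(cmod (a + b))\<^sup>2 \<le> 2 * (cmod a)\<^sup>2 + 2 * (cmod b)\<^sup>2" for a b
    proof -
      have "(cmod (a + b))\<^sup>2 \<le> (cmod a + cmod b)\<^sup>2"
        by (intro power_mono norm_triangle_ineq) auto
      also have "\<dots> \<le> 2 * (cmod a)\<^sup>2 + 2 * (cmod b)\<^sup>2"
        using sum_squares_bound[of "cmod a" "cmod b"] by (simp add: power2_sum)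
      finally show ?thesis .
    qed
    then show "AE x in lebesgue. norm ((cmod (f x + g x))\<^sup>2) \<le> norm (2 * (cmod (f x))\<^sup>2 + 2 * (cmod (g x))\<^sup>2)"
      by auto
  qed
  with m show ?thesis by (simp add: L2_def)
qed

lemma L2_mult_bounded:
  assumes "f \<in> L2" "m \<in> borel_measurable lebesgue" "\<And>x. cmod (m x) \<le> B"
  shows "(\<lambda>x. m x * f x) \<in> L2"
proof -
  have m: "(\<lambda>x. m x * f x) \<in> borel_measurable lebesgue"
    using assms by (auto dest!: L2_measurable)
  have "integrable lebesgue (\<lambda>x. (cmod (m x * f x))\<^sup>2)"
  proof (rule Bochner_Integration.integrable_bound)
    show "integrable lebesgue (\<lambda>x. B\<^sup>2 * (cmod (f x))\<^sup>2)"
      using assms by (auto simp: L2_def)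
    show "(\<lambda>x. (cmod (m x * f x))\<^sup>2) \<in> borel_measurable lebesgue"
      using m by auto
    have "(cmod (m x))\<^sup>2 * (cmod (f x))\<^sup>2 \<le> B\<^sup>2 * (cmod (f x))\<^sup>2" for x
      by (intro mult_right_mono power_mono assms) auto
    then show "AE x in lebesgue. norm ((cmod (m x * f x))\<^sup>2) \<le> norm (B\<^sup>2 * (cmod (f x))\<^sup>2)"
      by (auto simp: norm_mult power_mult_distrib)
  qed
  with m show ?thesis by (simp add: L2_def)
qed

lemma L2_cmult: "f \<in> L2 \<Longrightarrow> (\<lambda>x. c * f x) \<in> L2"
  by (rule L2_mult_bounded[where m = "\<lambda>_. c" and B = "cmod c"]) auto

lemma L2_zero: "(\<lambda>x. 0) \<in> L2"
  by (simp add: L2_def)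

lemma L2_uminus: "f \<in> L2 \<Longrightarrow> (\<lambda>x. - f x) \<in> L2"
  using L2_cmult[of f "-1"] by simp

lemma L2_diff: "f \<in> L2 \<Longrightarrow> g \<in> L2 \<Longrightarrow> (\<lambda>x. f x - g x) \<in> L2"
  using L2_add[of f "\<lambda>x. - g x"] L2_uminus[of g] by simp

lemma L2_scaleR: "f \<in> L2 \<Longrightarrow> (\<lambda>x. c *\<^sub>R f x) \<in> L2"
  using L2_cmult[of f "of_real c"] by (simp add: scaleR_conv_of_real)

text \<open>Only members of \<open>L2\<close> are related to themselves, so this is a partial
  equivalence relation, and the quotient consists exactly of the classes of square-integrable
  functions.\<close>

definition lsq_rel :: "('a::euclidean_space \<Rightarrow> complex) \<Rightarrow> ('a \<Rightarrow> complex) \<Rightarrow> bool" where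
  "lsq_rel f g \<longleftrightarrow> f \<in> L2 \<and> g \<in> L2 \<and> (AE x in lebesgue. f x = g x)"

quotient_type (overloaded) 'a lsq = "'a::euclidean_space \<Rightarrow> complex" / partial: lsq_rel
proof (rule part_equivpI)
  show "\<exists>f::'a \<Rightarrow> complex. lsq_rel f f"
    using L2_zero by (auto simp: lsq_rel_def)
  show "symp (lsq_rel :: ('a \<Rightarrow> complex) \<Rightarrow> _)"
    by (auto simp: lsq_rel_def symp_def eq_commute)
  show "transp (lsq_rel :: ('a \<Rightarrow> complex) \<Rightarrow> _)"
    unfolding lsq_rel_def transp_def by (auto elim!: AE_mp)
qed

lemma inner_lsq_rel:
  assumes "lsq_rel f f'" "lsq_rel g g'"
  shows "Re (l2_inner f g) = Re (l2_inner f' g')"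
proof -
  have "AE x in lebesgue. f x * cnj (g x) = f' x * cnj (g' x)"
    using assms by (auto simp: lsq_rel_def elim!: AE_mp)
  then have "l2_inner f g = l2_inner f' g'"
    unfolding l2_inner_def using assms
    by (intro integral_cong_AE borel_measurable_integrable L2_integrable_mult) (auto simp: lsq_rel_def)
  then show ?thesis by simp
qed

instantiation lsq :: (euclidean_space) real_vector
begin

lift_definition zero_lsq :: "'a lsq" is "\<lambda>x. 0"
  by (auto simp: lsq_rel_def L2_zero)

lift_definition plus_lsq :: "'a lsq \<Rightarrow> 'a lsq \<Rightarrow> 'a lsq" is "\<lambda>f g x. f x + g x"
  by (auto simp: lsq_rel_def L2_add elim!: AE_mp)

lift_definition minus_lsq :: "'a lsq \<Rightarrow> 'a lsq \<Rightarrow> 'a lsq" is "\<lambda>f g x. f x - g x"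
  by (auto simp: lsq_rel_def L2_diff elim!: AE_mp)

lift_definition uminus_lsq :: "'a lsq \<Rightarrow> 'a lsq" is "\<lambda>f x. - f x"
  by (auto simp: lsq_rel_def L2_uminus elim!: AE_mp)

lift_definition scaleR_lsq :: "real \<Rightarrow> 'a lsq \<Rightarrow> 'a lsq" is "\<lambda>c f x. c *\<^sub>R f x"
  by (auto simp: lsq_rel_def L2_scaleR elim!: AE_mp)

instance
proof
  fix f g h :: "'a lsq" and c e :: real
  show "f + g + h = f + (g + h)"
    by transfer (auto simp: lsq_rel_def L2_add add.assoc)
  show "f + g = g + f"
    by transfer (auto simp: lsq_rel_def L2_add add.commute)
  show "0 + f = f"
    by transfer (auto simp: lsq_rel_def)
  show "- f + f = 0"
    by transfer (auto simp: lsq_rel_def L2_zero)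
  show "f - g = f + - g"
    by transfer (auto simp: lsq_rel_def L2_diff)
  show "c *\<^sub>R (f + g) = c *\<^sub>R f + c *\<^sub>R g"
    by transfer (auto simp: lsq_rel_def scaleR_right_distrib intro!: L2_add L2_scaleR)
  show "(c + e) *\<^sub>R f = c *\<^sub>R f + e *\<^sub>R f"
    by transfer (auto simp: lsq_rel_def L2_add L2_scaleR scaleR_left_distrib)
  show "c *\<^sub>R e *\<^sub>R f = (c * e) *\<^sub>R f"
    by transfer (auto simp: lsq_rel_def L2_scaleR)
  show "1 *\<^sub>R f = f"
    by transfer (auto simp: lsq_rel_def)
qed

end

text \<open>Taking the real part of the Hermitian product gives a real inner product with the same
  norm; the complex structure is recovered through multiplication by the imaginary unit.\<close>

instantiation lsq :: (euclidean_space) real_inner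
begin

lift_definition inner_lsq :: "'a lsq \<Rightarrow> 'a lsq \<Rightarrow> real" is "\<lambda>f g. Re (l2_inner f g)"
  by (rule inner_lsq_rel)

definition norm_lsq :: "'a lsq \<Rightarrow> real" where "norm_lsq f = sqrt (inner f f)"
definition sgn_lsq :: "'a lsq \<Rightarrow> 'a lsq" where "sgn_lsq f = f /\<^sub>R norm f"
definition dist_lsq :: "'a lsq \<Rightarrow> 'a lsq \<Rightarrow> real" where "dist_lsq f g = norm (f - g)"
definition uniformity_lsq :: "('a lsq \<times> 'a lsq) filter" where
  "uniformity_lsq = (INF e\<in>{0<..}. principal {(x, y). dist x y < e})"
definition open_lsq :: "'a lsq set \<Rightarrow> bool" where
  "open_lsq S = (\<forall>x\<in>S. \<forall>\<^sub>F (x', y) in uniformity. x' = x \<longrightarrow> y \<in> S)"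

instance
proof
  fix f g h :: "'a lsq" and c e :: real
  show "inner f g = inner g f"
  proof (transfer, clarsimp simp: lsq_rel_def)
    fix f g :: "'a \<Rightarrow> complex" assume "f \<in> L2" "g \<in> L2"
    have "l2_inner g f = cnj (l2_inner f g)"
      unfolding l2_inner_def by (simp add: mult.commute flip: Bochner_Integration.integral_cnj)
    then show "Re (l2_inner f g) = Re (l2_inner g f)" by simp
  qed
  show "inner (f + g) h = inner f h + inner g h"
    by transfer (auto simp: lsq_rel_def l2_inner_def distrib_right L2_integrable_mult)
  show "inner (c *\<^sub>R f) g = c * inner f g"
    by transfer (auto simp: lsq_rel_def l2_inner_def)
  have nn: "Re (l2_inner f f) = (LINT x|lebesgue. (cmod (f x))\<^sup>2)" if "f \<in> L2" for f :: "'a \<Rightarrow> complex"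
  proof -
    have "Re (l2_inner f f) = (LINT x|lebesgue. Re (f x * cnj (f x)))"
      unfolding l2_inner_def by (rule integral_Re[symmetric]) (rule L2_integrable_mult[OF that that])
    also have "\<dots> = (LINT x|lebesgue. (cmod (f x))\<^sup>2)"
      by (simp only: cmod_power2) (simp add: power2_eq_square)
    finally show ?thesis .
  qed
  show "0 \<le> inner f f"
    by transfer (auto simp: lsq_rel_def nn)
  show "inner f f = 0 \<longleftrightarrow> f = 0"
  proof (transfer, clarsimp simp: lsq_rel_def nn L2_zero)
    fix f :: "'a \<Rightarrow> complex" assume "f \<in> L2"
    then show "(LINT x|lebesgue. (cmod (f x))\<^sup>2) = 0 \<longleftrightarrow> (AE x in lebesgue. f x = 0)"
      by (subst integral_nonneg_eq_0_iff_AE) (auto simp: L2_integrable)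
  qed
qed (rule norm_lsq_def sgn_lsq_def dist_lsq_def uniformity_lsq_def open_lsq_def)+

end

section \<open>Passing between functions and their classes; completeness\<close>

abbreviation cls :: "('a::euclidean_space \<Rightarrow> complex) \<Rightarrow> 'a lsq" where
  "cls \<equiv> abs_lsq"

lemma lsq_rel_refl: "f \<in> L2 \<Longrightarrow> lsq_rel f f"
  by (simp add: lsq_rel_def)

lemma cls_eq_iff: "f \<in> L2 \<Longrightarrow> g \<in> L2 \<Longrightarrow> cls f = cls g \<longleftrightarrow> (AE x in lebesgue. f x = g x)"
  using Quotient_rel[OF Quotient_lsq, of f g] by (auto simp: lsq_rel_def)

lemma cls_add: "f \<in> L2 \<Longrightarrow> g \<in> L2 \<Longrightarrow> cls (\<lambda>x. f x + g x) = cls f + cls g"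
  by (simp add: plus_lsq.abs_eq lsq_rel_refl)

lemma cls_diff: "f \<in> L2 \<Longrightarrow> g \<in> L2 \<Longrightarrow> cls (\<lambda>x. f x - g x) = cls f - cls g"
  by (simp add: minus_lsq.abs_eq lsq_rel_refl)

lemma cls_uminus: "f \<in> L2 \<Longrightarrow> cls (\<lambda>x. - f x) = - cls f"
  by (simp add: uminus_lsq.abs_eq lsq_rel_refl)

lemma cls_scaleR: "f \<in> L2 \<Longrightarrow> cls (\<lambda>x. c *\<^sub>R f x) = c *\<^sub>R cls f"
  by (simp add: scaleR_lsq.abs_eq lsq_rel_refl)

lemma cls_zero: "cls (\<lambda>x. 0) = 0"
  by (simp add: zero_lsq_def)

lemma inner_cls: "f \<in> L2 \<Longrightarrow> g \<in> L2 \<Longrightarrow> inner (cls f) (cls g) = Re (l2_inner f g)"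
  by (simp add: inner_lsq.abs_eq lsq_rel_refl)

lemma inner_cls_integral:
  "f \<in> L2 \<Longrightarrow> g \<in> L2 \<Longrightarrow> inner (cls f) (cls g) = (LINT x|lebesgue. Re (f x * cnj (g x)))"
  unfolding inner_cls l2_inner_def by (rule integral_Re[symmetric]) (rule L2_integrable_mult)

lemma norm_cls: "f \<in> L2 \<Longrightarrow> norm (cls f) = l2_norm f"
proof -
  assume f: "f \<in> L2"
  have "inner (cls f) (cls f) = (LINT x|lebesgue. (cmod (f x))\<^sup>2)"
    unfolding inner_cls_integral[OF f f]
    by (simp only: cmod_power2) (simp add: power2_eq_square)
  then show ?thesis by (simp add: norm_lsq_def l2_norm_def)
qed

lemma lsq_cases:
  obtains f where "f \<in> L2" "F = cls f"
proof -
  obtain f where "lsq_rel f f" "abs_lsq f = F"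
    using Quotient_rep_reflp[OF Quotient_lsq] Quotient_abs_rep[OF Quotient_lsq] by metis
  with that show ?thesis by (auto simp: lsq_rel_def)
qed

text \<open>Fatou's lemma applied to the squared moduli. The bound is asked for from some index on,
  because it is applied to tails of a Cauchy sequence.\<close>

lemma Fatou_L2:
  fixes g :: "nat \<Rightarrow> 'a::euclidean_space \<Rightarrow> complex"
  assumes g: "\<And>m. g m \<in> L2" and h: "h \<in> borel_measurable lebesgue"
    and lim: "AE x in lebesgue. (\<lambda>m. g m x) \<longlonglongrightarrow> h x"
    and le: "\<And>m. m \<ge> n \<Longrightarrow> norm (cls (g m)) \<le> B" and B: "0 \<le> B"
  shows "h \<in> L2" "norm (cls h) \<le> B"
proof -
  have nn: "(\<integral>\<^sup>+x. ennreal ((cmod (f x))\<^sup>2) \<partial>lebesgue) = ennreal ((norm (cls f))\<^sup>2)" if "f \<in> L2" for f :: "'a \<Rightarrow> complex"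
    unfolding norm_cls[OF that] l2_norm_def using L2_integrable[OF that]
    by (subst nn_integral_eq_integral) auto
  have "(\<integral>\<^sup>+x. ennreal ((cmod (h x))\<^sup>2) \<partial>lebesgue) = (\<integral>\<^sup>+x. liminf (\<lambda>m. ennreal ((cmod (g m x))\<^sup>2)) \<partial>lebesgue)"
  proof (rule nn_integral_cong_AE)
    show "AE x in lebesgue. ennreal ((cmod (h x))\<^sup>2) = liminf (\<lambda>m. ennreal ((cmod (g m x))\<^sup>2))"
      using lim
    proof eventually_elim
      case (elim x)
      then have "(\<lambda>m. ennreal ((cmod (g m x))\<^sup>2)) \<longlonglongrightarrow> ennreal ((cmod (h x))\<^sup>2)"
        by (intro tendsto_intros)
      from lim_imp_Liminf[OF _ this] show ?case by simp
    qed
  qed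
  also have "\<dots> \<le> liminf (\<lambda>m. \<integral>\<^sup>+x. ennreal ((cmod (g m x))\<^sup>2) \<partial>lebesgue)"
    using L2_measurable[OF g] by (intro nn_integral_liminf) auto
  also have "\<dots> \<le> ennreal (B\<^sup>2)"
  proof -
    have "\<forall>\<^sub>F m in sequentially. (\<integral>\<^sup>+x. ennreal ((cmod (g m x))\<^sup>2) \<partial>lebesgue) \<le> ennreal (B\<^sup>2)"
      unfolding nn[OF g] eventually_sequentially using le
      by (intro exI[of _ n] allI impI ennreal_leI power_mono) auto
    then have "liminf (\<lambda>m. \<integral>\<^sup>+x. ennreal ((cmod (g m x))\<^sup>2) \<partial>lebesgue) \<le> liminf (\<lambda>m. ennreal (B\<^sup>2))"
      by (rule Liminf_mono)
    then show ?thesis by (simp only: Liminf_const[OF sequentially_bot])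
  qed
  finally have fin: "(\<integral>\<^sup>+x. ennreal ((cmod (h x))\<^sup>2) \<partial>lebesgue) \<le> ennreal (B\<^sup>2)" .
  then have "integrable lebesgue (\<lambda>x. (cmod (h x))\<^sup>2)"
    using h by (intro integrableI_bounded) (auto simp: order_le_less_trans)
  with h show hL: "h \<in> L2" by (simp add: L2_def)
  show "norm (cls h) \<le> B"
    using fin B by (simp add: nn[OF hL] power2_le_iff_abs_le)
qed

lemma ennreal_le_suminf: "f n \<le> (\<Sum>n. f n)" for f :: "nat \<Rightarrow> ennreal"
  using sum_le_suminf[OF summableI, of "{n}" f] by simp

instance lsq :: (euclidean_space) complete_space
proof
  fix X :: "nat \<Rightarrow> 'a lsq" assume X: "Cauchy X"
  have "\<exists>f. f \<in> L2 \<and> X n = cls f" for n by (meson lsq_cases)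
  then obtain f where f: "\<And>n. f n \<in> L2" "\<And>n. X n = cls (f n)" by metis
  have "\<exists>N. \<forall>i\<ge>N. \<forall>j\<ge>N. dist (X i) (X j) < (1/4) ^ n" for n
    using metric_CauchyD[OF X, of "(1/4)^n"] by auto
  then obtain N where N: "\<And>n i j. i \<ge> N n \<Longrightarrow> j \<ge> N n \<Longrightarrow> dist (X i) (X j) < (1/4) ^ n" by metis
  \<comment> \<open>The maximum makes every later index exceed all earlier thresholds, so that
    \<open>g\<close> is controlled at every scale up to \<open>n\<close> at once.\<close>
  define r where "r n = Max (N ` {..n})" for n
  have r: "N n \<le> r m" if "n \<le> m" for n m
    unfolding r_def using that by (intro Max_ge) auto
  define g where "g n = f (r n)" for n
  have gL: "g n \<in> L2" for n by (simp add: g_def f)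
  have gd: "norm (cls (\<lambda>x. g m x - g n x)) \<le> (1/4) ^ k" if "k \<le> m" "k \<le> n" for m n k
    using N[OF r[OF that(1)] r[OF that(2)]] by (simp add: cls_diff gL dist_norm) (simp add: g_def f(2)[symmetric])
  \<comment> \<open>The increments have squared norm at most \<open>(1/16) ^ n\<close>, so the
    weight \<open>4 ^ n\<close> still leaves a summable series of integrals. Where
    \<open>T x\<close> is finite, the weight in turn forces the increments below a multiple of
    \<open>(1/2) ^ n\<close>, hence pointwise convergence.\<close>
  define T where "T x = (\<Sum>n. ennreal (4 ^ n * (cmod (g (Suc n) x - g n x))\<^sup>2))" for x
  have "(\<integral>\<^sup>+x. T x \<partial>lebesgue) = (\<Sum>n. \<integral>\<^sup>+x. ennreal (4 ^ n * (cmod (g (Suc n) x - g n x))\<^sup>2) \<partial>lebesgue)"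
    unfolding T_def using L2_measurable[OF gL] by (intro nn_integral_suminf) auto
  also have "\<dots> \<le> (\<Sum>n. ennreal ((1/4) ^ n))"
  proof (rule suminf_le)
    fix n
    have L: "(\<lambda>x. g (Suc n) x - g n x) \<in> L2" by (intro L2_diff gL)
    have "(\<integral>\<^sup>+x. ennreal (4 ^ n * (cmod (g (Suc n) x - g n x))\<^sup>2) \<partial>lebesgue)
      = ennreal (4 ^ n * (norm (cls (\<lambda>x. g (Suc n) x - g n x)))\<^sup>2)"
      unfolding norm_cls[OF L] l2_norm_def using L2_integrable[OF L]
      by (subst nn_integral_eq_integral) auto
    also have "\<dots> \<le> ennreal (4 ^ n * ((1/4) ^ n)\<^sup>2)"
      by (intro ennreal_leI mult_left_mono power_mono gd) auto
    also have "4 ^ n * ((1/4) ^ n)\<^sup>2 = (1/4::real) ^ n"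
      by (simp add: power2_eq_square power_one_over field_simps)
    finally show "(\<integral>\<^sup>+x. ennreal (4 ^ n * (cmod (g (Suc n) x - g n x))\<^sup>2) \<partial>lebesgue) \<le> ennreal ((1/4) ^ n)" .
  qed auto
  also have "\<dots> < \<infinity>"
  proof -
    have s: "(\<lambda>n. (1/4::real) ^ n) sums (1 / (1 - 1/4))" by (rule geometric_sums) simp
    have "(\<Sum>n. ennreal ((1/4) ^ n)) = ennreal (1 / (1 - 1/4))"
      by (rule suminf_ennreal_eq[OF _ s]) simp
    then show ?thesis by (simp only: ennreal_less_top infinity_ennreal_def)
  qed
  finally have "AE x in lebesgue. T x \<noteq> \<infinity>"
    using L2_measurable[OF gL] by (intro nn_integral_PInf_AE) (auto simp: T_def)
  then have conv: "AE x in lebesgue. convergent (\<lambda>n. g n x)"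
  proof eventually_elim
    case (elim x)
    define t where "t = enn2real (T x)"
    have t: "T x = ennreal t" "t \<ge> 0" using elim by (auto simp: t_def less_top)
    have le: "cmod (g (Suc n) x - g n x) \<le> sqrt t * (1/2) ^ n" for n
    proof -
      have "ennreal (4 ^ n * (cmod (g (Suc n) x - g n x))\<^sup>2) \<le> ennreal t"
        unfolding t(1)[symmetric] T_def by (rule ennreal_le_suminf)
      then have "4 ^ n * (cmod (g (Suc n) x - g n x))\<^sup>2 \<le> t" using t by simp
      then have "(2 ^ n * cmod (g (Suc n) x - g n x))\<^sup>2 \<le> t"
        using power_mult_distrib[of "2::real" 2 n] by (simp add: power_mult_distrib power2_eq_square mult_ac)
      then have "2 ^ n * cmod (g (Suc n) x - g n x) \<le> sqrt t"
        by (rule real_le_rsqrt)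
      then show ?thesis by (simp add: field_simps power_one_over)
    qed
    have "summable (\<lambda>n. g (Suc n) x - g n x)"
      by (rule summable_comparison_test'[OF summable_mult[OF summable_geometric], of "1/2" 0 _ "sqrt t"]) (use le in auto)
    then have "convergent (\<lambda>n. \<Sum>k<n. g (Suc k) x - g k x)"
      by (simp add: summable_iff_convergent)
    then have "convergent (\<lambda>n. g 0 x + (g n x - g 0 x))"
      unfolding sum_lessThan_telescope[of "\<lambda>n. g n x"] by (intro convergent_add convergent_const)
    then show ?case by simp
  qed
  define h where "h x = lim (\<lambda>n. g n x)" for x
  have h: "h \<in> borel_measurable lebesgue"
    unfolding h_def using L2_measurable[OF gL] by (intro borel_measurable_lim_metric)
  have lim: "AE x in lebesgue. (\<lambda>n. g n x) \<longlonglongrightarrow> h x"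
    using conv by eventually_elim (simp add: h_def convergent_LIMSEQ_iff)
  \<comment> \<open>Fatou for \<open>g m - g n\<close> as \<open>m\<close> tends to infinity turns
    the Cauchy estimate into a distance estimate to the pointwise limit.\<close>
  have key: "(\<lambda>x. h x - g n x) \<in> L2 \<and> norm (cls (\<lambda>x. h x - g n x)) \<le> (1/4) ^ n" for n
  proof -
    have "AE x in lebesgue. (\<lambda>m. g m x - g n x) \<longlonglongrightarrow> h x - g n x"
      using lim by eventually_elim (intro tendsto_intros)
    moreover have "(\<lambda>x. h x - g n x) \<in> borel_measurable lebesgue"
      using h L2_measurable[OF gL] by auto
    moreover have "(\<lambda>x. g m x - g n x) \<in> L2" for m
      by (rule L2_diff[OF gL gL])
    moreover have "norm (cls (\<lambda>x. g m x - g n x)) \<le> (1/4) ^ n" if "n \<le> m" for m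
      by (rule gd[OF that order_refl])
    moreover have "0 \<le> (1/4::real) ^ n" by simp
    ultimately show ?thesis
      by (intro conjI Fatou_L2[of "\<lambda>m x. g m x - g n x" "\<lambda>x. h x - g n x" n "(1/4)^n"])
  qed
  have hL: "h \<in> L2"
    using L2_add[OF conjunct1[OF key[of 0]] gL[of 0]] by simp
  have "X \<longlonglongrightarrow> cls h"
  proof (rule metric_LIMSEQ_I)
    fix e :: real assume "e > 0"
    obtain n where n: "(1/4) ^ n < e / 2"
      using real_arch_pow_inv[of "e/2" "1/4"] \<open>e > 0\<close> by auto
    have "dist (X m) (cls h) < e" if "m \<ge> N n" for m
    proof -
      have "dist (X (r n)) (cls h) \<le> (1/4) ^ n"
        using key[of n] by (simp add: cls_diff hL gL dist_norm norm_minus_commute) (simp add: g_def f(2)[symmetric] norm_minus_commute)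
      moreover have "dist (X m) (X (r n)) < (1/4) ^ n"
        using N[OF that r[of n n]] by simp
      ultimately show ?thesis
        using dist_triangle[of "X m" "cls h" "X (r n)"] n by linarith
    qed
    then show "\<exists>no. \<forall>n\<ge>no. dist (X n) (cls h) < e" by blast
  qed
  then show "convergent X" by (auto simp: convergent_def)
qed

section \<open>Bounded multiplication operators\<close>

definition bdd_meas :: "('a::euclidean_space \<Rightarrow> complex) \<Rightarrow> bool" where
  "bdd_meas m \<longleftrightarrow> m \<in> borel_measurable lebesgue \<and> (\<exists>B. \<forall>x. cmod (m x) \<le> B)"

lemma L2_mult_bdd_meas: "bdd_meas m \<Longrightarrow> f \<in> L2 \<Longrightarrow> (\<lambda>x. m x * f x) \<in> L2"
  by (auto simp: bdd_meas_def intro: L2_mult_bounded)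

lemma L2_if_bdd_meas: "f \<in> L2 \<Longrightarrow> (\<lambda>x. if bdd_meas m then m x * f x else 0) \<in> L2"
  by (cases "bdd_meas m") (simp_all add: L2_zero L2_mult_bdd_meas)

text \<open>The value is zero unless the multiplier is bounded and measurable, which makes
  \<open>mul m\<close> a bounded linear operator on the whole space for every
  \<open>m\<close>.\<close>

lift_definition mul :: "('a::euclidean_space \<Rightarrow> complex) \<Rightarrow> 'a lsq \<Rightarrow> 'a lsq" is
  "\<lambda>m f x. if bdd_meas m then m x * f x else 0"
  by (auto simp: lsq_rel_def L2_if_bdd_meas elim: AE_mp)

lemma mul_cls: "bdd_meas m \<Longrightarrow> f \<in> L2 \<Longrightarrow> mul m (cls f) = cls (\<lambda>x. m x * f x)"
  by (simp add: mul.abs_eq lsq_rel_refl)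

lemma mul_not_bdd_meas: "\<not> bdd_meas m \<Longrightarrow> mul m F = 0"
  by transfer (simp add: lsq_rel_def L2_zero)

lemma mul_add: "mul m (F + G) = mul m F + mul m G"
proof (cases "bdd_meas m")
  case True
  obtain f where f: "f \<in> L2" "F = cls f" by (rule lsq_cases)
  obtain g where g: "g \<in> L2" "G = cls g" by (rule lsq_cases)
  show ?thesis
    using f g True
    by (simp add: mul_cls L2_mult_bdd_meas distrib_left L2_add flip: cls_add)
qed (simp add: mul_not_bdd_meas)

lemma mul_scaleR: "mul m (c *\<^sub>R F) = c *\<^sub>R mul m F"
proof (cases "bdd_meas m")
  case True
  obtain f where f: "f \<in> L2" "F = cls f" by (rule lsq_cases)
  show ?thesis
    using f True by (simp add: mul_cls L2_mult_bdd_meas L2_scaleR flip: cls_scaleR)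
qed (simp add: mul_not_bdd_meas)

lemma norm_mul_le:
  assumes "\<And>x. cmod (m x) \<le> B"
  shows "norm (mul m F) \<le> B * norm F"
proof (cases "bdd_meas m")
  case True
  obtain f where f: "f \<in> L2" "F = cls f" by (rule lsq_cases)
  have B: "0 \<le> B" using assms[of undefined] norm_ge_zero order_trans by blast
  have "(LINT x|lebesgue. (cmod (m x * f x))\<^sup>2) \<le> (LINT x|lebesgue. B\<^sup>2 * (cmod (f x))\<^sup>2)"
  proof (rule integral_mono)
    show "integrable lebesgue (\<lambda>x. (cmod (m x * f x))\<^sup>2)"
      by (intro L2_integrable L2_mult_bdd_meas True f)
    show "integrable lebesgue (\<lambda>x. B\<^sup>2 * (cmod (f x))\<^sup>2)"
      using L2_integrable[OF f(1)] by simp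
    show "(cmod (m x * f x))\<^sup>2 \<le> B\<^sup>2 * (cmod (f x))\<^sup>2" for x
      unfolding norm_mult power_mult_distrib by (intro mult_right_mono power_mono assms) auto
  qed
  then have "l2_norm (\<lambda>x. m x * f x) \<le> sqrt (B\<^sup>2 * (LINT x|lebesgue. (cmod (f x))\<^sup>2))"
    unfolding l2_norm_def by (intro real_sqrt_le_mono) simp
  then show ?thesis
    using True f B by (simp add: mul_cls norm_cls L2_mult_bdd_meas) (simp add: l2_norm_def real_sqrt_mult)
next
  case False
  have "mul m F = 0" using False by (rule mul_not_bdd_meas)
  moreover have "0 \<le> B" using assms[of undefined] norm_ge_zero order_trans by blast
  ultimately show ?thesis by simp
qed

lemma bounded_linear_mul: "bounded_linear (mul m)"
proof (cases "bdd_meas m")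
  case True
  then obtain B where "\<And>x. cmod (m x) \<le> B" by (auto simp: bdd_meas_def)
  from norm_mul_le[OF this] show ?thesis
    by (intro bounded_linear_intro[of _ B]) (auto simp: mul_add mul_scaleR mult.commute)
next
  case False
  then have "mul m = (\<lambda>F. 0)" by (auto simp: mul_not_bdd_meas)
  then show ?thesis by (simp add: bounded_linear_zero)
qed

lemmas mul_diff = linear_diff[OF bounded_linear.linear[OF bounded_linear_mul]]
lemmas mul_sum = linear_sum[OF bounded_linear.linear[OF bounded_linear_mul]]
lemmas mul_minus = linear_neg[OF bounded_linear.linear[OF bounded_linear_mul]]
lemmas tendsto_mul = bounded_linear.tendsto[OF bounded_linear_mul]

lemma inner_mul:
  assumes "bdd_meas m"
  shows "inner (mul m F) G = inner F (mul (\<lambda>x. cnj (m x)) G)"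
proof -
  have c: "bdd_meas (\<lambda>x. cnj (m x))"
    using assms by (auto simp: bdd_meas_def intro: measurable_cnj)
  obtain f where f: "f \<in> L2" "F = cls f" by (rule lsq_cases)
  obtain g where g: "g \<in> L2" "G = cls g" by (rule lsq_cases)
  show ?thesis
    unfolding f(2) g(2) mul_cls[OF assms f(1)] mul_cls[OF c g(1)]
      inner_cls[OF L2_mult_bdd_meas[OF assms f(1)] g(1)] inner_cls[OF f(1) L2_mult_bdd_meas[OF c g(1)]]
    by (simp add: l2_inner_def mult_ac)
qed

lemma bdd_meas_mult: "bdd_meas m \<Longrightarrow> bdd_meas n \<Longrightarrow> bdd_meas (\<lambda>x. m x * n x)"
  unfolding bdd_meas_def norm_mult
  by (auto simp: borel_measurable_times) (meson mult_mono norm_ge_zero order_trans)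

lemma mul_mul:
  assumes "bdd_meas m" "bdd_meas n"
  shows "mul m (mul n F) = mul (\<lambda>x. m x * n x) F"
proof -
  obtain f where f: "f \<in> L2" "F = cls f" by (rule lsq_cases)
  then show ?thesis
    using assms by (simp add: mul_cls L2_mult_bdd_meas bdd_meas_mult mult.assoc)
qed

lemma bdd_meas_const: "bdd_meas (\<lambda>x. c)"
  by (auto simp: bdd_meas_def)

lemma mul_one: "mul (\<lambda>x. 1) F = F"
proof -
  obtain f where f: "f \<in> L2" "F = cls f" by (rule lsq_cases)
  then show ?thesis by (simp add: mul_cls bdd_meas_const)
qed

lemma mul_of_real: "mul (\<lambda>x. complex_of_real r) F = r *\<^sub>R F"
proof -
  obtain h where h: "h \<in> L2" "F = cls h" by (rule lsq_cases)
  show ?thesis unfolding h(2) mul_cls[OF bdd_meas_const h(1)] cls_scaleR[OF h(1), symmetric]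
    by (simp add: scaleR_conv_of_real)
qed

text \<open>Uniformly bounded multipliers that converge only pointwise converge strongly as
  operators: \<open>(2 * B)\<^sup>2 * (cmod (f x))\<^sup>2\<close> dominates the squared
  differences. This is how every cutoff is later removed.\<close>

lemma tendsto_mul_strong:
  assumes m: "\<And>k. m k \<in> borel_measurable lebesgue" and B: "\<And>k x. cmod (m k x) \<le> B"
    and lim: "\<And>x::'a::euclidean_space. (\<lambda>k. m k x) \<longlonglongrightarrow> c"
  shows "(\<lambda>k. mul (m k) F) \<longlonglongrightarrow> mul (\<lambda>x. c) F"
proof -
  obtain f where f: "f \<in> L2" "F = cls f" by (rule lsq_cases)
  have bm: "bdd_meas (m k)" for k using m B by (auto simp: bdd_meas_def)
  have eq: "norm (mul (m k) F - mul (\<lambda>x. c) F) = sqrt (LINT x|lebesgue. (cmod (m k x * f x - c * f x))\<^sup>2)" for k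
    unfolding f(2) mul_cls[OF bm f(1)] mul_cls[OF bdd_meas_const f(1)]
    by (subst cls_diff[symmetric])
      (auto simp: norm_cls L2_diff L2_mult_bdd_meas bm bdd_meas_const f l2_norm_def)
  have c: "cmod c \<le> B"
    by (rule LIMSEQ_le_const2[OF tendsto_norm[OF lim[of undefined]]]) (use B in auto)
  have "(\<lambda>k. LINT x|lebesgue. (cmod (m k x * f x - c * f x))\<^sup>2) \<longlonglongrightarrow> (LINT x|(lebesgue :: 'a measure). 0 :: real)"
  proof (rule Bochner_Integration.integral_dominated_convergence[where w = "\<lambda>x. (2 * B)\<^sup>2 * (cmod (f x))\<^sup>2"])
    show "(\<lambda>x. (cmod (m k x * f x - c * f x))\<^sup>2) \<in> borel_measurable lebesgue" for k
      using m L2_measurable[OF f(1)] by auto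
    show "integrable lebesgue (\<lambda>x. (2 * B)\<^sup>2 * (cmod (f x))\<^sup>2)"
      using L2_integrable[OF f(1)] by simp
    have "(\<lambda>k. (cmod (m k x * f x - c * f x))\<^sup>2) \<longlonglongrightarrow> (cmod (c * f x - c * f x))\<^sup>2" for x
      by (intro tendsto_intros lim)
    then show "AE x in lebesgue. (\<lambda>k. (cmod (m k x * f x - c * f x))\<^sup>2) \<longlonglongrightarrow> 0" by simp
    have "cmod (m k x - c) \<le> 2 * B" for k x
      using norm_triangle_ineq4[of "m k x" c] B[of k x] c by linarith
    then show "AE x in lebesgue. norm ((cmod (m k x * f x - c * f x))\<^sup>2) \<le> (2 * B)\<^sup>2 * (cmod (f x))\<^sup>2" for k
      unfolding left_diff_distrib[symmetric] norm_mult power_mult_distrib[of "cmod _"]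
      by (intro AE_I2) (simp only: real_norm_def abs_mult abs_power2 abs_norm_cancel,
        intro mult_right_mono power_mono, auto)
  qed simp
  then have "(\<lambda>k. norm (mul (m k) F - mul (\<lambda>x. c) F)) \<longlonglongrightarrow> sqrt 0"
    unfolding eq by (intro tendsto_real_sqrt) simp
  then show ?thesis by (simp add: LIM_zero_cancel tendsto_norm_zero_iff)
qed

subsection \<open>Operators in Hilbert space\<close>

lemma subspace_closure:
  fixes S :: "'v::real_normed_vector set"
  assumes "subspace S"
  shows "subspace (closure S)"
proof (rule subspaceI; clarsimp simp: closure_sequential)
  show "\<exists>x. (\<forall>n. x n \<in> S) \<and> x \<longlonglongrightarrow> 0"
    using subspace_0[OF assms] by (intro exI[of _ "\<lambda>_. 0"]) auto
next
  fix x y :: 'v and f g :: "nat \<Rightarrow> 'v"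
  assume "\<forall>n. f n \<in> S" "f \<longlonglongrightarrow> x" "\<forall>n. g n \<in> S" "g \<longlonglongrightarrow> y"
  then show "\<exists>z. (\<forall>n. z n \<in> S) \<and> z \<longlonglongrightarrow> x + y"
    by (intro exI[of _ "\<lambda>n. f n + g n"]) (auto intro: subspace_add[OF assms] tendsto_add)
next
  fix c :: real and x :: 'v and f :: "nat \<Rightarrow> 'v"
  assume "\<forall>n. f n \<in> S" "f \<longlonglongrightarrow> x"
  then show "\<exists>z. (\<forall>n. z n \<in> S) \<and> z \<longlonglongrightarrow> c *\<^sub>R x"
    by (intro exI[of _ "\<lambda>n. c *\<^sub>R f n"]) (auto intro: subspace_scale[OF assms] tendsto_intros)
qed

text \<open>The projection argument: a minimising sequence for the distance from \<open>x\<close> to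
  \<open>S\<close> is Cauchy, and \<open>x\<close> minus its limit is orthogonal to
  \<open>S\<close>, hence zero.\<close>

lemma dense_if_orthogonal_trivial:
  fixes S :: "'h::{real_inner, complete_space} set"
  assumes S: "subspace S" and orth: "\<And>h. (\<And>s. s \<in> S \<Longrightarrow> inner h s = 0) \<Longrightarrow> h = 0"
  shows "closure S = UNIV"
proof -
  have "x \<in> closure S" for x
  proof -
    define d where "d = infdist x S"
    have S0: "S \<noteq> {}" using subspace_0[OF S] by auto
    have d0: "0 \<le> d" by (simp add: d_def infdist_nonneg)
    have dle: "d \<le> norm (x - s)" if "s \<in> S" for s
      using infdist_le[OF that, of x] by (simp add: d_def dist_norm)
    have "\<exists>s\<in>S. norm (x - s) < d + 1 / real (Suc n)" for n
    proof (rule ccontr)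
      assume "\<not> ?thesis"
      then have "d + 1 / real (Suc n) \<le> infdist x S"
        unfolding infdist_notempty[OF S0] using S0 by (intro cINF_greatest) (auto simp: dist_norm not_less)
      then show False by (simp add: d_def)
    qed
    then obtain s where s: "\<And>n. s n \<in> S" "\<And>n. norm (x - s n) < d + 1 / real (Suc n)" by metis
    \<comment> \<open>The midpoint of two members of the sequence lies in \<open>S\<close> and is
      thus at distance at least \<open>d\<close> from \<open>x\<close>; the rest is the
      parallelogram identity.\<close>
    have par: "(norm (s m - s n))\<^sup>2 \<le> 2 * (norm (x - s m))\<^sup>2 + 2 * (norm (x - s n))\<^sup>2 - 4 * d\<^sup>2" for m n
    proof -
      have "(1/2) *\<^sub>R (s m + s n) \<in> S"
        by (intro subspace_scale subspace_add S s)
      then have "d\<^sup>2 \<le> (norm (x - (1/2) *\<^sub>R (s m + s n)))\<^sup>2"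
        using dle d0 by (intro power_mono) auto
      also have "4 * \<dots> = 2 * (norm (x - s m))\<^sup>2 + 2 * (norm (x - s n))\<^sup>2 - (norm (s m - s n))\<^sup>2"
        unfolding power2_norm_eq_inner by (simp add: algebra_simps inner_commute)
      finally show ?thesis by linarith
    qed
    have lim: "(\<lambda>n. norm (x - s n)) \<longlonglongrightarrow> d"
    proof (rule tendsto_sandwich[of "\<lambda>n. d" _ _ "\<lambda>n. d + 1 / real (Suc n)"])
      show "(\<lambda>n. d + 1 / real (Suc n)) \<longlonglongrightarrow> d"
        using tendsto_add[OF tendsto_const LIMSEQ_Suc[OF lim_1_over_n], of d] by simp
      show "\<forall>\<^sub>F n in sequentially. norm (x - s n) \<le> d + 1 / real (Suc n)"
        by (intro always_eventually allI less_imp_le s(2))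
      show "\<forall>\<^sub>F n in sequentially. d \<le> norm (x - s n)"
        by (intro always_eventually allI dle s(1))
    qed auto
    have "Cauchy s"
    proof (rule metric_CauchyI)
      fix e :: real assume "e > 0"
      have "(\<lambda>n. (norm (x - s n))\<^sup>2) \<longlonglongrightarrow> d\<^sup>2"
        by (intro tendsto_intros lim)
      then have "\<forall>\<^sub>F n in sequentially. (norm (x - s n))\<^sup>2 < d\<^sup>2 + e\<^sup>2 / 4"
        by (rule order_tendstoD) (use \<open>e > 0\<close> in simp)
      then obtain N where N: "\<And>n. n \<ge> N \<Longrightarrow> (norm (x - s n))\<^sup>2 < d\<^sup>2 + e\<^sup>2 / 4"
        by (auto simp: eventually_sequentially)
      have "dist (s m) (s n) < e" if "m \<ge> N" "n \<ge> N" for m n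
      proof -
        have "(norm (s m - s n))\<^sup>2 < e\<^sup>2"
          using par[of m n] N[OF that(1)] N[OF that(2)] by linarith
        then show ?thesis
          using \<open>e > 0\<close> by (simp add: dist_norm power_less_imp_less_base[of _ 2])
      qed
      then show "\<exists>M. \<forall>m\<ge>M. \<forall>n\<ge>M. dist (s m) (s n) < e" by blast
    qed
    then obtain p where p: "s \<longlonglongrightarrow> p"
      by (auto simp: Cauchy_convergent_iff convergent_def)
    have "(\<lambda>n. norm (x - s n)) \<longlonglongrightarrow> norm (x - p)"
      by (intro tendsto_intros p)
    with lim have np: "norm (x - p) = d" by (rule LIMSEQ_unique[rotated])
    have "x - p = 0"
    proof (rule orth)
      fix v assume v: "v \<in> S"
      define c where "c = inner (x - p) v"
      have t: "d\<^sup>2 \<le> d\<^sup>2 - 2 * t * c + t\<^sup>2 * (norm v)\<^sup>2" for t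
      proof -
        have "(\<lambda>n. norm (x - (s n + t *\<^sub>R v))) \<longlonglongrightarrow> norm (x - (p + t *\<^sub>R v))"
          by (intro tendsto_intros p)
        then have "d \<le> norm (x - (p + t *\<^sub>R v))"
          by (rule LIMSEQ_le_const) (auto intro!: dle subspace_add[OF S] subspace_scale[OF S] s v)
        then have "d\<^sup>2 \<le> (norm (x - p - t *\<^sub>R v))\<^sup>2"
          using d0 by (intro power_mono) (auto simp: algebra_simps)
        also have "\<dots> = d\<^sup>2 - 2 * t * c + t\<^sup>2 * (norm v)\<^sup>2"
          unfolding np[symmetric] c_def power2_norm_eq_inner
          by (simp add: algebra_simps inner_commute power2_eq_square)
        finally show ?thesis .
      qed
      show "inner (x - p) v = 0"
      proof (cases "v = 0")
        case False
        define N where "N = (norm v)\<^sup>2"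
        have N: "N > 0" using False by (simp add: N_def)
        have "(c / N)\<^sup>2 * N = c\<^sup>2 / N" using N by (simp add: power2_eq_square)
        \<comment> \<open>\<open>c / N\<close> minimises the quadratic in \<open>t\<close>.\<close>
        with t[of "c / N"] have "c\<^sup>2 / N \<le> 0"
          unfolding N_def[symmetric] by (simp add: power2_eq_square)
        with N have "c\<^sup>2 \<le> 0" by (simp add: divide_le_0_iff)
        then show ?thesis by (simp add: c_def)
      qed simp
    qed
    then show "x \<in> closure S"
      using p s(1) by (auto simp: closure_sequential)
  qed
  then show ?thesis by blast
qed

lemma inner_le_norm: "inner x y \<le> norm x * norm y"
  using Cauchy_Schwarz_ineq2[of x y] by linarith

text \<open>A pair in \<open>Q\<close> holds the value of an operator and of its perturbation on one
  vector. If \<open>h\<close> is orthogonal to all sums, then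
  \<open>inner h p = - inner h q\<close>, which is at most \<open>c * norm h * norm p\<close>;
  letting \<open>p\<close> approach \<open>h\<close> gives
  \<open>(norm h)\<^sup>2 \<le> c * (norm h)\<^sup>2\<close>.\<close>

lemma Kato_Rellich_dense:
  fixes Q :: "('h::{real_inner, complete_space} \<times> 'h) set"
  assumes Q: "subspace Q" and dense: "closure (fst ` Q) = UNIV"
    and c: "c < 1" and le: "\<And>p q. (p, q) \<in> Q \<Longrightarrow> norm q \<le> c * norm p"
  shows "closure ((\<lambda>(p, q). p + q) ` Q) = UNIV"
proof (rule dense_if_orthogonal_trivial)
  have "linear (\<lambda>(p, q). p + q :: 'h)"
    by (rule linearI) (auto simp: scaleR_right_distrib)
  then show "subspace ((\<lambda>(p, q). p + q) ` Q)"
    using Q by (rule linear_subspace_image)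
next
  fix h assume orth: "\<And>s. s \<in> (\<lambda>(p, q). p + q) ` Q \<Longrightarrow> inner h s = 0"
  have "h \<in> closure (fst ` Q)" using dense by simp
  then obtain z where z: "\<And>n. z n \<in> fst ` Q" "z \<longlonglongrightarrow> h"
    by (auto simp: closure_sequential)
  have "\<exists>q. (z n, q) \<in> Q" for n
  proof -
    obtain p q where "(p, q) \<in> Q" "z n = p" using z(1)[of n] by auto
    then show ?thesis by blast
  qed
  then obtain q where q: "\<And>n. (z n, q n) \<in> Q" by metis
  have "inner h (z n) \<le> norm h * (c * norm (z n))" for n
  proof -
    have "inner h (z n + q n) = 0" by (rule orth) (use q[of n] in force)
    then have "inner h (z n) = inner h (- q n)" by (simp add: inner_add_right)
    also have "\<dots> \<le> norm h * norm (q n)" using inner_le_norm[of h "- q n"] by simp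
    also have "\<dots> \<le> norm h * (c * norm (z n))" by (intro mult_left_mono le q) auto
    finally show ?thesis .
  qed
  then have "inner h h \<le> norm h * (c * norm h)"
    by (intro LIMSEQ_le[of "\<lambda>n. inner h (z n)" _ "\<lambda>n. norm h * (c * norm (z n))"] tendsto_intros z) auto
  then have "(norm h)\<^sup>2 * (1 - c) \<le> 0"
    by (simp add: power2_norm_eq_inner[symmetric] power2_eq_square algebra_simps)
  with c show "h = 0" by (simp add: mult_le_0_iff)
qed

text \<open>The lower bound turns a convergent sequence of images into a Cauchy sequence of
  preimages, so a dense range becomes the full space once the graph is closed.\<close>

lemma closure_range_graph:
  fixes G :: "('h::{real_inner, complete_space} \<times> 'h) set"
  assumes G: "subspace G" and l: "l > 0" and d: "d > 0"
    and low: "\<And>f g. (f, g) \<in> G \<Longrightarrow> norm (g + l *\<^sub>R f) \<ge> d * norm f"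
    and dense: "closure ((\<lambda>(f, g). g + l *\<^sub>R f) ` G) = UNIV"
  obtains f where "(f, h - l *\<^sub>R f) \<in> closure G"
proof -
  have "h \<in> closure ((\<lambda>(f, g). g + l *\<^sub>R f) ` G)" using dense by simp
  then obtain z where z: "\<And>n. z n \<in> (\<lambda>(f, g). g + l *\<^sub>R f) ` G" "z \<longlonglongrightarrow> h"
    by (auto simp: closure_sequential)
  have "\<exists>f. (f, z n - l *\<^sub>R f) \<in> G" for n
  proof -
    obtain f g where "(f, g) \<in> G" "z n = g + l *\<^sub>R f" using z(1)[of n] by auto
    then show ?thesis by (intro exI[of _ f]) simp
  qed
  then obtain f where f: "\<And>n. (f n, z n - l *\<^sub>R f n) \<in> G" by metis
  have "Cauchy f"
  proof (rule metric_CauchyI)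
    fix e :: real assume "e > 0"
    then obtain N where N: "\<And>m n. m \<ge> N \<Longrightarrow> n \<ge> N \<Longrightarrow> dist (z m) (z n) < d * e"
      using metric_CauchyD[OF LIMSEQ_imp_Cauchy[OF z(2)], of "d * e"] d by auto
    have "dist (f m) (f n) < e" if "m \<ge> N" "n \<ge> N" for m n
    proof -
      have "(f m - f n, (z m - l *\<^sub>R f m) - (z n - l *\<^sub>R f n)) \<in> G"
        using subspace_diff[OF G f[of m] f[of n]] by simp
      from low[OF this] have "d * norm (f m - f n) \<le> norm (z m - z n)"
        by (simp add: algebra_simps)
      also have "\<dots> < d * e" using N[OF that] by (simp add: dist_norm)
      finally show ?thesis using d by (simp add: dist_norm)
    qed
    then show "\<exists>M. \<forall>m\<ge>M. \<forall>n\<ge>M. dist (f m) (f n) < e" by blast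
  qed
  then obtain F where F: "f \<longlonglongrightarrow> F"
    by (auto simp: Cauchy_convergent_iff convergent_def)
  have "(\<lambda>n. (f n, z n - l *\<^sub>R f n)) \<longlonglongrightarrow> (F, h - l *\<^sub>R F)"
    by (intro tendsto_intros F z)
  with f have "(F, h - l *\<^sub>R F) \<in> closure G"
    unfolding closure_sequential by (intro exI[of _ "\<lambda>n. (f n, z n - l *\<^sub>R f n)"]) auto
  with that show ?thesis .
qed

text \<open>The resolvents $R_\lambda = (G+\lambda)^{-1}$ exist for every $\lambda > 0$, and
  $\lambda \mapsto \langle R_\lambda h, h\rangle$ has derivative $-\|R_\lambda h\|^2 \le 0$
  and tends to $0$ at infinity, so it is nonnegative.\<close>

lemma symmetric_graph_nonneg:
  fixes G :: "('h::{real_inner, complete_space} \<times> 'h) set"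
  assumes G: "subspace G" and d: "d > 0"
    and sym: "\<And>f g f' g'. (f, g) \<in> G \<Longrightarrow> (f', g') \<in> G \<Longrightarrow> inner g f' = inner f g'"
    and low: "\<And>f g l. (f, g) \<in> G \<Longrightarrow> l > 0 \<Longrightarrow> norm (g + l *\<^sub>R f) \<ge> d * l * norm f"
    and dense: "\<And>l. l > 0 \<Longrightarrow> closure ((\<lambda>(f, g). g + l *\<^sub>R f) ` G) = UNIV"
    and fg: "(f, g) \<in> G"
  shows "inner g f \<ge> 0"
proof -
  have C: "subspace (closure G)" by (rule subspace_closure[OF G])
  have lowC: "norm (g + l *\<^sub>R f) \<ge> d * l * norm f" if "(f, g) \<in> closure G" "l > 0" for f g l
  proof -
    obtain z where z: "\<And>n. z n \<in> G" "z \<longlonglongrightarrow> (f, g)"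
      using \<open>(f, g) \<in> closure G\<close> by (auto simp: closure_sequential)
    have "d * l * norm (fst (z n)) \<le> norm (snd (z n) + l *\<^sub>R fst (z n))" for n
      using low[of "fst (z n)" "snd (z n)" l] z that by simp
    moreover have "(\<lambda>n. d * l * norm (fst (z n))) \<longlonglongrightarrow> d * l * norm (fst (f, g))"
      by (intro tendsto_intros z)
    moreover have "(\<lambda>n. norm (snd (z n) + l *\<^sub>R fst (z n))) \<longlonglongrightarrow> norm (snd (f, g) + l *\<^sub>R fst (f, g))"
      by (intro tendsto_intros z)
    ultimately show ?thesis by (auto intro: LIMSEQ_le)
  qed
  have symC: "inner g f' = inner f g'" if fg: "(f, g) \<in> closure G" and fg': "(f', g') \<in> closure G" for f g f' g'
  proof -
    obtain z where z: "\<And>n. z n \<in> G" "z \<longlonglongrightarrow> (f, g)"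
      using fg by (auto simp: closure_sequential)
    obtain y where y: "\<And>n. y n \<in> G" "y \<longlonglongrightarrow> (f', g')"
      using fg' by (auto simp: closure_sequential)
    have "inner (snd (z n)) (fst (y n)) = inner (fst (z n)) (snd (y n))" for n
      using sym[of "fst (z n)" "snd (z n)" "fst (y n)" "snd (y n)"] z y by simp
    moreover have "(\<lambda>n. inner (snd (z n)) (fst (y n))) \<longlonglongrightarrow> inner (snd (f, g)) (fst (f', g'))"
      by (intro tendsto_intros z y)
    moreover have "(\<lambda>n. inner (fst (z n)) (snd (y n))) \<longlonglongrightarrow> inner (fst (f, g)) (snd (f', g'))"
      by (intro tendsto_intros z y)
    ultimately show ?thesis by (auto intro: LIMSEQ_unique)
  qed
  have "\<exists>f. (f, h - l *\<^sub>R f) \<in> closure G" if "l > 0" for h l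
    by (rule closure_range_graph[OF G that _ _ dense[OF that], of "d * l" h]) (use low d that in auto)
  then obtain R where R: "\<And>l h. l > 0 \<Longrightarrow> (R l h, h - l *\<^sub>R R l h) \<in> closure G" by metis
  have Rle: "d * l * norm (R l h) \<le> norm h" if "l > 0" for l h
    using lowC[OF R[OF that] that, of h] by simp
  \<comment> \<open>The resolvent identity in weak form: symmetry of the closed graph applied to the
    two resolvent pairs of \<open>h\<close>.\<close>
  have res: "inner (R l h) h - inner (R m h) h = (m - l) * inner (R l h) (R m h)" if "l > 0" "m > 0" for l m h
    using symC[OF R[OF that(1), of h] R[OF that(2), of h]] by (simp add: algebra_simps inner_commute)
  have lip: "d * l * norm (R l h - R m h) \<le> \<bar>m - l\<bar> * norm (R m h)" if "l > 0" "m > 0" for l m h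
  proof -
    have "(R l h - R m h, (h - l *\<^sub>R R l h) - (h - m *\<^sub>R R m h)) \<in> closure G"
      using subspace_diff[OF C R[OF that(1), of h] R[OF that(2), of h]] by simp
    from lowC[OF this that(1)] have "d * l * norm (R l h - R m h) \<le> norm ((m - l) *\<^sub>R R m h)"
      by (simp add: algebra_simps)
    then show ?thesis by simp
  qed
  have pos: "0 \<le> inner (R l h) h" if l: "l > 0" for l h
  proof -
    have der: "((\<lambda>l. inner (R l h) h) has_real_derivative - inner (R l h) (R l h)) (at l)" if l: "l > 0" for l
      unfolding has_field_derivative_iff
    proof (rule Lim_transform_eventually)
      \<comment> \<open>Staying above \<open>l / 2\<close> keeps the factor \<open>d * m\<close> of
        the Lipschitz estimate away from zero.\<close>
      have ev: "\<forall>\<^sub>F m in at l. m > l / 2"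
        using l by (intro eventually_at_topological[THEN iffD2] exI[of _ "{l/2<..}"]) auto
      have "((\<lambda>m. R m h) \<longlongrightarrow> R l h) (at l)"
      proof (rule LIM_zero_cancel, rule tendsto_norm_zero_cancel)
        show "((\<lambda>m. norm (R m h - R l h)) \<longlongrightarrow> 0) (at l)"
        proof (rule tendsto_sandwich[of "\<lambda>_. 0" _ _ "\<lambda>m. \<bar>l - m\<bar> * norm (R l h) / (d * (l / 2))"])
          show "\<forall>\<^sub>F m in at l. norm (R m h - R l h) \<le> \<bar>l - m\<bar> * norm (R l h) / (d * (l / 2))"
            using ev
          proof eventually_elim
            case (elim m)
            have "d * (l / 2) * norm (R m h - R l h) \<le> d * m * norm (R m h - R l h)"
              using elim d by (intro mult_right_mono mult_left_mono) auto
            also have "\<dots> \<le> \<bar>l - m\<bar> * norm (R l h)"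
              using lip[of m l h] elim l by simp
            finally show ?case using d l by (simp add: field_simps)
          qed
          have "((\<lambda>m. \<bar>l - m\<bar> * norm (R l h) / (d * (l / 2))) \<longlongrightarrow> \<bar>l - l\<bar> * norm (R l h) / (d * (l / 2))) (at l)"
            by (intro tendsto_intros) (use d l in auto)
          then show "((\<lambda>m. \<bar>l - m\<bar> * norm (R l h) / (d * (l / 2))) \<longlongrightarrow> 0) (at l)" by simp
        qed auto
      qed
      then show "((\<lambda>m. - inner (R l h) (R m h)) \<longlongrightarrow> - inner (R l h) (R l h)) (at l)"
        by (intro tendsto_intros)
      show "\<forall>\<^sub>F m in at l. - inner (R l h) (R m h) = (inner (R m h) h - inner (R l h) h) / (m - l)"
        using ev eventually_neq_at_within[of l l UNIV]
      proof eventually_elim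
        case (elim m)
        then show ?case using res[of l m h] l by (simp add: field_simps)
      qed
    qed
    have dec: "inner (R m h) h \<le> inner (R l h) h" if "m \<ge> l" for m
    proof (rule DERIV_nonpos_imp_nonincreasing[OF that])
      show "\<exists>y. ((\<lambda>l. inner (R l h) h) has_real_derivative y) (at x) \<and> y \<le> 0" if "l \<le> x" for x
        using der[of x] that l by (intro exI[of _ "- inner (R x h) (R x h)"]) auto
    qed
    have low2: "- ((norm h)\<^sup>2 / d) * inverse m \<le> inner (R l h) h" if "m \<ge> l" for m
    proof -
      have m: "m > 0" using that l by simp
      have "- inner (R m h) h \<le> norm (R m h) * norm h"
        using inner_le_norm[of "- R m h" h] by simp
      also have "\<dots> \<le> (norm h / (d * m)) * norm h"
        using Rle[OF m, of h] d m by (intro mult_right_mono) (auto simp: field_simps)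
      finally have "- ((norm h)\<^sup>2 / d) * inverse m \<le> inner (R m h) h"
        using d m by (simp add: field_simps power2_eq_square)
      also have "\<dots> \<le> inner (R l h) h" by (rule dec[OF that])
      finally show ?thesis .
    qed
    have "((\<lambda>m. - ((norm h)\<^sup>2 / d) * inverse m) \<longlongrightarrow> - ((norm h)\<^sup>2 / d) * 0) at_top"
      by (intro tendsto_intros tendsto_inverse_0_at_top filterlim_ident)
    then have "- ((norm h)\<^sup>2 / d) * 0 \<le> inner (R l h) h"
      by (rule tendsto_upperbound) (use low2 in \<open>auto simp: eventually_at_top_linorder\<close>)
    then show ?thesis by simp
  qed
  \<comment> \<open>By the lower bound, \<open>f\<close> is itself the resolvent of
    \<open>h = g + l f\<close>, so nonnegativity of the resolvent form speaks about every element of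
    the graph. Afterwards \<open>l\<close> tends to 0.\<close>
  have "0 \<le> inner f (g + l *\<^sub>R f)" if l: "l > 0" for l
  proof -
    define h where "h = g + l *\<^sub>R f"
    have "(f - R l h, g - (h - l *\<^sub>R R l h)) \<in> closure G"
      using subspace_diff[OF C subsetD[OF closure_subset fg] R[OF l, of h]] by simp
    from lowC[OF this l] have "d * l * norm (f - R l h) \<le> 0"
      by (simp add: h_def algebra_simps)
    moreover have "0 < d * l" using d l by simp
    ultimately have "norm (f - R l h) \<le> 0"
      using mult_pos_pos[of "d * l" "norm (f - R l h)"] by linarith
    then have "R l h = f" by simp
    with pos[OF l, of h] have "0 \<le> inner f h" by (simp only:)
    then show ?thesis by (simp only: h_def)
  qed
  moreover have "((\<lambda>l. inner f (g + l *\<^sub>R f)) \<longlongrightarrow> inner f (g + 0 *\<^sub>R f)) (at_right 0)"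
    by (intro tendsto_intros)
  ultimately have "0 \<le> inner f (g + 0 *\<^sub>R f)"
    by (intro tendsto_lowerbound[of _ _ "at_right 0"]) (auto simp: eventually_at_right_less intro: eventually_at_rightI[of 0 1])
  then show ?thesis by (simp add: inner_commute)
qed

subsection \<open>Smooth functions\<close>

lemma dir_deriv_eqI: "(f has_derivative f') (at x) \<Longrightarrow> dir_deriv v f x = f' v"
  by (simp add: dir_deriv_def frechet_derivative_at[symmetric])

lemma differentiable_on_UNIV_has_derivative:
  "f differentiable_on UNIV \<Longrightarrow> (f has_derivative frechet_derivative f (at x)) (at x)"
  by (simp add: differentiable_on_def frechet_derivative_works)

lemma dir_deriv_linear_Basis:
  assumes "f differentiable_on UNIV"
  shows "dir_deriv v f x = (\<Sum>b\<in>Basis. (v \<bullet> b) *\<^sub>R dir_deriv b f x)"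
proof -
  have l: "linear (frechet_derivative f (at x))"
    using differentiable_on_UNIV_has_derivative[OF assms] has_derivative_linear by blast
  have "dir_deriv v f x = frechet_derivative f (at x) (\<Sum>b\<in>Basis. (v \<bullet> b) *\<^sub>R b)"
    by (simp add: dir_deriv_def euclidean_representation)
  also have "\<dots> = (\<Sum>b\<in>Basis. (v \<bullet> b) *\<^sub>R dir_deriv b f x)"
    by (simp add: linear_sum[OF l] linear_scale[OF l] dir_deriv_def)
  finally show ?thesis .
qed

lemma C_k_Suc_imp: "C_k (Suc k) f \<Longrightarrow> C_k k f"
  by (induction k arbitrary: f) (auto intro: differentiable_imp_continuous_on)

lemma dir_deriv_bilinear:
  assumes "bounded_bilinear p" "f differentiable_on UNIV" "g differentiable_on UNIV"
  shows "dir_deriv v (\<lambda>x. p (f x) (g x)) = (\<lambda>x. p (f x) (dir_deriv v g x) + p (dir_deriv v f x) (g x))"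
  by (intro ext, subst dir_deriv_eqI[OF bounded_bilinear.FDERIV[OF assms(1)
      differentiable_on_UNIV_has_derivative[OF assms(2)] differentiable_on_UNIV_has_derivative[OF assms(3)]]])
    (simp add: dir_deriv_def)

lemma dir_deriv_add:
  assumes "f differentiable_on UNIV" "g differentiable_on UNIV"
  shows "dir_deriv v (\<lambda>x. f x + g x) = (\<lambda>x. dir_deriv v f x + dir_deriv v g x)"
  by (intro ext, subst dir_deriv_eqI[OF has_derivative_add[OF
      differentiable_on_UNIV_has_derivative[OF assms(1)] differentiable_on_UNIV_has_derivative[OF assms(2)]]])
    (simp add: dir_deriv_def)

lemma dir_deriv_bounded_linear:
  assumes "bounded_linear L" "f differentiable_on UNIV"
  shows "dir_deriv v (\<lambda>x. L (f x)) = (\<lambda>x. L (dir_deriv v f x))"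
  by (intro ext, subst dir_deriv_eqI[OF bounded_linear.has_derivative[OF assms(1)
      differentiable_on_UNIV_has_derivative[OF assms(2)]]])
    (simp add: dir_deriv_def)

lemma dir_deriv_const: "dir_deriv v (\<lambda>x. c) = (\<lambda>x. 0)"
  by (intro ext dir_deriv_eqI) (rule has_derivative_const)

lemma C_k_const: "C_k k (\<lambda>x. c)"
  by (induction k arbitrary: c) (auto simp: dir_deriv_const)

lemma C_k_add: "C_k k f \<Longrightarrow> C_k k g \<Longrightarrow> C_k k (\<lambda>x. f x + g x)"
  by (induction k arbitrary: f g) (auto simp: dir_deriv_add intro: continuous_on_add)

lemma C_k_bounded_linear: "bounded_linear L \<Longrightarrow> C_k k f \<Longrightarrow> C_k k (\<lambda>x. L (f x))"
proof (induction k arbitrary: f)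
  case 0
  then show ?case by (auto intro: bounded_linear.continuous_on)
next
  case (Suc k)
  then have d: "f differentiable_on UNIV" by simp
  have "(\<lambda>x. L (f x)) differentiable_on UNIV"
    unfolding differentiable_on_def differentiable_def
    using bounded_linear.has_derivative[OF Suc.prems(1) differentiable_on_UNIV_has_derivative[OF d]] by blast
  then show ?case
    using Suc by (simp add: dir_deriv_bounded_linear[OF Suc.prems(1) d])
qed

lemma C_k_bilinear:
  assumes "bounded_bilinear p"
  shows "C_k k f \<Longrightarrow> C_k k g \<Longrightarrow> C_k k (\<lambda>x. p (f x) (g x))"
proof (induction k arbitrary: f g)
  case 0
  then show ?case using bounded_bilinear.continuous_on[OF assms] by simp
next
  case (Suc k)
  then have d: "f differentiable_on UNIV" "g differentiable_on UNIV" by auto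
  have "(\<lambda>x. p (f x) (g x)) differentiable_on UNIV"
    unfolding differentiable_on_def differentiable_def
    using bounded_bilinear.FDERIV[OF assms differentiable_on_UNIV_has_derivative[OF d(1)]
      differentiable_on_UNIV_has_derivative[OF d(2)]] by blast
  moreover have "C_k k f" "C_k k g" using Suc.prems by (blast intro: C_k_Suc_imp)+
  ultimately show ?case
    using Suc.IH Suc.prems by (simp add: dir_deriv_bilinear[OF assms d] C_k_add)
qed

definition smooth :: "('a::euclidean_space \<Rightarrow> 'b::real_normed_vector) \<Rightarrow> bool" where
  "smooth f \<longleftrightarrow> (\<forall>k. C_k k f)"

lemma smooth_differentiable: "smooth f \<Longrightarrow> f differentiable_on UNIV"
  unfolding smooth_def using C_k.simps(2) by blast

lemma smooth_has_derivative: "smooth f \<Longrightarrow> (f has_derivative frechet_derivative f (at x)) (at x)"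
  by (intro differentiable_on_UNIV_has_derivative smooth_differentiable)

lemma smooth_continuous: "smooth f \<Longrightarrow> continuous_on UNIV f"
  unfolding smooth_def using C_k.simps(1) by blast

lemma smooth_dir_deriv: "smooth f \<Longrightarrow> b \<in> Basis \<Longrightarrow> smooth (dir_deriv b f)"
  unfolding smooth_def using C_k.simps(2) by blast

lemma smooth_const: "smooth (\<lambda>x. c)"
  by (simp add: smooth_def C_k_const)

lemma smooth_add: "smooth f \<Longrightarrow> smooth g \<Longrightarrow> smooth (\<lambda>x. f x + g x)"
  by (simp add: smooth_def C_k_add)

lemma smooth_bounded_linear: "bounded_linear L \<Longrightarrow> smooth f \<Longrightarrow> smooth (\<lambda>x. L (f x))"
  by (simp add: smooth_def C_k_bounded_linear)

lemma smooth_mult: "smooth f \<Longrightarrow> smooth g \<Longrightarrow> smooth (\<lambda>x. f x * g x :: 'b::real_normed_algebra)"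
  by (simp add: smooth_def C_k_bilinear[OF bounded_bilinear_mult])

lemma smooth_cmult: "smooth g \<Longrightarrow> smooth (\<lambda>x. c * g x :: 'b::real_normed_algebra)"
  by (intro smooth_mult smooth_const)

lemma smooth_scaleR: "smooth f \<Longrightarrow> smooth g \<Longrightarrow> smooth (\<lambda>x. f x *\<^sub>R g x)"
  by (simp add: smooth_def C_k_bilinear[OF bounded_bilinear_scaleR])

lemma smooth_minus: "smooth f \<Longrightarrow> smooth (\<lambda>x. - f x)"
  using smooth_bounded_linear[OF bounded_linear_minus[OF bounded_linear_ident]] .

lemma smooth_diff: "smooth f \<Longrightarrow> smooth g \<Longrightarrow> smooth (\<lambda>x. f x - g x)"
  using smooth_add[of f "\<lambda>x. - g x"] smooth_minus[of g] by simp

lemma smooth_sum: "(\<And>i. i \<in> I \<Longrightarrow> smooth (f i)) \<Longrightarrow> smooth (\<lambda>x. \<Sum>i\<in>I. f i x)"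
  by (induction I rule: infinite_finite_induct) (auto intro: smooth_const smooth_add)

lemma smooth_prod: "(\<And>i. i \<in> I \<Longrightarrow> smooth (f i)) \<Longrightarrow> smooth (\<lambda>x. \<Prod>i\<in>I. f i x :: real)"
  by (induction I rule: infinite_finite_induct) (auto intro: smooth_const smooth_mult)

lemma smooth_linear:
  assumes "bounded_linear L"
  shows "smooth L"
proof -
  have d: "(L has_derivative L) (at x)" for x
    using assms by (rule bounded_linear_imp_has_derivative)
  then have dd: "dir_deriv v L = (\<lambda>x. L v)" for v
    by (intro ext dir_deriv_eqI)
  have diff: "L differentiable_on UNIV"
    using d unfolding differentiable_on_def differentiable_def by blast
  have cont: "continuous_on UNIV L" by (rule linear_continuous_on[OF assms])
  show ?thesis
    unfolding smooth_def
  proof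
    fix k show "C_k k L"
    proof (cases k)
      case 0
      with cont show ?thesis by simp
    next
      case (Suc j)
      show ?thesis
        unfolding Suc C_k.simps(2) dd by (intro conjI ballI diff C_k_const)
    qed
  qed
qed

lemma smooth_inner_left: "smooth (\<lambda>x. x \<bullet> b)"
  by (rule smooth_linear) (rule bounded_linear_inner_left)

section \<open>Smoothness under affine substitution, reciprocals and composition\<close>

lemma has_derivative_affine:
  assumes "(f has_derivative f') (at (c *\<^sub>R x + y))"
  shows "((\<lambda>x. f (c *\<^sub>R x + y)) has_derivative (\<lambda>h. f' (c *\<^sub>R h))) (at x)"
proof -
  have "((\<lambda>x. c *\<^sub>R x + y) has_derivative (\<lambda>h. c *\<^sub>R h)) (at x)"
    by (auto intro!: derivative_eq_intros)
  from has_derivative_compose[OF this assms] show ?thesis .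
qed

lemma dir_deriv_affine:
  assumes "f differentiable_on UNIV"
  shows "dir_deriv v (\<lambda>x. f (c *\<^sub>R x + y)) x = c *\<^sub>R dir_deriv v f (c *\<^sub>R x + y)"
proof -
  note d = differentiable_on_UNIV_has_derivative[OF assms, of "c *\<^sub>R x + y"]
  from dir_deriv_eqI[OF has_derivative_affine[OF d]] show ?thesis
    by (simp add: dir_deriv_def linear_scale[OF has_derivative_linear[OF d]])
qed

lemma differentiable_affine:
  assumes "f differentiable_on UNIV"
  shows "(\<lambda>x. f (c *\<^sub>R x + y)) differentiable_on UNIV"
  unfolding differentiable_on_def differentiable_def
  using has_derivative_affine[OF differentiable_on_UNIV_has_derivative[OF assms]] by blast

lemma C_k_affine: "C_k k f \<Longrightarrow> C_k k (\<lambda>x. f (c *\<^sub>R x + y))"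
proof (induction k arbitrary: f)
  case 0
  then show ?case
    by (auto intro!: continuous_on_compose2[of UNIV f] continuous_intros)
next
  case (Suc k)
  then have "f differentiable_on UNIV" by simp
  then have "dir_deriv b (\<lambda>x. f (c *\<^sub>R x + y)) = (\<lambda>x. c *\<^sub>R dir_deriv b f (c *\<^sub>R x + y))" for b
    by (intro ext dir_deriv_affine)
  moreover have "C_k k (\<lambda>x. c *\<^sub>R dir_deriv b f (c *\<^sub>R x + y))" if "b \<in> Basis" for b
    using C_k_bounded_linear[OF bounded_linear_scaleR_right Suc.IH[of "dir_deriv b f"]] Suc.prems that by simp
  ultimately show ?case
    using differentiable_affine[OF \<open>f differentiable_on UNIV\<close>] by simp
qed

lemma smooth_affine: "smooth f \<Longrightarrow> smooth (\<lambda>x. f (c *\<^sub>R x + y))"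
  by (simp add: smooth_def C_k_affine)

lemma has_derivative_inverse_real:
  fixes f :: "'a::euclidean_space \<Rightarrow> real"
  assumes "f differentiable_on UNIV" "\<And>x. f x \<noteq> 0"
  shows "((\<lambda>x. inverse (f x)) has_derivative (\<lambda>h. - (frechet_derivative f (at x) h * (inverse (f x) * inverse (f x))))) (at x)"
  using Deriv.has_derivative_inverse[OF assms(2) differentiable_on_UNIV_has_derivative[OF assms(1)], of x]
  by (simp add: mult_ac)

lemma dir_deriv_inverse:
  fixes f :: "'a::euclidean_space \<Rightarrow> real"
  assumes "f differentiable_on UNIV" "\<And>x. f x \<noteq> 0"
  shows "dir_deriv v (\<lambda>x. inverse (f x)) = (\<lambda>x. - (dir_deriv v f x * (inverse (f x) * inverse (f x))))"
  by (intro ext) (subst dir_deriv_eqI[OF has_derivative_inverse_real[OF assms]], simp add: dir_deriv_def)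

text \<open>The derivative of a reciprocal is a product of a smooth function with two copies of the
  same reciprocal, so each order of differentiability yields the next.\<close>

lemma smooth_inverse:
  fixes f :: "'a::euclidean_space \<Rightarrow> real"
  assumes f: "smooth f" and nz: "\<And>x. f x \<noteq> 0"
  shows "smooth (\<lambda>x. inverse (f x))"
proof -
  note d = smooth_differentiable[OF f]
  have "C_k k (\<lambda>x. inverse (f x))" for k
  proof (induction k)
    case 0
    then show ?case using smooth_continuous[OF f] nz by (auto intro: continuous_on_inverse)
  next
    case (Suc k)
    have "(\<lambda>x. inverse (f x)) differentiable_on UNIV"
      unfolding differentiable_on_def differentiable_def
      using has_derivative_inverse_real[OF d nz] by blast
    moreover have "C_k k (\<lambda>x. - (dir_deriv b f x * (inverse (f x) * inverse (f x))))" if "b \<in> Basis" for b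
    proof -
      have "C_k k (dir_deriv b f)"
        using smooth_dir_deriv[OF f that] by (simp add: smooth_def)
      then have "C_k k (\<lambda>x. dir_deriv b f x * (inverse (f x) * inverse (f x)))"
        by (rule C_k_bilinear[OF bounded_bilinear_mult _ C_k_bilinear[OF bounded_bilinear_mult Suc Suc]])
      then show ?thesis
        by (rule C_k_bounded_linear[OF bounded_linear_minus[OF bounded_linear_ident]])
    qed
    ultimately show ?case
      by (simp add: dir_deriv_inverse[OF d nz])
  qed
  then show ?thesis by (simp add: smooth_def)
qed

text \<open>\<open>h j\<close> is the sequence of successive derivatives of \<open>h 0\<close>.
  Keeping \<open>j\<close> arbitrary closes the induction on the order of differentiability, because
  one derivative merely moves \<open>j\<close> on by one.\<close>

lemma smooth_compose_real:
  fixes h :: "nat \<Rightarrow> real \<Rightarrow> real" and f :: "'a::euclidean_space \<Rightarrow> real"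
  assumes h: "\<And>j s. (h j has_real_derivative h (Suc j) s) (at s)" and f: "smooth f"
  shows "smooth (\<lambda>x. h j (f x))"
proof -
  have d: "((\<lambda>x. h j (f x)) has_derivative (\<lambda>v. h (Suc j) (f x) * frechet_derivative f (at x) v)) (at x)" for j x
    by (rule has_derivative_compose[OF smooth_has_derivative[OF f]])
      (use h[of j "f x"] in \<open>simp add: has_field_derivative_def\<close>)
  have dd: "dir_deriv v (\<lambda>x. h j (f x)) = (\<lambda>x. h (Suc j) (f x) * dir_deriv v f x)" for v j
    by (intro ext) (subst dir_deriv_eqI[OF d], simp add: dir_deriv_def)
  have "C_k k (\<lambda>x. h j (f x))" for k
  proof (induction k arbitrary: j)
    case 0
    have "(\<lambda>x. h j (f x)) differentiable_on UNIV"
      using d unfolding differentiable_on_def differentiable_def by blast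
    then show ?case by (simp add: differentiable_imp_continuous_on)
  next
    case (Suc k)
    have "C_k k (\<lambda>x. h (Suc j) (f x) * dir_deriv b f x)" if "b \<in> Basis" for b
      using C_k_bilinear[OF bounded_bilinear_mult Suc] smooth_dir_deriv[OF f that] by (simp add: smooth_def)
    moreover have "(\<lambda>x. h j (f x)) differentiable_on UNIV"
      using d unfolding differentiable_on_def differentiable_def by blast
    ultimately show ?case by (simp add: dd)
  qed
  then show ?thesis by (simp add: smooth_def)
qed

text \<open>Closed under differentiation in the form \<open>flat_has_derivative\<close>, which makes
  $e^{-1/s}$ smooth.\<close>

definition flat :: "real poly \<Rightarrow> real \<Rightarrow> real" where
  "flat p s = (if s > 0 then poly p (inverse s) * exp (- inverse s) else 0)"

lemma poly_times_exp_minus_tendsto: "((\<lambda>x. poly p x * exp (- x)) \<longlongrightarrow> (0::real)) at_top"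
proof -
  have "((\<lambda>x. \<Sum>i\<le>degree p. coeff p i * (x ^ i / exp x)) \<longlongrightarrow> (\<Sum>i\<le>degree p. coeff p i * 0)) at_top"
    by (intro tendsto_sum tendsto_mult tendsto_const tendsto_power_div_exp_0)
  moreover have "(\<Sum>i\<le>degree p. coeff p i * (x ^ i / exp x)) = poly p x * exp (- x)" for x
    unfolding poly_altdef sum_distrib_right by (intro sum.cong) (auto simp: exp_minus field_simps)
  ultimately show ?thesis by simp
qed

text \<open>Differentiating \<open>p(1/s) exp(-1/s)\<close> gives
  \<open>(1/s)\<^sup>2 (p - p')(1/s) exp(-1/s)\<close>, again of the same shape; this is where the
  polynomial \<open>monom 1 2 * (p - pderiv p)\<close> comes from.\<close>

lemma flat_has_derivative:
  "(flat p has_real_derivative flat (monom 1 2 * (p - pderiv p)) s) (at s)"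
proof -
  consider "s > 0" | "s < 0" | "s = 0" by linarith
  then show ?thesis
  proof cases
    case 1
    have "((\<lambda>s. poly p (inverse s) * exp (- inverse s)) has_real_derivative
        flat (monom 1 2 * (p - pderiv p)) s) (at s)"
      using 1 by (auto intro!: derivative_eq_intros simp: flat_def poly_monom power2_eq_square algebra_simps)
    then show ?thesis
      by (rule has_field_derivative_transform_within_open[of _ _ _ "{0<..}"]) (use 1 in \<open>auto simp: flat_def\<close>)
  next
    case 2
    have "((\<lambda>s. 0) has_real_derivative flat (monom 1 2 * (p - pderiv p)) s) (at s)"
      using 2 by (auto simp: flat_def)
    then show ?thesis
      by (rule has_field_derivative_transform_within_open[of _ _ _ "{..<0}"]) (use 2 in \<open>auto simp: flat_def\<close>)
  next
    case 3
    have "((\<lambda>y. flat p y / y) \<longlongrightarrow> 0) (at_left 0)"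
      by (rule Lim_transform_eventually[OF tendsto_const])
        (auto simp: flat_def eventually_at_filter)
    moreover have "((\<lambda>y. flat p y / y) \<longlongrightarrow> 0) (at_right 0)"
    proof (rule Lim_transform_eventually)
      \<comment> \<open>Dividing by \<open>y\<close> multiplies the polynomial in \<open>1/y\<close>
        by its variable, hence \<open>pCons 0 p\<close>; the exponential still wins as
        \<open>1/y\<close> tends to infinity.\<close>
      show "((\<lambda>y. poly (pCons 0 p) (inverse y) * exp (- inverse y)) \<longlongrightarrow> 0) (at_right 0)"
        by (rule filterlim_compose[OF poly_times_exp_minus_tendsto filterlim_inverse_at_top_right])
      show "\<forall>\<^sub>F y in at_right 0. poly (pCons 0 p) (inverse y) * exp (- inverse y) = flat p y / y"
        by (rule eventually_at_rightI[of 0 1]) (auto simp: flat_def field_simps)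
    qed
    ultimately have "((\<lambda>y. flat p y / y) \<longlongrightarrow> 0) (at 0)"
      by (simp add: filterlim_split_at)
    then show ?thesis
      using 3 by (simp add: has_field_derivative_iff flat_def)
  qed
qed

lemma smooth_flat:
  fixes f :: "'a::euclidean_space \<Rightarrow> real"
  assumes "smooth f"
  shows "smooth (\<lambda>x. flat 1 (f x))"
  using smooth_compose_real[of "\<lambda>j. flat (((\<lambda>p. monom 1 2 * (p - pderiv p)) ^^ j) 1)" f 0]
  by (simp add: assms flat_has_derivative)

subsection \<open>Integration against test functions\<close>

lemma
  fixes t :: "'a::euclidean_space" and c :: real
  assumes c: "c \<noteq> 0"
  shows lebesgue_measurable_affine: "(\<lambda>x. c *\<^sub>R x + t) \<in> lebesgue \<rightarrow>\<^sub>M lebesgue"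
    and lebesgue_affine: "lebesgue = density (distr lebesgue lebesgue (\<lambda>x. c *\<^sub>R x + t)) (\<lambda>_. ennreal (\<bar>c\<bar> ^ DIM('a)))"
proof -
  have T: "(\<lambda>x. t + (\<Sum>j\<in>Basis. (c * (x \<bullet> j)) *\<^sub>R j)) = (\<lambda>x. c *\<^sub>R x + t)"
    unfolding scaleR_scaleR[symmetric] scaleR_sum_right[symmetric] euclidean_representation
    by (simp add: add.commute)
  show "(\<lambda>x. c *\<^sub>R x + t) \<in> lebesgue \<rightarrow>\<^sub>M lebesgue"
    using lebesgue_affine_measurable[of "\<lambda>_. c" t] c unfolding T by simp
  show "lebesgue = density (distr lebesgue lebesgue (\<lambda>x. c *\<^sub>R x + t)) (\<lambda>_. ennreal (\<bar>c\<bar> ^ DIM('a)))"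
    using lebesgue_affine_euclidean[of "\<lambda>_. c" t] c unfolding T by simp
qed

lemma lebesgue_integral_affine:
  fixes t :: "'a::euclidean_space" and c :: real
    and f :: "'a \<Rightarrow> 'b::{banach, second_countable_topology}"
  assumes c: "c \<noteq> 0" and f: "f \<in> borel_measurable lebesgue"
  shows "(LINT x|lebesgue. f x) = \<bar>c\<bar> ^ DIM('a) *\<^sub>R (LINT x|lebesgue. f (c *\<^sub>R x + t))"
proof -
  note m = lebesgue_measurable_affine[OF c, of t]
  have "(LINT x|lebesgue. f x) =
    (LINT x|density (distr lebesgue lebesgue (\<lambda>x. c *\<^sub>R x + t)) (\<lambda>_. ennreal (\<bar>c\<bar> ^ DIM('a))). f x)"
    using lebesgue_affine[OF c, of t] by simp
  also have "\<dots> = (LINT x|distr lebesgue lebesgue (\<lambda>x. c *\<^sub>R x + t). \<bar>c\<bar> ^ DIM('a) *\<^sub>R f x)"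
    using f by (subst integral_density) auto
  also have "\<dots> = (LINT x|lebesgue. \<bar>c\<bar> ^ DIM('a) *\<^sub>R f (c *\<^sub>R x + t))"
    using f m by (subst integral_distr) auto
  finally show ?thesis by simp
qed

text \<open>Vanishing outside a ball is equivalent to compact support in a euclidean space and
  passes more directly to sums, derivatives and affine substitutions.\<close>

definition csupp :: "('a::real_normed_vector \<Rightarrow> 'b::zero) \<Rightarrow> bool" where
  "csupp f \<longleftrightarrow> (\<exists>R. \<forall>x. R < norm x \<longrightarrow> f x = 0)"

lemma csupp_iff_compact:
  fixes f :: "'a::euclidean_space \<Rightarrow> 'b::zero"
  shows "csupp f \<longleftrightarrow> compact (closure {x. f x \<noteq> 0})"
proof
  assume "csupp f"
  then obtain R where R: "\<And>x. R < norm x \<Longrightarrow> f x = 0" by (auto simp: csupp_def)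
  have "{x. f x \<noteq> 0} \<subseteq> cball 0 R" using R by (force simp: not_less)
  then have "bounded {x. f x \<noteq> 0}" using bounded_cball bounded_subset by blast
  then show "compact (closure {x. f x \<noteq> 0})" by (simp add: compact_closure)
next
  assume "compact (closure {x. f x \<noteq> 0})"
  then have "bounded {x. f x \<noteq> 0}" by (simp add: compact_closure)
  then obtain R where "\<And>x. f x \<noteq> 0 \<Longrightarrow> norm x \<le> R" by (auto simp: bounded_iff)
  then show "csupp f" unfolding csupp_def by (meson not_le)
qed

lemma test_functions_iff: "\<phi> \<in> test_functions \<longleftrightarrow> smooth \<phi> \<and> csupp \<phi>"
  by (simp add: test_functions_def smooth_def csupp_iff_compact)

lemma csupp_mono: "csupp f \<Longrightarrow> (\<And>x. f x = 0 \<Longrightarrow> g x = 0) \<Longrightarrow> csupp g"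
  by (auto simp: csupp_def)

lemma csupp_add:
  fixes f g :: "'a::real_normed_vector \<Rightarrow> 'b::monoid_add"
  assumes "csupp f" "csupp g"
  shows "csupp (\<lambda>x. f x + g x)"
proof -
  obtain R S where "\<And>x. R < norm x \<Longrightarrow> f x = 0" "\<And>x. S < norm x \<Longrightarrow> g x = 0"
    using assms by (auto simp: csupp_def)
  then show ?thesis unfolding csupp_def by (intro exI[of _ "max R S"]) auto
qed

lemma csupp_zero: "csupp (\<lambda>x. 0)"
  by (simp add: csupp_def)

lemma csupp_sum:
  fixes f :: "'i \<Rightarrow> 'a::real_normed_vector \<Rightarrow> 'b::comm_monoid_add"
  shows "(\<And>i. i \<in> I \<Longrightarrow> csupp (f i)) \<Longrightarrow> csupp (\<lambda>x. \<Sum>i\<in>I. f i x)"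
  by (induction I rule: infinite_finite_induct) (auto intro: csupp_zero csupp_add)

lemma dir_deriv_zero_outside:
  fixes f :: "'a::euclidean_space \<Rightarrow> 'b::real_normed_vector"
  assumes "\<And>x. R < norm x \<Longrightarrow> f x = 0" "R < norm x"
  shows "dir_deriv v f x = 0"
proof -
  have "((\<lambda>x. 0) has_derivative (\<lambda>h. 0)) (at x)" by (rule has_derivative_const)
  then have "(f has_derivative (\<lambda>h. 0)) (at x)"
  proof (rule has_derivative_transform_within_open[of _ _ _ _ "- cball 0 R"])
    show "open (- cball 0 R :: 'a set)" by (simp add: open_Compl)
  qed (use assms in auto)
  then show ?thesis by (rule dir_deriv_eqI)
qed

lemma csupp_dir_deriv: "csupp f \<Longrightarrow> csupp (dir_deriv v f)"
  unfolding csupp_def using dir_deriv_zero_outside by metis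

lemma csupp_affine:
  assumes "csupp f" "c \<noteq> 0"
  shows "csupp (\<lambda>x. f (c *\<^sub>R x + y))"
proof -
  obtain R where R: "\<And>x. R < norm x \<Longrightarrow> f x = 0" using assms by (auto simp: csupp_def)
  have "f (c *\<^sub>R x + y) = 0" if "(\<bar>R\<bar> + norm y) / \<bar>c\<bar> < norm x" for x
  proof (rule R)
    have "\<bar>R\<bar> + norm y < \<bar>c\<bar> * norm x" using that assms(2) by (simp add: field_simps)
    also have "\<dots> \<le> norm (c *\<^sub>R x + y) + norm y"
      using norm_triangle_ineq4[of "c *\<^sub>R x + y" y] by simp
    finally show "R < norm (c *\<^sub>R x + y)" by linarith
  qed
  then show ?thesis unfolding csupp_def by blast
qed

lemma continuous_lebesgue_measurable:
  "continuous_on UNIV f \<Longrightarrow> (f :: 'a::euclidean_space \<Rightarrow> 'b::topological_space) \<in> borel_measurable lebesgue"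
  using borel_measurable_continuous_onI measurable_completion by (simp add: measurable_completion borel_measurable_continuous_onI)

lemma csupp_bounded:
  fixes f :: "'a::euclidean_space \<Rightarrow> 'b::real_normed_vector"
  assumes "continuous_on UNIV f" "csupp f"
  obtains B where "0 \<le> B" "\<And>x. norm (f x) \<le> B"
proof -
  obtain R where R: "\<And>x. R < norm x \<Longrightarrow> f x = 0" using assms by (auto simp: csupp_def)
  have "bounded (f ` cball 0 R)"
    using assms(1) by (intro compact_imp_bounded compact_continuous_image) (auto intro: continuous_on_subset)
  then obtain B where "\<forall>y\<in>f ` cball 0 R. norm y \<le> B" unfolding bounded_iff by blast
  then have B: "norm (f x) \<le> B" if "norm x \<le> R" for x using that by auto
  have "norm (f x) \<le> max 0 B" for x
    using B[of x] R[of x] by (cases "norm x \<le> R") auto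
  then show ?thesis using that[of "max 0 B"] by auto
qed

lemma csupp_integrable:
  fixes f :: "'a::euclidean_space \<Rightarrow> 'b::{banach, second_countable_topology}"
  assumes c: "continuous_on UNIV f" and s: "csupp f"
  shows "integrable lebesgue f"
proof -
  obtain R where R: "\<And>x. R < norm x \<Longrightarrow> f x = 0" using s by (auto simp: csupp_def)
  have "integrable lborel (\<lambda>x. indicator (cball 0 R) x *\<^sub>R f x)"
    using c by (intro borel_integrable_compact) (auto intro: continuous_on_subset)
  also have "(\<lambda>x. indicator (cball 0 R) x *\<^sub>R f x) = f"
    using R by (auto simp: indicator_def fun_eq_iff not_less[symmetric])
  finally show ?thesis
    using c by (simp add: integrable_completion borel_measurable_continuous_onI)
qed

lemma csupp_L2:
  assumes c: "continuous_on UNIV f" and s: "csupp f"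
  shows "f \<in> L2"
proof -
  have "integrable lebesgue (\<lambda>x. (cmod (f x))\<^sup>2)"
    by (rule csupp_integrable) (auto intro!: continuous_intros c csupp_mono[OF s])
  then show ?thesis by (simp add: L2_def continuous_lebesgue_measurable c)
qed

lemma locally_integrable_mult:
  fixes h g :: "'a::euclidean_space \<Rightarrow> real"
  assumes h: "locally_integrable h" and c: "continuous_on UNIV g" and s: "csupp g"
  shows "integrable lebesgue (\<lambda>x. h x * g x)"
proof -
  obtain R where R: "\<And>x. R < norm x \<Longrightarrow> g x = 0" using s by (auto simp: csupp_def)
  obtain B where B: "0 \<le> B" "\<And>x. norm (g x) \<le> B" using csupp_bounded[OF c s] by blast
  have hi: "integrable lebesgue (\<lambda>x. indicator (cball 0 R) x *\<^sub>R h x)"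
    using h unfolding locally_integrable_def set_integrable_def by auto
  have eq: "(\<lambda>x. h x * g x) = (\<lambda>x. (indicator (cball 0 R) x *\<^sub>R h x) * g x)"
    using R by (auto simp: indicator_def fun_eq_iff not_less[symmetric])
  show ?thesis
    unfolding eq
  proof (rule Bochner_Integration.integrable_bound)
    show "integrable lebesgue (\<lambda>x. B * (indicator (cball 0 R) x *\<^sub>R h x))" using hi by simp
    show "(\<lambda>x. indicat_real (cball 0 R) x *\<^sub>R h x * g x) \<in> borel_measurable lebesgue"
      using borel_measurable_integrable[OF hi] continuous_lebesgue_measurable[OF c] by simp
    show "AE x in lebesgue. norm (indicat_real (cball 0 R) x *\<^sub>R h x * g x)
        \<le> norm (B * indicat_real (cball 0 R) x *\<^sub>R h x)"
      using B by (intro AE_I2) (simp add: abs_mult mult.commute mult_right_mono mult_left_mono)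
  qed
qed

lemma locally_integrable_const: "locally_integrable (\<lambda>x::'a::euclidean_space. c)"
  unfolding locally_integrable_def by (auto intro: absolutely_integrable_on_const lmeasurable_compact)

section \<open>Differentiation under the integral and integration by parts\<close>

lemma has_real_derivative_dir_deriv:
  assumes "f differentiable_on UNIV"
  shows "((\<lambda>s. f (x + s *\<^sub>R b)) has_real_derivative dir_deriv b f (x + s *\<^sub>R b)) (at s)"
proof -
  have d: "((\<lambda>s. x + s *\<^sub>R b) has_derivative (\<lambda>h. h *\<^sub>R b)) (at s)"
    by (auto intro!: derivative_eq_intros)
  note f = differentiable_on_UNIV_has_derivative[OF assms, of "x + s *\<^sub>R b"]
  have "((\<lambda>s. f (x + s *\<^sub>R b)) has_derivative (\<lambda>h. frechet_derivative f (at (x + s *\<^sub>R b)) (h *\<^sub>R b))) (at s)"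
    using has_derivative_compose[OF d f] .
  then show ?thesis
    unfolding has_field_derivative_def
    by (simp add: linear_scale[OF has_derivative_linear[OF f]] dir_deriv_def mult_commute_abs)
qed

text \<open>All derivatives fall on the test function, so \<open>h\<close> may be merely locally
  integrable. The difference quotients of \<open>\<psi>\<close> are bounded by its Lipschitz
  constant and live in a fixed ball, which permits dominated convergence.\<close>

lemma has_real_derivative_integral_translate:
  fixes h \<psi> :: "'a::euclidean_space \<Rightarrow> real"
  assumes h: "locally_integrable h" and sm: "smooth \<psi>" and cs: "csupp \<psi>" and b: "b \<in> Basis"
  shows "((\<lambda>s. LINT x|lebesgue. h x * \<psi> (x + s *\<^sub>R b)) has_real_derivative
     (LINT x|lebesgue. h x * dir_deriv b \<psi> x)) (at 0)"
  unfolding has_field_derivative_iff tendsto_at_iff_sequentially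
proof (intro allI impI, simp)
  fix X :: "nat \<Rightarrow> real" assume X: "\<forall>i. X i \<noteq> 0" "X \<longlonglongrightarrow> 0"
  note diff = smooth_differentiable[OF sm]
  have tr: "smooth (\<lambda>x. \<psi> (x + s *\<^sub>R b))" "csupp (\<lambda>x. \<psi> (x + s *\<^sub>R b))" for s
    using smooth_affine[OF sm, of 1 "s *\<^sub>R b"] csupp_affine[OF cs, of 1 "s *\<^sub>R b"] by simp_all
  have int: "integrable lebesgue (\<lambda>x. h x * \<psi> (x + s *\<^sub>R b))" for s
    by (intro locally_integrable_mult h smooth_continuous tr)
  have int0: "integrable lebesgue (\<lambda>x. h x * \<psi> x)"
    using int[of 0] by simp
  obtain M where M: "\<And>i. norm (X i) \<le> M"
    using convergent_imp_Bseq[OF convergentI[OF X(2)]] by (auto simp: Bseq_def)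
  obtain R where R: "\<And>x. R < norm x \<Longrightarrow> \<psi> x = 0" using cs by (auto simp: csupp_def)
  have d: "smooth (dir_deriv b \<psi>)" "csupp (dir_deriv b \<psi>)"
    using sm cs b by (auto intro: smooth_dir_deriv csupp_dir_deriv)
  obtain B where B: "0 \<le> B" "\<And>x. norm (dir_deriv b \<psi> x) \<le> B"
    using csupp_bounded[OF smooth_continuous[OF d(1)] d(2)] by blast
  have lip: "\<bar>\<psi> (x + s *\<^sub>R b) - \<psi> x\<bar> \<le> B * \<bar>s\<bar>" for x s
  proof -
    have "norm (\<psi> (x + s *\<^sub>R b) - \<psi> (x + 0 *\<^sub>R b)) \<le> B * norm (s - 0)"
      by (rule field_differentiable_bound[of UNIV "\<lambda>s. \<psi> (x + s *\<^sub>R b)"])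
        (use has_real_derivative_dir_deriv[OF diff] B in auto)
    then show ?thesis by simp
  qed
  define g where "g i x = h x * ((\<psi> (x + X i *\<^sub>R b) - \<psi> x) / X i)" for i x
  \<comment> \<open>Shifts by at most \<open>M\<close> move a support in the ball of radius
    \<open>R\<close> into the ball of radius \<open>R + M\<close>.\<close>
  let ?w = "\<lambda>x. B * \<bar>indicator (cball 0 (R + M)) x *\<^sub>R h x\<bar>"
  have hi: "integrable lebesgue (\<lambda>x. indicator (cball 0 (R + M)) x *\<^sub>R h x)"
    using h unfolding locally_integrable_def set_integrable_def by auto
  have "(\<lambda>i. LINT x|lebesgue. g i x) \<longlonglongrightarrow> (LINT x|lebesgue. h x * dir_deriv b \<psi> x)"
  proof (rule Bochner_Integration.integral_dominated_convergence[where w = ?w])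
    show "(\<lambda>x. h x * dir_deriv b \<psi> x) \<in> borel_measurable lebesgue"
      by (intro borel_measurable_integrable locally_integrable_mult h smooth_continuous d)
    have "g i = (\<lambda>x. (h x * \<psi> (x + X i *\<^sub>R b) - h x * \<psi> x) / X i)" for i
      by (auto simp: g_def fun_eq_iff algebra_simps)
    then show "g i \<in> borel_measurable lebesgue" for i
      using borel_measurable_integrable[OF int, of "X i"] borel_measurable_integrable[OF int0] by simp
    show "integrable lebesgue ?w" using hi by (intro integrable_mult_right integrable_abs)
    have "(\<lambda>i. (\<psi> (x + X i *\<^sub>R b) - \<psi> x) / X i) \<longlonglongrightarrow> dir_deriv b \<psi> x" for x
    proof -
      have "((\<lambda>s. (\<psi> (x + s *\<^sub>R b) - \<psi> x) / s) \<longlongrightarrow> dir_deriv b \<psi> x) (at 0)"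
        using has_real_derivative_dir_deriv[OF diff, of x b 0] by (simp add: has_field_derivative_iff)
      then show ?thesis
        using X by (auto simp: tendsto_at_iff_sequentially o_def)
    qed
    then show "AE x in lebesgue. (\<lambda>i. g i x) \<longlonglongrightarrow> h x * dir_deriv b \<psi> x"
      unfolding g_def by (intro AE_I2 tendsto_mult tendsto_const) auto
    show "AE x in lebesgue. norm (g i x) \<le> ?w x" for i
    proof (intro AE_I2)
      fix x :: 'a
      show "norm (g i x) \<le> ?w x"
      proof (cases "norm x \<le> R + M")
        case True
        have "\<bar>(\<psi> (x + X i *\<^sub>R b) - \<psi> x) / X i\<bar> \<le> B"
          using lip[of x "X i"] X(1) by (simp add: abs_divide pos_divide_le_eq)
        then have "\<bar>h x\<bar> * \<bar>(\<psi> (x + X i *\<^sub>R b) - \<psi> x) / X i\<bar> \<le> \<bar>h x\<bar> * B"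
          by (intro mult_left_mono) auto
        then show ?thesis using True by (simp add: g_def abs_mult mult.commute)
      next
        case False
        then have "norm x > R + M" by simp
        moreover have "norm (X i *\<^sub>R b) \<le> M" using M[of i] b by simp
        moreover have "M \<ge> 0" using M[of i] norm_ge_zero order_trans by blast
        ultimately have "R < norm x" "R < norm (x + X i *\<^sub>R b)"
          using norm_triangle_ineq4[of "x + X i *\<^sub>R b" "X i *\<^sub>R b"] by auto
        then have "g i x = 0" by (simp add: g_def R)
        then show ?thesis using B by simp
      qed
    qed
  qed
  moreover have "(LINT x|lebesgue. g i x) = ((LINT x|lebesgue. h x * \<psi> (x + X i *\<^sub>R b)) - (LINT x|lebesgue. h x * \<psi> x)) / X i" for i
    by (simp add: g_def right_diff_distrib diff_divide_distrib int int0)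
  ultimately show "((\<lambda>s. ((LINT x|lebesgue. h x * \<psi> (x + s *\<^sub>R b)) - (LINT x|lebesgue. h x * \<psi> x)) / s) \<circ> X)
      \<longlonglongrightarrow> (LINT x|lebesgue. h x * dir_deriv b \<psi> x)"
    by (simp add: o_def)
qed

text \<open>By translation invariance the integral of a shifted function does not depend on the
  shift; differentiate at shift 0.\<close>

lemma integral_dir_deriv_zero_real:
  fixes \<psi> :: "'a::euclidean_space \<Rightarrow> real"
  assumes sm: "smooth \<psi>" and cs: "csupp \<psi>" and b: "b \<in> Basis"
  shows "(LINT x|lebesgue. dir_deriv b \<psi> x) = 0"
proof -
  have "(LINT x|lebesgue. \<psi> (x + s *\<^sub>R b)) = (LINT x|lebesgue. \<psi> x)" for s
    using lebesgue_integral_affine[of 1 \<psi> "s *\<^sub>R b"] continuous_lebesgue_measurable[OF smooth_continuous[OF sm]] by simp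
  then have "((\<lambda>s::real. LINT x|lebesgue. \<psi> x) has_real_derivative (LINT x|lebesgue. dir_deriv b \<psi> x)) (at 0)"
    using has_real_derivative_integral_translate[OF locally_integrable_const[of 1] assms] by simp
  then show ?thesis using DERIV_const DERIV_unique by blast
qed

lemma smooth_dir_deriv_any:
  assumes "smooth f"
  shows "smooth (dir_deriv v f)"
proof -
  have "dir_deriv v f = (\<lambda>x. \<Sum>b\<in>Basis. (v \<bullet> b) *\<^sub>R dir_deriv b f x)"
    by (intro ext dir_deriv_linear_Basis smooth_differentiable assms)
  then show ?thesis
    by (simp only:) (intro smooth_sum smooth_scaleR smooth_const smooth_dir_deriv assms)
qed

lemma integral_by_parts_real:
  fixes f g :: "'a::euclidean_space \<Rightarrow> real"
  assumes "smooth f" "csupp f" "smooth g" "b \<in> Basis"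
  shows "(LINT x|lebesgue. g x * dir_deriv b f x) = - (LINT x|lebesgue. dir_deriv b g x * f x)"
proof -
  have s: "smooth (\<lambda>x. g x * f x)" "csupp (\<lambda>x. g x * f x)"
    using assms by (auto intro: smooth_mult csupp_mono)
  have "dir_deriv b (\<lambda>x. g x * f x) = (\<lambda>x. g x * dir_deriv b f x + dir_deriv b g x * f x)"
    by (rule dir_deriv_bilinear[OF bounded_bilinear_mult]) (intro smooth_differentiable assms)+
  with integral_dir_deriv_zero_real[OF s assms(4)]
  have "(LINT x|lebesgue. g x * dir_deriv b f x + dir_deriv b g x * f x) = 0" by simp
  moreover have "integrable lebesgue (\<lambda>x. g x * dir_deriv b f x)"
    using assms by (intro csupp_integrable smooth_continuous smooth_mult smooth_dir_deriv
        csupp_mono[OF csupp_dir_deriv[OF assms(2)]]) auto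
  moreover have "integrable lebesgue (\<lambda>x. dir_deriv b g x * f x)"
    using assms by (intro csupp_integrable smooth_continuous smooth_mult smooth_dir_deriv
        csupp_mono[OF assms(2)]) auto
  ultimately show ?thesis by simp
qed

text \<open>Both sides are the derivative at $s = 0$ of
  $\int g(x)\,\partial_c f(x + sb)\,dx = -\int \partial_c g(x)\,f(x + sb)\,dx$.\<close>

lemma integral_dir_deriv_commute:
  fixes f g :: "'a::euclidean_space \<Rightarrow> real"
  assumes f: "smooth f" "csupp f" and g: "smooth g" "csupp g" and b: "b \<in> Basis" "c \<in> Basis"
  shows "(LINT x|lebesgue. g x * dir_deriv b (dir_deriv c f) x) = (LINT x|lebesgue. g x * dir_deriv c (dir_deriv b f) x)"
proof -
  have lg: "locally_integrable h" if "smooth h" "csupp h" for h :: "'a \<Rightarrow> real"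
    unfolding locally_integrable_def set_integrable_def
    by (intro allI impI integrable_mult_indicator csupp_integrable smooth_continuous that)
      (simp add: lmeasurable_compact fmeasurableD)
  have tr: "smooth (\<lambda>x. f (x + s *\<^sub>R b))" "csupp (\<lambda>x. f (x + s *\<^sub>R b))" for s
    using smooth_affine[OF f(1), of 1 "s *\<^sub>R b"] csupp_affine[OF f(2), of 1 "s *\<^sub>R b"] by simp_all
  have "(LINT x|lebesgue. g x * dir_deriv c f (x + s *\<^sub>R b)) = - (LINT x|lebesgue. dir_deriv c g x * f (x + s *\<^sub>R b))" for s
    using integral_by_parts_real[OF tr[of s] g(1) b(2)]
      dir_deriv_affine[OF smooth_differentiable[OF f(1)], of c 1 "s *\<^sub>R b"] by simp
  moreover have "((\<lambda>s. LINT x|lebesgue. g x * dir_deriv c f (x + s *\<^sub>R b)) has_real_derivative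
     (LINT x|lebesgue. g x * dir_deriv b (dir_deriv c f) x)) (at 0)"
    using assms by (intro has_real_derivative_integral_translate lg smooth_dir_deriv csupp_dir_deriv)
  moreover have "((\<lambda>s. - (LINT x|lebesgue. dir_deriv c g x * f (x + s *\<^sub>R b))) has_real_derivative
     - (LINT x|lebesgue. dir_deriv c g x * dir_deriv b f x)) (at 0)"
    using assms by (intro DERIV_minus has_real_derivative_integral_translate lg smooth_dir_deriv csupp_dir_deriv)
  ultimately have "(LINT x|lebesgue. g x * dir_deriv b (dir_deriv c f) x) = - (LINT x|lebesgue. dir_deriv c g x * dir_deriv b f x)"
    using DERIV_unique by simp
  also have "\<dots> = (LINT x|lebesgue. g x * dir_deriv c (dir_deriv b f) x)"
    using assms by (intro integral_by_parts_real[symmetric] smooth_dir_deriv csupp_dir_deriv)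
  finally show ?thesis .
qed

subsection \<open>The space of test functions\<close>

text \<open>Having test functions as a vector space of their own turns differentiation,
  multiplication and the embedding into \<open>lsq\<close> into total linear maps.\<close>

typedef (overloaded) 'a testf = "test_functions :: ('a::euclidean_space \<Rightarrow> complex) set"
  by (rule exI[of _ "\<lambda>x. 0"]) (simp add: test_functions_iff smooth_const csupp_zero)

setup_lifting type_definition_testf

instantiation testf :: (euclidean_space) real_vector
begin

lift_definition zero_testf :: "'a testf" is "\<lambda>x. 0"
  by (simp add: test_functions_iff smooth_const csupp_zero)
lift_definition plus_testf :: "'a testf \<Rightarrow> 'a testf \<Rightarrow> 'a testf" is "\<lambda>f g x. f x + g x"
  by (simp add: test_functions_iff smooth_add csupp_add)
lift_definition uminus_testf :: "'a testf \<Rightarrow> 'a testf" is "\<lambda>f x. - f x"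
  by (auto simp: test_functions_iff smooth_minus intro: csupp_mono)
lift_definition scaleR_testf :: "real \<Rightarrow> 'a testf \<Rightarrow> 'a testf" is "\<lambda>c f x. c *\<^sub>R f x"
  by (auto simp: test_functions_iff intro: csupp_mono smooth_scaleR smooth_const)
definition minus_testf :: "'a testf \<Rightarrow> 'a testf \<Rightarrow> 'a testf" where "f - g = f + - g" for f g :: "'a testf"

instance
  by standard (transfer; simp add: fun_eq_iff algebra_simps minus_testf_def; fail | rule minus_testf_def)+

end

lift_definition td :: "'a::euclidean_space \<Rightarrow> 'a testf \<Rightarrow> 'a testf" is dir_deriv
  by (simp add: test_functions_iff smooth_dir_deriv_any csupp_dir_deriv)

lift_definition tm :: "('a::euclidean_space \<Rightarrow> real) \<Rightarrow> 'a testf \<Rightarrow> 'a testf" is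
  "\<lambda>m f x. if smooth m then m x *\<^sub>R f x else 0"
  by (case_tac "smooth fun1") (auto simp: test_functions_iff intro: csupp_mono smooth_scaleR smooth_const csupp_zero)

lift_definition tj :: "'a::euclidean_space testf \<Rightarrow> 'a testf" is "\<lambda>f x. \<i> * f x"
  by (auto simp: test_functions_iff intro: csupp_mono smooth_cmult)

definition emb :: "'a::euclidean_space testf \<Rightarrow> 'a lsq" where "emb f = cls (Rep_testf f)"

lemma Rep_testf_smooth: "smooth (Rep_testf f)" and Rep_testf_csupp: "csupp (Rep_testf f)"
  using Rep_testf[of f] by (auto simp: test_functions_iff)

lemma Rep_testf_L2: "Rep_testf f \<in> L2"
  by (intro csupp_L2 smooth_continuous Rep_testf_smooth Rep_testf_csupp)

lemma linear_emb: "linear emb"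
proof (rule linearI)
  show "emb (f + g) = emb f + emb g" for f g :: "'a testf"
    unfolding emb_def plus_testf.rep_eq by (rule cls_add[OF Rep_testf_L2 Rep_testf_L2])
  show "emb (c *\<^sub>R f) = c *\<^sub>R emb f" for c and f :: "'a testf"
    unfolding emb_def scaleR_testf.rep_eq by (rule cls_scaleR[OF Rep_testf_L2])
qed

lemmas emb_add = linear_add[OF linear_emb]
lemmas emb_diff = linear_diff[OF linear_emb]
lemmas emb_scaleR = linear_scale[OF linear_emb]
lemmas emb_sum = linear_sum[OF linear_emb]

lemma linear_td: "linear (td v)"
proof (rule linearI)
  show "td v (f + g) = td v f + td v g" for f g
    by transfer (simp add: dir_deriv_add smooth_differentiable test_functions_iff)
  show "td v (c *\<^sub>R f) = c *\<^sub>R td v f" for c f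
    by transfer (simp add: dir_deriv_bounded_linear[OF bounded_linear_scaleR_right] smooth_differentiable test_functions_iff)
qed

lemma linear_tm: "linear (tm m)"
  by (rule linearI; transfer) (auto simp: fun_eq_iff scaleR_right_distrib)

lemma linear_tj: "linear tj"
  by (rule linearI; transfer) (auto simp: fun_eq_iff algebra_simps)

lemma td_tm: "smooth m \<Longrightarrow> td b (tm m f) = tm (dir_deriv b m) f + tm m (td b f)"
  by transfer (simp add: fun_eq_iff smooth_dir_deriv_any test_functions_iff add.commute
      dir_deriv_bilinear[OF bounded_bilinear_scaleR] smooth_differentiable)

lemma td_tj: "td b (tj f) = tj (td b f)"
  by transfer (simp add: dir_deriv_bounded_linear[OF bounded_linear_mult_right] smooth_differentiable test_functions_iff)

lemma tm_tm: "smooth m \<Longrightarrow> smooth n \<Longrightarrow> tm m (tm n f) = tm (\<lambda>x. m x * n x) f"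
  by transfer (simp add: smooth_mult)

lemma inner_cls_inner:
  assumes "f \<in> L2" "g \<in> L2"
  shows "inner (cls f) (cls g) = (LINT x|lebesgue. f x \<bullet> g x)"
  using inner_cls_integral[OF assms] by (simp add: inner_complex_def)

lemma inner_emb: "inner (emb f) (emb g) = (LINT x|lebesgue. Rep_testf f x \<bullet> Rep_testf g x)"
  unfolding emb_def by (intro inner_cls_inner Rep_testf_L2)

lemma inner_td:
  assumes "b \<in> Basis"
  shows "inner (emb (td b f)) (emb g) = - inner (emb f) (emb (td b g))"
proof -
  let ?f = "Rep_testf f" and ?g = "Rep_testf g"
  note sf = Rep_testf_smooth[of f] and sg = Rep_testf_smooth[of g] and cf = Rep_testf_csupp[of f] and cg = Rep_testf_csupp[of g]
  have sm: "smooth (\<lambda>x. p x \<bullet> q x)" if "smooth p" "smooth q" for p q :: "'a \<Rightarrow> complex"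
    using that by (simp add: smooth_def C_k_bilinear[OF bounded_bilinear_inner])
  have "dir_deriv b (\<lambda>x. ?f x \<bullet> ?g x) = (\<lambda>x. ?f x \<bullet> dir_deriv b ?g x + dir_deriv b ?f x \<bullet> ?g x)"
    by (rule dir_deriv_bilinear[OF bounded_bilinear_inner]) (intro smooth_differentiable sf sg)+
  moreover have "(LINT x|lebesgue. dir_deriv b (\<lambda>x. ?f x \<bullet> ?g x) x) = 0"
    by (intro integral_dir_deriv_zero_real sm sf sg assms csupp_mono[OF cf]) auto
  ultimately have "(LINT x|lebesgue. ?f x \<bullet> dir_deriv b ?g x + dir_deriv b ?f x \<bullet> ?g x) = 0" by simp
  moreover have "integrable lebesgue (\<lambda>x. ?f x \<bullet> dir_deriv b ?g x)"
    by (intro csupp_integrable smooth_continuous sm sf smooth_dir_deriv sg assms csupp_mono[OF cf]) auto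
  moreover have "integrable lebesgue (\<lambda>x. dir_deriv b ?f x \<bullet> ?g x)"
    by (intro csupp_integrable smooth_continuous sm sf smooth_dir_deriv sg assms csupp_mono[OF cg]) auto
  ultimately show ?thesis by (simp add: inner_emb td.rep_eq)
qed

text \<open>Mixed derivatives are exchanged by duality: both sides pair equally with every test
  function. Equality of classes in \<open>lsq\<close> is all that the commutator computation asks
  for.\<close>

lemma emb_td_commute:
  assumes b: "b \<in> Basis" "c \<in> Basis"
  shows "emb (td b (td c f)) = emb (td c (td b f))"
proof -
  have bl: "bounded_linear Re" "bounded_linear Im" by (rule bounded_linear_Re bounded_linear_Im)+
  have dd: "dir_deriv b (dir_deriv c (\<lambda>x. L (Rep_testf f x))) = (\<lambda>x. L (dir_deriv b (dir_deriv c (Rep_testf f)) x))"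
    if "bounded_linear L" "b \<in> Basis" "c \<in> Basis" for L :: "complex \<Rightarrow> real" and b c
    using that by (simp add: dir_deriv_bounded_linear smooth_differentiable Rep_testf_smooth smooth_dir_deriv)
  have key: "(LINT x|lebesgue. L (Rep_testf g x) * L (dir_deriv b (dir_deriv c (Rep_testf f)) x))
    = (LINT x|lebesgue. L (Rep_testf g x) * L (dir_deriv c (dir_deriv b (Rep_testf f)) x))"
    if L: "bounded_linear L" for L :: "complex \<Rightarrow> real" and g
  proof -
    have "smooth (\<lambda>x. L (Rep_testf h x))" "csupp (\<lambda>x. L (Rep_testf h x))" for h
      using smooth_bounded_linear[OF L Rep_testf_smooth, of h]
        csupp_mono[OF Rep_testf_csupp, of h "\<lambda>x. L (Rep_testf h x)"] linear_0[OF bounded_linear.linear[OF L]] by auto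
    from integral_dir_deriv_commute[OF this[of f] this[of g] b] show ?thesis
      by (simp only: dd[OF L b] dd[OF L b(2,1)])
  qed
  have "inner (emb (td b (td c f))) (emb g) = inner (emb (td c (td b f))) (emb g)" for g
  proof -
    have int: "integrable lebesgue (\<lambda>x. L (Rep_testf g x) * L (Rep_testf h x))"
      if "bounded_linear L" for L :: "complex \<Rightarrow> real" and h
    proof (intro csupp_integrable smooth_continuous smooth_mult smooth_bounded_linear[OF that] Rep_testf_smooth)
      show "csupp (\<lambda>x. L (Rep_testf g x) * L (Rep_testf h x))"
        by (rule csupp_mono[OF Rep_testf_csupp[of g]]) (simp add: linear_0[OF bounded_linear.linear[OF that]])
    qed
    have "inner (emb h) (emb g) = (LINT x|lebesgue. Re (Rep_testf g x) * Re (Rep_testf h x))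
      + (LINT x|lebesgue. Im (Rep_testf g x) * Im (Rep_testf h x))" for h
      unfolding inner_emb inner_complex_def
      by (subst Bochner_Integration.integral_add[OF int[OF bl(1)] int[OF bl(2)], symmetric]) (simp add: mult.commute)
    then show ?thesis
      by (simp only: td.rep_eq key[OF bl(1)] key[OF bl(2)])
  qed
  \<comment> \<open>The difference of the two mixed derivatives is itself a test function and may be
    paired with itself.\<close>
  then have "inner (emb (td b (td c f)) - emb (td c (td b f))) (emb (td b (td c f) - td c (td b f))) = 0"
    by (simp add: inner_diff_left)
  then show ?thesis by (simp add: emb_diff)
qed

definition tlap :: "'a::euclidean_space testf \<Rightarrow> 'a testf" where
  "tlap f = (\<Sum>b\<in>Basis. td b (td b f))"

lemma linear_tlap: "linear tlap"
  unfolding tlap_def[abs_def]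
  by (intro linear_compose_sum ballI linear_compose[OF linear_td linear_td, unfolded o_def])

lemma Rep_testf_sum: "Rep_testf (\<Sum>i\<in>I. f i) = (\<lambda>x. \<Sum>i\<in>I. Rep_testf (f i) x)"
  by (induction I rule: infinite_finite_induct) (auto simp: zero_testf.rep_eq plus_testf.rep_eq)

lemma Rep_testf_tlap: "Rep_testf (tlap f) = laplacian (Rep_testf f)"
  by (simp add: tlap_def Rep_testf_sum td.rep_eq fun_eq_iff laplacian_def)

lemma inner_tm: "inner (emb (tm m f)) (emb g) = inner (emb f) (emb (tm m g))"
  by (cases "smooth m") (simp_all add: inner_emb tm.rep_eq)

lemma bdd_meas_smooth:
  assumes "smooth m" "\<And>x. \<bar>m x\<bar> \<le> B"
  shows "bdd_meas (\<lambda>x. complex_of_real (m x))"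
proof -
  have "continuous_on UNIV (\<lambda>x. complex_of_real (m x))"
    by (intro continuous_intros smooth_continuous assms)
  then show ?thesis unfolding bdd_meas_def
    using assms(2) by (auto intro!: continuous_lebesgue_measurable)
qed

lemma emb_tm:
  assumes "smooth m" "\<And>x. \<bar>m x\<bar> \<le> B"
  shows "emb (tm m f) = mul (\<lambda>x. complex_of_real (m x)) (emb f)"
  unfolding emb_def mul_cls[OF bdd_meas_smooth[OF assms] Rep_testf_L2]
  by (simp add: tm.rep_eq assms(1) scaleR_conv_of_real)

lemma emb_tj: "emb (tj f) = mul (\<lambda>x. \<i>) (emb f)"
  unfolding emb_def mul_cls[OF bdd_meas_const Rep_testf_L2] by (simp add: tj.rep_eq)

subsection \<open>Density of the range of the Helmholtz operator\<close>

lemma flat_one_bounds: "0 \<le> flat 1 s" "flat 1 s \<le> 1"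
  by (auto simp: flat_def)

lemma flat_one_tendsto: "(\<lambda>k. flat 1 (real k * s)) \<longlonglongrightarrow> indicator {0<..} s"
proof (cases "s > 0")
  case True
  have "filterlim (\<lambda>k. real k * s) at_top sequentially"
    using filterlim_tendsto_pos_mult_at_top[OF tendsto_const[of s] True filterlim_real_sequentially] by (simp add: mult.commute)
  then have "(\<lambda>k. exp (- inverse (real k * s))) \<longlonglongrightarrow> exp (- 0)"
    by (intro tendsto_exp tendsto_minus tendsto_inverse_0_at_top)
  moreover have "\<forall>\<^sub>F k in sequentially. exp (- inverse (real k * s)) = flat 1 (real k * s)"
    using eventually_gt_at_top[of "0::nat"] by eventually_elim (use True in \<open>simp add: flat_def\<close>)
  ultimately show ?thesis using True by (auto intro: Lim_transform_eventually)
next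
  case False
  then have "flat 1 (real k * s) = 0" for k
    by (auto simp: flat_def zero_less_mult_iff)
  then show ?thesis using False by simp
qed

text \<open>Each factor is \<open>exp(-1/(k s))\<close> in the distance \<open>s\<close> to a face
  of the box and 0 beyond that face, so the product is smooth and tends pointwise to the indicator
  of the open box.\<close>

definition box_bump :: "'a::euclidean_space \<Rightarrow> 'a \<Rightarrow> nat \<Rightarrow> 'a \<Rightarrow> real" where
  "box_bump l u k x = (\<Prod>b\<in>Basis. flat 1 (real k * (x \<bullet> b - l \<bullet> b)) * flat 1 (real k * (u \<bullet> b - x \<bullet> b)))"

lemma smooth_box_bump: "smooth (box_bump l u k)"
proof -
  have "smooth (\<lambda>x. \<Prod>b\<in>Basis. flat 1 (real k * (x \<bullet> b - l \<bullet> b)) * flat 1 (real k * (u \<bullet> b - x \<bullet> b)))"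
    by (intro smooth_prod smooth_mult smooth_flat smooth_diff smooth_const smooth_inner_left)
  then show ?thesis by (simp add: box_bump_def[abs_def])
qed

lemma box_bump_zero:
  assumes "x \<notin> box l u"
  shows "box_bump l u k x = 0"
proof -
  obtain b where b: "b \<in> Basis" "x \<bullet> b \<le> l \<bullet> b \<or> u \<bullet> b \<le> x \<bullet> b"
    using assms by (auto simp: mem_box not_less)
  then have "flat 1 (real k * (x \<bullet> b - l \<bullet> b)) * flat 1 (real k * (u \<bullet> b - x \<bullet> b)) = 0"
    by (auto simp: flat_def zero_less_mult_iff)
  with b(1) show ?thesis unfolding box_bump_def by (intro prod_zero) auto
qed

lemma csupp_box_bump: "csupp (box_bump l u k)"
proof -
  obtain R where "\<And>x. x \<in> box l u \<Longrightarrow> norm x \<le> R"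
    using bounded_box[of l u] by (auto simp: bounded_iff)
  then show ?thesis unfolding csupp_def by (meson box_bump_zero not_le)
qed

lemma box_bump_tendsto: "(\<lambda>k. box_bump l u k x) \<longlonglongrightarrow> indicator (box l u) x"
proof -
  have "(\<lambda>k. box_bump l u k x) \<longlonglongrightarrow> (\<Prod>b\<in>Basis. indicator {0<..} (x \<bullet> b - l \<bullet> b) * indicator {0<..} (u \<bullet> b - x \<bullet> b))"
    unfolding box_bump_def by (intro tendsto_prod tendsto_mult flat_one_tendsto)
  also have "(\<Prod>b\<in>Basis. indicator {0<..} (x \<bullet> b - l \<bullet> b) * indicator {0<..} (u \<bullet> b - x \<bullet> b)) = (indicator (box l u) x :: real)"
  proof (cases "x \<in> box l u")
    case True
    then show ?thesis by (auto simp: mem_box intro!: prod.neutral)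
  next
    case False
    then obtain b where b: "b \<in> Basis" "x \<bullet> b \<le> l \<bullet> b \<or> u \<bullet> b \<le> x \<bullet> b"
      by (auto simp: mem_box not_less)
    then have "\<exists>b\<in>Basis. indicator {0<..} (x \<bullet> b - l \<bullet> b) * indicator {0<..} (u \<bullet> b - x \<bullet> b) = (0::real)"
      by (intro bexI[of _ b]) auto
    with False show ?thesis by (simp add: prod_zero)
  qed
  finally show ?thesis .
qed

lemma box_bump_bound: "norm (box_bump l u k x) \<le> indicator (cbox l u) x"
proof (cases "x \<in> box l u")
  case True
  then have "x \<in> cbox l u" using box_subset_cbox by blast
  moreover have "0 \<le> box_bump l u k x"
    unfolding box_bump_def by (intro prod_nonneg mult_nonneg_nonneg flat_one_bounds)
  moreover have "box_bump l u k x \<le> 1"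
    unfolding box_bump_def by (intro prod_le_1 conjI mult_nonneg_nonneg mult_le_one flat_one_bounds)
  ultimately show ?thesis by simp
qed (simp add: box_bump_zero)

text \<open>Bump functions show that the integral over every box vanishes. Boxes generate the Borel
  sets and are stable under intersection, so the integral vanishes over every measurable part of a
  fixed box, which forces the function to be zero there.\<close>

lemma locally_integrable_orth_test_AE_zero:
  fixes h :: "'a::euclidean_space \<Rightarrow> real"
  assumes h: "locally_integrable h"
    and orth: "\<And>\<psi>. smooth \<psi> \<Longrightarrow> csupp \<psi> \<Longrightarrow> (LINT x|lebesgue. h x * \<psi> x) = 0"
  shows "AE x in lebesgue. h x = 0"
proof -
  have hi: "integrable lebesgue (\<lambda>x. indicator (cbox l u) x *\<^sub>R h x)" for l u
    using h unfolding locally_integrable_def set_integrable_def by auto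
  have box0: "(LINT x|lebesgue. indicator (box l u) x *\<^sub>R h x) = 0" for l u
  proof -
    have "(\<lambda>k. LINT x|lebesgue. h x * box_bump l u k x) \<longlonglongrightarrow> (LINT x|lebesgue. indicator (box l u) x *\<^sub>R h x)"
    proof (rule Bochner_Integration.integral_dominated_convergence[where w = "\<lambda>x. \<bar>indicator (cbox l u) x *\<^sub>R h x\<bar>"])
      have "(\<lambda>x. indicat_real (box l u) x *\<^sub>R (indicat_real (cbox l u) x *\<^sub>R h x)) \<in> borel_measurable lebesgue"
        by (intro borel_measurable_scaleR borel_measurable_indicator borel_measurable_integrable[OF hi]) auto
      also have "(\<lambda>x. indicat_real (box l u) x *\<^sub>R (indicat_real (cbox l u) x *\<^sub>R h x)) = (\<lambda>x. indicat_real (box l u) x *\<^sub>R h x)"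
        using box_subset_cbox[of l u] by (auto simp: indicator_def fun_eq_iff)
      finally show "(\<lambda>x. indicat_real (box l u) x *\<^sub>R h x) \<in> borel_measurable lebesgue" .
      show "(\<lambda>x. h x * box_bump l u k x) \<in> borel_measurable lebesgue" for k
        by (intro borel_measurable_integrable locally_integrable_mult h smooth_continuous smooth_box_bump csupp_box_bump)
      show "AE x in lebesgue. (\<lambda>k. h x * box_bump l u k x) \<longlonglongrightarrow> indicat_real (box l u) x *\<^sub>R h x"
        by (intro AE_I2) (use tendsto_mult[OF tendsto_const box_bump_tendsto] in \<open>simp add: mult.commute\<close>)
      show "AE x in lebesgue. norm (h x * box_bump l u k x) \<le> \<bar>indicat_real (cbox l u) x *\<^sub>R h x\<bar>" for k
        using mult_left_mono[OF box_bump_bound[of l u k], of "\<bar>h _\<bar>"]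
        by (intro AE_I2) (simp add: abs_mult mult.commute)
    qed (use hi in auto)
    then show ?thesis
      using orth[OF smooth_box_bump csupp_box_bump, of l u] by (simp add: LIMSEQ_const_iff)
  qed
  \<comment> \<open>Restricting to a large box makes the function integrable, so that integrals over
    arbitrary measurable sets exist.\<close>
  have "AE x in lebesgue. indicator (box (- (real N *\<^sub>R One)) (real N *\<^sub>R One)) x *\<^sub>R h x = 0" for N
  proof -
    define f where "f x = indicator (box (- (real N *\<^sub>R One)) (real N *\<^sub>R One)) x *\<^sub>R h x" for x :: 'a
    have f: "integrable lebesgue f"
    proof -
      have "integrable lebesgue (\<lambda>x. indicator (box (- (real N *\<^sub>R One)) (real N *\<^sub>R One)) x *\<^sub>R
          (indicat_real (cbox (- (real N *\<^sub>R One)) (real N *\<^sub>R One)) x *\<^sub>R h x))"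
        by (intro integrable_mult_indicator hi) auto
      also have "(\<lambda>x. indicator (box (- (real N *\<^sub>R One)) (real N *\<^sub>R One)) x *\<^sub>R
          (indicat_real (cbox (- (real N *\<^sub>R One)) (real N *\<^sub>R One)) x *\<^sub>R h x)) = f"
        using box_subset_cbox[of "- (real N *\<^sub>R One)" "real N *\<^sub>R One :: 'a"] by (auto simp: f_def indicator_def fun_eq_iff)
      finally show ?thesis .
    qed
    have si: "set_integrable lebesgue A f" if "A \<in> sets lebesgue" for A
      unfolding set_integrable_def by (intro integrable_mult_indicator that f)
    have borel: "(LINT x:A|lebesgue. f x) = 0" if "A \<in> sets borel" for A
    proof -
      let ?E = "range (\<lambda>(a, b). box a b :: 'a set)"
      have st: "Int_stable ?E" by (auto simp: Int_stable_def box_Int_box)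
      have A: "A \<in> sigma_sets UNIV ?E" using that by (simp add: borel_eq_box)
      have meas: "B \<in> sets lebesgue" if "B \<in> sigma_sets UNIV ?E" for B
        using that sets_completionI_sets[of B lborel] by (simp add: borel_eq_box)
      show ?thesis
      proof (induction rule: sigma_sets_induct_disjoint[OF st _ A])
        case (2 B)
        then obtain a b where "B = box a b" by auto
        moreover obtain l u :: 'a where "box a b \<inter> box (- (real N *\<^sub>R One)) (real N *\<^sub>R One) = box l u"
          by (auto simp: box_Int_box)
        ultimately show ?case
          using box0[of l u] by (simp add: set_lebesgue_integral_def f_def flip: indicator_inter_arith mult.assoc)
      next
        case 3 show ?case by (simp add: set_lebesgue_integral_def)
      next
        case (4 B)
        \<comment> \<open>Complements: the integral over the whole space is an integral over the
          truncation box, hence 0.\<close>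
        have "(LINT x:UNIV - B|lebesgue. f x) + (LINT x:B|lebesgue. f x) = (LINT x:(UNIV - B) \<union> B|lebesgue. f x)"
          by (intro set_integral_Un[symmetric] si)
            (use sets.compl_sets[OF meas[OF 4(1)]] meas[OF 4(1)] in auto)
        also have "\<dots> = 0"
          using box0[of "- (real N *\<^sub>R One)" "real N *\<^sub>R One"] by (simp add: set_lebesgue_integral_def f_def[abs_def])
        finally show ?case using 4 by simp
      next
        case (5 B)
        have "(LINT x:(\<Union>i. B i)|lebesgue. f x) = (\<Sum>i. (LINT x:(B i)|lebesgue. f x))"
          using 5 by (intro lebesgue_integral_countable_add si sets.countable_UN meas)
            (auto simp: disjoint_family_on_def image_subset_iff intro!: meas)
        then show ?case using 5 by simp
      qed auto
    qed
    have "AE x in lebesgue. f x = 0"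
    proof (rule density_unique_real[OF f])
      \<comment> \<open>A Lebesgue measurable set differs from a Borel set by a null set, so the
        Borel case carries over.\<close>
      fix A :: "'a set" assume A: "A \<in> sets lebesgue"
      obtain S M M' where S: "A = S \<union> M" "M \<subseteq> M'" "M' \<in> null_sets lborel" "S \<in> sets lborel"
        using A by (auto elim: sets_completionE)
      have "M' \<in> null_sets lebesgue" using S(3) by (simp add: null_sets_completionI)
      then have "AE x in lebesgue. x \<notin> M'" by (rule AE_not_in)
      then have "(LINT x:A|lebesgue. f x) = (LINT x:S|lebesgue. f x)"
        unfolding set_lebesgue_integral_def
      proof (intro integral_cong_AE)
        show "(\<lambda>x. indicat_real A x *\<^sub>R f x) \<in> borel_measurable lebesgue"
          using si[OF A] by (simp add: set_integrable_def borel_measurable_integrable)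
        show "(\<lambda>x. indicat_real S x *\<^sub>R f x) \<in> borel_measurable lebesgue"
          using si[OF sets_completionI_sets[OF S(4)]] by (simp only: set_integrable_def borel_measurable_integrable)
        assume "AE x in lebesgue. x \<notin> M'"
        then show "AE x in lebesgue. indicat_real A x *\<^sub>R f x = indicat_real S x *\<^sub>R f x"
          by eventually_elim (use S in \<open>auto simp: indicator_def\<close>)
      qed
      also have "\<dots> = 0" using borel S(4) by simp
      finally show "(LINT x:A|lebesgue. f x) = (LINT x:A|lebesgue. 0)" by (simp add: set_lebesgue_integral_def)
    qed simp
    then show ?thesis by (simp only: f_def)
  qed
  then have "AE x in lebesgue. \<forall>N. indicator (box (- (real N *\<^sub>R One)) (real N *\<^sub>R One)) x *\<^sub>R h x = 0"
    unfolding AE_all_countable by blast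
  then show ?thesis
  proof eventually_elim
    case (elim x)
    have "x \<in> (\<Union>N. box (- (real N *\<^sub>R One)) (real N *\<^sub>R One))" unfolding UN_box_eq_UNIV by simp
    then obtain N where "x \<in> box (- (real N *\<^sub>R One)) (real N *\<^sub>R One)" by blast
    with elim show ?case by (auto simp: indicator_def dest: spec[of _ N])
  qed
qed

text \<open>The first derivative vanishes at the maximum; with \<open>d > 0\<close> it would be
  positive just to the right, and the mean value theorem would produce a larger value of
  \<open>g\<close>.\<close>

lemma second_derivative_nonpos_at_max:
  fixes g g' :: "real \<Rightarrow> real"
  assumes g: "\<And>s. (g has_real_derivative g' s) (at s)" and g': "(g' has_real_derivative d) (at 0)"
    and max: "\<And>s. g s \<le> g 0"
  shows "d \<le> 0"
proof (rule ccontr)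
  assume "\<not> d \<le> 0"
  then have "0 < d" by simp
  have "g' 0 = 0" by (rule DERIV_local_max[OF g zero_less_one]) (use max in auto)
  obtain e where e: "e > 0" "\<And>h. h > 0 \<Longrightarrow> h < e \<Longrightarrow> g' 0 < g' (0 + h)"
    using DERIV_pos_inc_right[OF g' \<open>0 < d\<close>] by blast
  have "\<exists>z. 0 < z \<and> z < e / 2 \<and> g (e / 2) - g 0 = (e / 2 - 0) * g' z"
    by (rule MVT2) (use e g in auto)
  then obtain z where z: "0 < z" "z < e / 2" "g (e / 2) - g 0 = (e / 2) * g' z" by auto
  have "0 < g' z" using e(2)[of z] z e(1) \<open>g' 0 = 0\<close> by simp
  then have "0 < (e / 2) * g' z" using e(1) by simp
  with z(3) max[of "e / 2"] show False by linarith
qed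

text \<open>Maximum principle: at a maximum of $u - \delta|x|^2$ the Laplacian of $u$ is at most
  $2n\delta$.\<close>

lemma bounded_laplace_eigenfunction_nonpos:
  fixes u :: "'a::euclidean_space \<Rightarrow> real"
  assumes cont: "continuous_on UNIV u" and bdd: "\<And>x. \<bar>u x\<bar> \<le> B" and l: "l > 0"
    and u1: "\<And>b x s. b \<in> Basis \<Longrightarrow> ((\<lambda>s. u (x + s *\<^sub>R b)) has_real_derivative u1 b (x + s *\<^sub>R b)) (at s)"
    and u2: "\<And>b x. b \<in> Basis \<Longrightarrow> ((\<lambda>s. u1 b (x + s *\<^sub>R b)) has_real_derivative u2 b x) (at 0)"
    and eq: "\<And>x. (\<Sum>b\<in>Basis. u2 b x) = l * u x"
  shows "u y \<le> 0"
proof -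
  have B: "B \<ge> 0" using bdd[of 0] by linarith
  have main: "u y \<le> e * ((norm y)\<^sup>2 + 2 * DIM('a) / l)" if e: "e > 0" for e
  proof -
    define v where "v x = u x - e * (x \<bullet> x)" for x
    \<comment> \<open>Outside this ball the penalty is at least \<open>2 * B\<close>, so
      \<open>v\<close> falls below its value at the origin, and the maximum over the ball is
      global.\<close>
    define R where "R = sqrt (2 * B / e)"
    have R: "R \<ge> 0" using B e by (simp add: R_def)
    have "continuous_on (cball 0 R) v"
      unfolding v_def by (intro continuous_intros continuous_on_subset[OF cont]) auto
    then obtain z where z: "z \<in> cball 0 R" "\<And>x. x \<in> cball 0 R \<Longrightarrow> v x \<le> v z"
      using continuous_attains_sup[of "cball 0 R" v] R by (auto simp: compact_cball)
    have max: "v x \<le> v z" for x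
    proof (cases "norm x \<le> R")
      case True then show ?thesis using z(2)[of x] by simp
    next
      case False
      then have "2 * B / e \<le> x \<bullet> x"
        using real_sqrt_le_iff[of "2 * B / e" "x \<bullet> x"] by (simp add: R_def norm_eq_sqrt_inner)
      then have "2 * B \<le> e * (x \<bullet> x)" using e by (simp add: field_simps)
      then have "v x \<le> u 0" unfolding v_def using bdd[of x] bdd[of 0] by linarith
      also have "\<dots> \<le> v z" using z(2)[of 0] R by (simp add: v_def)
      finally show ?thesis .
    qed
    have "u2 b z - 2 * e \<le> 0" if b: "b \<in> Basis" for b
    proof (rule second_derivative_nonpos_at_max[of "\<lambda>s. v (z + s *\<^sub>R b)" "\<lambda>s. u1 b (z + s *\<^sub>R b) - e * (2 * (z \<bullet> b) + 2 * s)"])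
      have i: "(z + s *\<^sub>R b) \<bullet> (z + s *\<^sub>R b) = z \<bullet> z + 2 * s * (z \<bullet> b) + s\<^sup>2" for s
        using b by (simp add: algebra_simps inner_commute power2_eq_square)
      show "((\<lambda>s. v (z + s *\<^sub>R b)) has_real_derivative u1 b (z + s *\<^sub>R b) - e * (2 * (z \<bullet> b) + 2 * s)) (at s)" for s
        unfolding v_def i by (auto intro!: derivative_eq_intros u1 b)
      show "((\<lambda>s. u1 b (z + s *\<^sub>R b) - e * (2 * (z \<bullet> b) + 2 * s)) has_real_derivative u2 b z - 2 * e) (at 0)"
        by (auto intro!: derivative_eq_intros u2 b)
      show "v (z + s *\<^sub>R b) \<le> v (z + 0 *\<^sub>R b)" for s using max by simp
    qed
    then have "(\<Sum>b\<in>Basis. u2 b z) \<le> (\<Sum>b\<in>(Basis :: 'a set). 2 * e)" by (intro sum_mono) auto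
    then have "u z \<le> 2 * e * DIM('a) / l" unfolding eq using l by (simp add: field_simps)
    moreover have "u y - e * (y \<bullet> y) \<le> u z"
    proof -
      have "0 \<le> e * (z \<bullet> z)" using e by simp
      then show ?thesis using max[of y] unfolding v_def by linarith
    qed
    ultimately show ?thesis by (simp add: power2_norm_eq_inner algebra_simps)
  qed
  have "((\<lambda>e. e * ((norm y)\<^sup>2 + 2 * DIM('a) / l)) \<longlongrightarrow> 0 * ((norm y)\<^sup>2 + 2 * DIM('a) / l)) (at_right 0)"
    by (intro tendsto_intros)
  then have "u y \<le> 0 * ((norm y)\<^sup>2 + 2 * DIM('a) / l)"
  proof (rule tendsto_lowerbound)
    show "\<forall>\<^sub>F e in at_right 0. u y \<le> e * ((norm y)\<^sup>2 + 2 * DIM('a) / l)"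
      by (rule eventually_at_rightI[of 0 1], rule main) auto
  qed simp
  then show ?thesis by simp
qed

lemma locally_integrable_L2_real:
  fixes h :: "'a::euclidean_space \<Rightarrow> real"
  assumes "(\<lambda>x. complex_of_real (h x)) \<in> L2"
  shows "locally_integrable h"
  unfolding locally_integrable_def set_integrable_def
proof (intro allI impI)
  fix K :: "'a set" assume K: "compact K"
  have m: "h \<in> borel_measurable lebesgue"
    using measurable_compose[OF L2_measurable[OF assms] borel_measurable_continuous_onI[OF linear_continuous_on[OF bounded_linear_Re]]]
    by simp
  have "locally_integrable (\<lambda>x::'a. 1::real)" by (rule locally_integrable_const)
  then have "integrable lebesgue (indicat_real K)"
    using K unfolding locally_integrable_def set_integrable_def by simp
  then have i: "integrable lebesgue (\<lambda>x. indicat_real K x + (h x)\<^sup>2)"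
    using L2_integrable[OF assms] by simp
  show "integrable lebesgue (\<lambda>x. indicat_real K x *\<^sub>R h x)"
  proof (rule Bochner_Integration.integrable_bound[OF i])
    show "(\<lambda>x. indicat_real K x *\<^sub>R h x) \<in> borel_measurable lebesgue"
      using lmeasurable_compact[OF K] by (intro borel_measurable_scaleR borel_measurable_indicator m) (auto simp: fmeasurableD)
    have "\<bar>t\<bar> \<le> 1 + t\<^sup>2" for t :: real
      using sum_squares_bound[of "\<bar>t\<bar>" 1] by simp
    then show "AE x in lebesgue. norm (indicat_real K x *\<^sub>R h x) \<le> norm (indicat_real K x + (h x)\<^sup>2)"
      by (intro AE_I2) (auto simp: indicator_def)
  qed
qed

text \<open>The correlation $y \mapsto \int h(x)\psi(x + y)\,dx$ is a bounded solution of
  $\Delta u = lu$, hence zero.\<close>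

lemma L2_orth_Helmholtz_AE_zero:
  fixes h :: "'a::euclidean_space \<Rightarrow> real"
  assumes h: "(\<lambda>x. complex_of_real (h x)) \<in> L2" and l: "l > 0"
    and orth: "\<And>\<psi>. smooth \<psi> \<Longrightarrow> csupp \<psi> \<Longrightarrow> (LINT x|lebesgue. h x * laplacian \<psi> x) = l * (LINT x|lebesgue. h x * \<psi> x)"
  shows "AE x in lebesgue. h x = 0"
proof (rule locally_integrable_orth_test_AE_zero)
  show lh: "locally_integrable h" using h by (rule locally_integrable_L2_real)
  fix \<psi> :: "'a \<Rightarrow> real" assume \<psi>: "smooth \<psi>" "csupp \<psi>"
  \<comment> \<open>The maximum principle yields one inequality for every test function; applying it
    to \<open>\<psi>\<close> and to \<open>- \<psi>\<close> gives equality.\<close>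
  have nonpos: "(LINT x|lebesgue. h x * \<rho> x) \<le> 0" if \<rho>: "smooth \<rho>" "csupp \<rho>" for \<rho>
  proof -
    define u where "u r y = (LINT x|lebesgue. h x * r (x + y))" for r :: "'a \<Rightarrow> real" and y
    have tr: "smooth (\<lambda>x. r (x + y))" "csupp (\<lambda>x. r (x + y))" if "smooth r" "csupp r" for r :: "'a \<Rightarrow> real" and y
      using smooth_affine[OF that(1), of 1 y] csupp_affine[OF that(2), of 1 y] by simp_all
    have der: "((\<lambda>s. u r (y + s *\<^sub>R b)) has_real_derivative u (dir_deriv b r) (y + s *\<^sub>R b)) (at s)"
      if r: "smooth r" "csupp r" and b: "b \<in> Basis" for r b s y
    proof -
      have "((\<lambda>t. LINT x|lebesgue. h x * (\<lambda>x. r (x + (y + s *\<^sub>R b))) (x + t *\<^sub>R b)) has_real_derivative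
        (LINT x|lebesgue. h x * dir_deriv b (\<lambda>x. r (x + (y + s *\<^sub>R b))) x)) (at 0)"
        by (rule has_real_derivative_integral_translate[OF lh tr[OF r] b])
      then have "((\<lambda>t. u r (y + (t + s) *\<^sub>R b)) has_real_derivative u (dir_deriv b r) (y + s *\<^sub>R b)) (at 0)"
        using dir_deriv_affine[OF smooth_differentiable[OF r(1)], of b 1 "y + s *\<^sub>R b"]
        by (simp add: u_def algebra_simps)
      then show ?thesis using DERIV_shift[of "\<lambda>t. u r (y + t *\<^sub>R b)" _ 0 s] by (simp add: add.commute)
    qed
    have "u \<rho> 0 \<le> 0"
    proof (rule bounded_laplace_eigenfunction_nonpos[OF _ _ l, where ?u1.0 = "\<lambda>b. u (dir_deriv b \<rho>)"
          and ?u2.0 = "\<lambda>b. u (dir_deriv b (dir_deriv b \<rho>))"])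
      show "((\<lambda>s. u \<rho> (x + s *\<^sub>R b)) has_real_derivative u (dir_deriv b \<rho>) (x + s *\<^sub>R b)) (at s)"
        if "b \<in> Basis" for b x s by (rule der[OF \<rho> that])
      show "((\<lambda>s. u (dir_deriv b \<rho>) (x + s *\<^sub>R b)) has_real_derivative u (dir_deriv b (dir_deriv b \<rho>)) x) (at 0)"
        if "b \<in> Basis" for b x
        using der[OF smooth_dir_deriv[OF \<rho>(1) that] csupp_dir_deriv[OF \<rho>(2)] that, of x 0] by simp
      show "(\<Sum>b\<in>Basis. u (dir_deriv b (dir_deriv b \<rho>)) y) = l * u \<rho> y" for y
      proof -
        have i: "integrable lebesgue (\<lambda>x. h x * dir_deriv b (dir_deriv b \<rho>) (x + y))" if "b \<in> Basis" for b
          by (intro locally_integrable_mult lh smooth_continuous tr smooth_dir_deriv csupp_dir_deriv \<rho> that)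
        have "laplacian (\<lambda>x. \<rho> (x + y)) x = laplacian \<rho> (x + y)" for x
        proof -
          have "dir_deriv b (\<lambda>x. r (x + y)) = (\<lambda>x. dir_deriv b r (x + y))" if "smooth r" for b r
            using dir_deriv_affine[OF smooth_differentiable[OF that], of b 1 y] by (simp add: fun_eq_iff)
          note e = this
          show ?thesis unfolding laplacian_def
            by (intro sum.cong refl) (simp only: e[OF \<rho>(1)] e[OF smooth_dir_deriv[OF \<rho>(1)]])
        qed
        then have "(LINT x|lebesgue. h x * laplacian \<rho> (x + y)) = l * u \<rho> y"
          using orth[OF tr[OF \<rho>, of y]] by (simp add: u_def)
        moreover have "(LINT x|lebesgue. h x * laplacian \<rho> (x + y)) = (\<Sum>b\<in>Basis. u (dir_deriv b (dir_deriv b \<rho>)) y)"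
          unfolding u_def laplacian_def sum_distrib_left by (rule Bochner_Integration.integral_sum) (rule i)
        ultimately show ?thesis by simp
      qed
      \<comment> \<open>The correlation is the inner product of \<open>h\<close> with a translate,
        and all translates have the same norm; hence it is bounded by Cauchy-Schwarz.\<close>
      define P where "P = cls (\<lambda>x. complex_of_real (h x))"
      have c2: "continuous_on UNIV (\<lambda>x. complex_of_real (\<rho> (x + y)))" for y
        by (intro continuous_intros smooth_continuous tr \<rho>)
      have c3: "csupp (\<lambda>x. complex_of_real (\<rho> (x + y)))" for y
        by (rule csupp_mono[OF tr(2)[OF \<rho>]]) auto
      have L: "(\<lambda>x. complex_of_real (\<rho> (x + y))) \<in> L2" for y
        by (rule csupp_L2[OF c2 c3])
      have ui: "u \<rho> y = inner P (cls (\<lambda>x. complex_of_real (\<rho> (x + y))))" for y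
        unfolding P_def inner_cls_inner[OF h L] u_def by (simp add: inner_complex_def)
      have nn: "norm (cls (\<lambda>x. complex_of_real (\<rho> (x + y)))) = norm (cls (\<lambda>x. complex_of_real (\<rho> (x + 0))))" for y
        unfolding norm_cls[OF L] l2_norm_def
        using lebesgue_integral_affine[of 1 "\<lambda>x. (cmod (complex_of_real (\<rho> x)))\<^sup>2" y]
          continuous_lebesgue_measurable[OF continuous_on_power[OF smooth_continuous[OF \<rho>(1)], of 2]] by simp
      show "\<bar>u \<rho> y\<bar> \<le> norm P * norm (cls (\<lambda>x. complex_of_real (\<rho> (x + 0))))" for y
        using Cauchy_Schwarz_ineq2[of P] unfolding ui nn[of y, symmetric] .
      show "continuous_on UNIV (u \<rho>)"
      proof (clarsimp simp: continuous_on_sequentially o_def)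
        fix Y y assume Y: "Y \<longlonglongrightarrow> (y::'a)"
        obtain M where M: "\<And>i. norm (Y i) \<le> M"
          using convergent_imp_Bseq[OF convergentI[OF Y]] by (auto simp: Bseq_def)
        obtain R where R: "\<And>x. R < norm x \<Longrightarrow> \<rho> x = 0" using \<rho> by (auto simp: csupp_def)
        obtain B where B: "0 \<le> B" "\<And>x. norm (\<rho> x) \<le> B"
          using csupp_bounded[OF smooth_continuous[OF \<rho>(1)] \<rho>(2)] by blast
        have hi: "integrable lebesgue (\<lambda>x. indicator (cball 0 (R + M)) x *\<^sub>R h x)"
          using lh unfolding locally_integrable_def set_integrable_def by auto
        show "(\<lambda>n. u \<rho> (Y n)) \<longlonglongrightarrow> u \<rho> y"
          unfolding u_def
        proof (rule Bochner_Integration.integral_dominated_convergence[where w = "\<lambda>x. B * \<bar>indicator (cball 0 (R + M)) x *\<^sub>R h x\<bar>"])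
          show "(\<lambda>x. h x * \<rho> (x + z)) \<in> borel_measurable lebesgue" for z
            by (intro borel_measurable_integrable locally_integrable_mult lh smooth_continuous tr \<rho>)
          then show "(\<lambda>x. h x * \<rho> (x + Y i)) \<in> borel_measurable lebesgue" for i .
          show "integrable lebesgue (\<lambda>x. B * \<bar>indicator (cball 0 (R + M)) x *\<^sub>R h x\<bar>)"
            using hi by (intro integrable_mult_right integrable_abs)
          have "isCont \<rho> z" for z
            using smooth_continuous[OF \<rho>(1)] by (simp add: continuous_on_eq_continuous_at)
          then show "AE x in lebesgue. (\<lambda>i. h x * \<rho> (x + Y i)) \<longlonglongrightarrow> h x * \<rho> (x + y)"
            by (intro AE_I2 tendsto_mult tendsto_const isCont_tendsto_compose[of _ \<rho>] tendsto_add Y) auto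
          show "AE x in lebesgue. norm (h x * \<rho> (x + Y i)) \<le> B * \<bar>indicator (cball 0 (R + M)) x *\<^sub>R h x\<bar>" for i
          proof (intro AE_I2)
            fix x :: 'a
            show "norm (h x * \<rho> (x + Y i)) \<le> B * \<bar>indicator (cball 0 (R + M)) x *\<^sub>R h x\<bar>"
            proof (cases "norm x \<le> R + M")
              case True
              then show ?thesis using mult_right_mono[OF B(2)[of "x + Y i"], of "\<bar>h x\<bar>"]
                by (simp add: abs_mult mult.commute)
            next
              case False
              then have "R < norm (x + Y i)"
                using norm_triangle_ineq4[of "x + Y i" "Y i"] M[of i] by simp
              then show ?thesis using R B by simp
            qed
          qed
        qed
      qed
    qed
    then show ?thesis by (simp add: u_def)
  qed
  have "(LINT x|lebesgue. h x * - \<psi> x) \<le> 0"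
    by (rule nonpos) (auto intro: smooth_minus \<psi> csupp_mono[OF \<psi>(2)])
  then show "(LINT x|lebesgue. h x * \<psi> x) = 0"
    using nonpos[OF \<psi>] by simp
qed

lemma Rep_testf_diff: "Rep_testf (f - g) = (\<lambda>x. Rep_testf f x - Rep_testf g x)"
  unfolding minus_testf_def plus_testf.rep_eq uminus_testf.rep_eq by simp

text \<open>Whatever is orthogonal to the range solves \<open>Laplacian F = l F\<close> weakly, and
  a square-integrable weak solution vanishes. The real and imaginary parts are treated
  separately.\<close>

lemma dense_range_Helmholtz:
  assumes l: "l > 0"
  shows "closure (range (\<lambda>f::'a::euclidean_space testf. emb (l *\<^sub>R f - tlap f))) = UNIV"
proof (rule dense_if_orthogonal_trivial)
  have lin: "linear (\<lambda>f::'a testf. emb (l *\<^sub>R f - tlap f))"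
    by (intro linear_compose[OF _ linear_emb, unfolded o_def] linear_compose_sub linear_tlap linear_compose_scale_right linear_ident)
  show "subspace (range (\<lambda>f::'a testf. emb (l *\<^sub>R f - tlap f)))"
    by (rule linear_subspace_image[OF lin subspace_UNIV])
  fix F :: "'a lsq" assume orth: "\<And>s. s \<in> range (\<lambda>f. emb (l *\<^sub>R f - tlap f)) \<Longrightarrow> inner F s = 0"
  obtain f where f: "f \<in> L2" "F = cls f" by (rule lsq_cases)
  \<comment> \<open>The pair \<open>L\<close>, \<open>c\<close> is \<open>Re\<close> with 1 or
    \<open>Im\<close> with the imaginary unit: pairing with a real test function times
    \<open>c\<close> isolates the corresponding part of \<open>f\<close>.\<close>
  have zero: "AE x in lebesgue. L (f x) = 0" if L: "bounded_linear L" and c: "\<And>z t. z \<bullet> (t *\<^sub>R c) = L z * t"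
    and n: "\<And>z. \<bar>L z\<bar> \<le> cmod z" for L :: "complex \<Rightarrow> real" and c
  proof (rule L2_orth_Helmholtz_AE_zero[OF _ l])
    have m: "(\<lambda>x. L (f x)) \<in> borel_measurable lebesgue"
      using measurable_compose[OF L2_measurable[OF f(1)] borel_measurable_continuous_onI[OF linear_continuous_on[OF L]]] .
    show "(\<lambda>x. complex_of_real (L (f x))) \<in> L2"
      unfolding L2_def
    proof (intro CollectI conjI)
      show "(\<lambda>x. complex_of_real (L (f x))) \<in> borel_measurable lebesgue" using m by simp
      show "integrable lebesgue (\<lambda>x. (cmod (complex_of_real (L (f x))))\<^sup>2)"
      proof (rule Bochner_Integration.integrable_bound[OF L2_integrable[OF f(1)]])
        show "(\<lambda>x. (cmod (complex_of_real (L (f x))))\<^sup>2) \<in> borel_measurable lebesgue" using m by simp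
        show "AE x in lebesgue. norm ((cmod (complex_of_real (L (f x))))\<^sup>2) \<le> norm ((cmod (f x))\<^sup>2)"
          using n by (intro AE_I2) (simp add: power_mono abs_le_square_iff[symmetric])
      qed
    qed
    then have lh: "locally_integrable (\<lambda>x. L (f x))" by (rule locally_integrable_L2_real)
    fix \<psi> :: "'a \<Rightarrow> real" assume \<psi>: "smooth \<psi>" "csupp \<psi>"
    have bl: "bounded_linear (\<lambda>t. t *\<^sub>R c)" by (rule bounded_linear_scaleR_left)
    have t: "(\<lambda>x. \<psi> x *\<^sub>R c) \<in> test_functions"
      using smooth_bounded_linear[OF bl \<psi>(1)] csupp_mono[OF \<psi>(2), of "\<lambda>x. \<psi> x *\<^sub>R c"] by (simp add: test_functions_iff)
    define p where "p = Abs_testf (\<lambda>x. \<psi> x *\<^sub>R c)"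
    have p: "Rep_testf p = (\<lambda>x. \<psi> x *\<^sub>R c)" by (simp add: p_def Abs_testf_inverse t)
    have lap: "laplacian (\<lambda>x. \<psi> x *\<^sub>R c) = (\<lambda>x. laplacian \<psi> x *\<^sub>R c)"
      by (simp add: laplacian_def fun_eq_iff dir_deriv_bounded_linear[OF bl] smooth_differentiable smooth_dir_deriv \<psi> scaleR_sum_left)
    have sl: "smooth (laplacian \<psi>)" "csupp (laplacian \<psi>)"
      unfolding laplacian_def[abs_def] by (intro smooth_sum csupp_sum smooth_dir_deriv csupp_dir_deriv \<psi>; assumption)+
    have "0 = inner F (emb (l *\<^sub>R p - tlap p))" using orth by simp
    also have "\<dots> = (LINT x|lebesgue. f x \<bullet> ((l * \<psi> x - laplacian \<psi> x) *\<^sub>R c))"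
      unfolding f(2) emb_def inner_cls_inner[OF f(1) Rep_testf_L2]
      by (simp add: Rep_testf_diff scaleR_testf.rep_eq Rep_testf_tlap p lap scaleR_left_diff_distrib)
    also have "\<dots> = (LINT x|lebesgue. l * (L (f x) * \<psi> x) - L (f x) * laplacian \<psi> x)"
      unfolding c by (simp add: right_diff_distrib mult.left_commute)
    also have "\<dots> = l * (LINT x|lebesgue. L (f x) * \<psi> x) - (LINT x|lebesgue. L (f x) * laplacian \<psi> x)"
      using locally_integrable_mult[OF lh smooth_continuous[OF \<psi>(1)] \<psi>(2)]
        locally_integrable_mult[OF lh smooth_continuous[OF sl(1)] sl(2)] by simp
    finally show "(LINT x|lebesgue. L (f x) * laplacian \<psi> x) = l * (LINT x|lebesgue. L (f x) * \<psi> x)" by simp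
  qed
  have "AE x in lebesgue. Re (f x) = 0"
    by (rule zero[of Re 1]) (auto simp: bounded_linear_Re abs_Re_le_cmod inner_complex_def)
  moreover have "AE x in lebesgue. Im (f x) = 0"
    by (rule zero[of Im \<i>]) (auto simp: bounded_linear_Im abs_Im_le_cmod inner_complex_def)
  ultimately have "AE x in lebesgue. f x = 0"
    by eventually_elim (simp add: complex_eq_iff)
  then show "F = 0"
    unfolding f(2) cls_zero[symmetric] by (simp add: cls_eq_iff f(1) L2_zero)
qed

subsection \<open>The relative bound and the energy form\<close>

lemma csupp_locally_integrable:
  fixes f :: "'a::euclidean_space \<Rightarrow> 'b::euclidean_space"
  assumes "continuous_on UNIV f" "csupp f"
  shows "locally_integrable f"
  unfolding locally_integrable_def set_integrable_def
  by (intro allI impI integrable_mult_indicator csupp_integrable assms)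
    (simp add: lmeasurable_compact fmeasurableD)

lemma integral_by_parts_complex:
  fixes f :: "'a::euclidean_space \<Rightarrow> complex" and g :: "'a \<Rightarrow> real"
  assumes "smooth f" "csupp f" "smooth g" "b \<in> Basis"
  shows "(LINT x|lebesgue. g x *\<^sub>R dir_deriv b f x) = - (LINT x|lebesgue. dir_deriv b g x *\<^sub>R f x)"
proof -
  have i1: "integrable lebesgue (\<lambda>x. g x *\<^sub>R dir_deriv b f x)"
    using assms by (intro csupp_integrable smooth_continuous smooth_scaleR smooth_dir_deriv
        csupp_mono[OF csupp_dir_deriv[OF assms(2)]]) auto
  have i2: "integrable lebesgue (\<lambda>x. dir_deriv b g x *\<^sub>R f x)"
    using assms by (intro csupp_integrable smooth_continuous smooth_scaleR smooth_dir_deriv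
        csupp_mono[OF assms(2)]) auto
  have "L (LINT x|lebesgue. g x *\<^sub>R dir_deriv b f x) = L (- (LINT x|lebesgue. dir_deriv b g x *\<^sub>R f x))"
    if L: "bounded_linear L" for L :: "complex \<Rightarrow> real"
  proof -
    have s: "smooth (\<lambda>x. L (f x))" "csupp (\<lambda>x. L (f x))"
      using smooth_bounded_linear[OF L assms(1)] csupp_mono[OF assms(2), of "\<lambda>x. L (f x)"]
        linear_0[OF bounded_linear.linear[OF L]] by auto
    have "L (LINT x|lebesgue. g x *\<^sub>R dir_deriv b f x) = (LINT x|lebesgue. g x * dir_deriv b (\<lambda>x. L (f x)) x)"
      by (simp add: integral_bounded_linear[OF L i1, symmetric] linear_scale[OF bounded_linear.linear[OF L]]
          dir_deriv_bounded_linear[OF L] smooth_differentiable assms)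
    also have "\<dots> = - (LINT x|lebesgue. dir_deriv b g x * L (f x))"
      by (rule integral_by_parts_real[OF s assms(3,4)])
    also have "\<dots> = L (- (LINT x|lebesgue. dir_deriv b g x *\<^sub>R f x))"
      by (simp add: integral_bounded_linear[OF L i2, symmetric] linear_scale[OF bounded_linear.linear[OF L]]
          linear_neg[OF bounded_linear.linear[OF L]])
    finally show ?thesis .
  qed
  from this[OF bounded_linear_Re] this[OF bounded_linear_Im] show ?thesis
    by (simp add: complex_eq_iff)
qed

lemma weak_dir_deriv_test:
  fixes f :: "'a::euclidean_space \<Rightarrow> complex"
  assumes "smooth f" "csupp f" "b \<in> Basis"
  shows "weak_dir_deriv b f (dir_deriv b f)"
  unfolding weak_dir_deriv_def test_functions_iff
  using assms by (auto intro!: csupp_locally_integrable smooth_continuous smooth_dir_deriv csupp_dir_deriv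
      integral_by_parts_complex)

lemma test_in_H2:
  assumes "smooth f" "csupp f"
  shows "f \<in> H2"
proof -
  have L: "g \<in> L2" if "smooth g" "csupp g" for g :: "'a \<Rightarrow> complex"
    using that by (intro csupp_L2 smooth_continuous)
  show ?thesis
    unfolding H2_def
  proof (intro CollectI conjI ballI)
    show "f \<in> L2" by (rule L[OF assms])
    fix b :: 'a assume b: "b \<in> Basis"
    note d = smooth_dir_deriv[OF assms(1) b] csupp_dir_deriv[OF assms(2), of b]
    have "\<exists>h\<in>L2. weak_dir_deriv c (dir_deriv b f) h" if c: "c \<in> Basis" for c
      by (intro bexI[of _ "dir_deriv c (dir_deriv b f)"] weak_dir_deriv_test d c L smooth_dir_deriv csupp_dir_deriv)
    then show "\<exists>g\<in>L2. weak_dir_deriv b f g \<and> (\<forall>c\<in>Basis. \<exists>h\<in>L2. weak_dir_deriv c g h)"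
      by (intro bexI[of _ "dir_deriv b f"] conjI weak_dir_deriv_test assms b L d) blast
  qed
qed

lemma smooth_laplacian: "smooth f \<Longrightarrow> smooth (laplacian f)"
  unfolding laplacian_def[abs_def] by (intro smooth_sum smooth_dir_deriv)

lemma csupp_laplacian: "csupp f \<Longrightarrow> csupp (laplacian f)"
  unfolding laplacian_def[abs_def] by (intro csupp_sum csupp_dir_deriv)

lemma weak_laplacian_test:
  fixes f :: "'a::euclidean_space \<Rightarrow> complex"
  assumes "smooth f" "csupp f"
  shows "weak_laplacian f (laplacian f)"
  unfolding weak_laplacian_def test_functions_iff
proof (intro conjI allI impI csupp_locally_integrable smooth_continuous smooth_laplacian csupp_laplacian assms)
  fix \<phi> :: "'a \<Rightarrow> real" assume \<phi>: "smooth \<phi> \<and> csupp \<phi>"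
  have "(LINT x|lebesgue. \<phi> x *\<^sub>R laplacian f x) = (\<Sum>b\<in>Basis. LINT x|lebesgue. \<phi> x *\<^sub>R dir_deriv b (dir_deriv b f) x)"
    unfolding laplacian_def scaleR_sum_right
    by (intro Bochner_Integration.integral_sum csupp_integrable smooth_continuous smooth_scaleR smooth_dir_deriv assms)
      (use \<phi> in \<open>auto intro: csupp_mono\<close>)
  also have "\<dots> = (\<Sum>b\<in>Basis. LINT x|lebesgue. dir_deriv b (dir_deriv b \<phi>) x *\<^sub>R f x)"
  proof (intro sum.cong refl)
    fix b :: 'a assume b: "b \<in> Basis"
    show "(LINT x|lebesgue. \<phi> x *\<^sub>R dir_deriv b (dir_deriv b f) x) = (LINT x|lebesgue. dir_deriv b (dir_deriv b \<phi>) x *\<^sub>R f x)"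
      using integral_by_parts_complex[OF smooth_dir_deriv[OF assms(1) b] csupp_dir_deriv[OF assms(2)] _ b, of \<phi>]
        integral_by_parts_complex[OF assms smooth_dir_deriv[of \<phi> b] b] \<phi> b by simp
  qed
  also have "\<dots> = (LINT x|lebesgue. laplacian \<phi> x *\<^sub>R f x)"
    unfolding laplacian_def scaleR_sum_left
    by (intro Bochner_Integration.integral_sum[symmetric] csupp_integrable smooth_continuous smooth_scaleR smooth_dir_deriv assms)
      (use \<phi> assms in \<open>auto intro: csupp_mono\<close>)
  finally show "(LINT x|lebesgue. \<phi> x *\<^sub>R laplacian f x) = (LINT x|lebesgue. laplacian \<phi> x *\<^sub>R f x)" .
qed

lemma l2_norm_dilate:
  fixes f :: "'a::euclidean_space \<Rightarrow> complex"
  assumes "R > 0" "f \<in> borel_measurable lebesgue"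
  shows "l2_norm f = sqrt (R ^ DIM('a)) * l2_norm (\<lambda>x. f (R *\<^sub>R x))"
proof -
  have "(\<lambda>x. (cmod (f x))\<^sup>2) \<in> borel_measurable lebesgue" using assms by simp
  from lebesgue_integral_affine[OF _ this, of R 0] show ?thesis
    using assms by (simp add: l2_norm_def real_sqrt_mult)
qed

lemma l2_norm_cmult: "l2_norm (\<lambda>x. c * f x) = cmod c * l2_norm f"
  by (simp add: l2_norm_def norm_mult power_mult_distrib real_sqrt_mult)

lemma laplacian_dilate:
  assumes "smooth f"
  shows "laplacian (\<lambda>x. f (R *\<^sub>R x)) x = R\<^sup>2 *\<^sub>R laplacian f (R *\<^sub>R x)"
proof -
  have e: "dir_deriv b (\<lambda>x. g (R *\<^sub>R x)) = (\<lambda>x. R *\<^sub>R dir_deriv b g (R *\<^sub>R x))" if "smooth g" for b and g :: "'a \<Rightarrow> 'b"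
    using dir_deriv_affine[OF smooth_differentiable[OF that], of b R 0] by (simp add: fun_eq_iff)
  have "dir_deriv b (dir_deriv b (\<lambda>x. f (R *\<^sub>R x))) x = R\<^sup>2 *\<^sub>R dir_deriv b (dir_deriv b f) (R *\<^sub>R x)" if b: "b \<in> Basis" for b
  proof -
    have s: "smooth (dir_deriv b f)" by (rule smooth_dir_deriv[OF assms b])
    have "smooth (\<lambda>x. dir_deriv b f (R *\<^sub>R x))" using smooth_affine[OF s, of R 0] by simp
    from dir_deriv_bounded_linear[OF bounded_linear_scaleR_right smooth_differentiable[OF this], of b R]
    show ?thesis unfolding e[OF assms] by (simp add: e[OF s] power2_eq_square)
  qed
  then show ?thesis unfolding laplacian_def scaleR_sum_right by (intro sum.cong) auto
qed

text \<open>The relative bound holds uniformly in $R$; undoing the dilation turns the lower-order term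
  $b\|f\|$ into $bR^{-2}\|f\|$, which vanishes as $R \to \infty$.\<close>

lemma scale_invariant_potential_bound:
  fixes V :: "'a::euclidean_space \<Rightarrow> real" and f :: "'a \<Rightarrow> complex"
  assumes V: "\<And>R f g. R > 0 \<Longrightarrow> f \<in> H2 \<Longrightarrow> g \<in> L2 \<Longrightarrow> weak_laplacian f g \<Longrightarrow>
      (\<lambda>x. complex_of_real (rescale R V x) * f x) \<in> L2 \<and>
      l2_norm (\<lambda>x. complex_of_real (rescale R V x) * f x) \<le> a * l2_norm g + b * l2_norm f"
    and f: "smooth f" "csupp f"
  shows "(\<lambda>x. complex_of_real (V x) * f x) \<in> L2"
    "l2_norm (\<lambda>x. complex_of_real (V x) * f x) \<le> a * l2_norm (laplacian f)"
proof -
  have L: "g \<in> L2" if "smooth g" "csupp g" for g :: "'a \<Rightarrow> complex"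
    using that by (intro csupp_L2 smooth_continuous)
  show VL: "(\<lambda>x. complex_of_real (V x) * f x) \<in> L2"
    using V[OF zero_less_one test_in_H2[OF f] L[OF smooth_laplacian csupp_laplacian] weak_laplacian_test[OF f], OF f]
    by (simp add: rescale_def[abs_def])
  have main: "l2_norm (\<lambda>x. complex_of_real (V x) * f x) \<le> a * l2_norm (laplacian f) + b * l2_norm f * inverse (R\<^sup>2)" if R: "R > 0" for R
  proof -
    let ?f = "\<lambda>x. f (R *\<^sub>R x)" and ?s = "sqrt (R ^ DIM('a))"
    have s: "?s > 0" using R by simp
    have fR: "smooth ?f" "csupp ?f"
      using smooth_affine[OF f(1), of R 0] csupp_affine[OF f(2), of R 0] R by auto
    have lap: "laplacian ?f = (\<lambda>x. complex_of_real (R\<^sup>2) * laplacian f (R *\<^sub>R x))"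
      by (simp add: fun_eq_iff laplacian_dilate[OF f(1)] scaleR_conv_of_real)
    have pot: "(\<lambda>x. complex_of_real (rescale R V x) * ?f x)
      = (\<lambda>x. complex_of_real (R\<^sup>2) * (\<lambda>x. complex_of_real (V x) * f x) (R *\<^sub>R x))"
      by (simp add: fun_eq_iff rescale_def)
    have "l2_norm (\<lambda>x. complex_of_real (rescale R V x) * ?f x) \<le> a * l2_norm (laplacian ?f) + b * l2_norm ?f"
      using V[OF R test_in_H2[OF fR] L[OF smooth_laplacian csupp_laplacian] weak_laplacian_test[OF fR], OF fR] by simp
    \<comment> \<open>The factor \<open>?s\<close> undoes the change of volume in all three norms.
      The Laplacian and the rescaled potential both produce the factor \<open>R\<^sup>2\<close>, but
      the lower-order term does not, which is why dividing leaves it small.\<close>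
    then have "?s * (R\<^sup>2 * l2_norm (\<lambda>x. (\<lambda>x. complex_of_real (V x) * f x) (R *\<^sub>R x)))
      \<le> ?s * (a * (R\<^sup>2 * l2_norm (\<lambda>x. laplacian f (R *\<^sub>R x))) + b * l2_norm ?f)"
      unfolding lap pot l2_norm_cmult norm_of_real abs_power2 using s by (intro mult_left_mono) auto
    then have "R\<^sup>2 * l2_norm (\<lambda>x. complex_of_real (V x) * f x) \<le> a * (R\<^sup>2 * l2_norm (laplacian f)) + b * l2_norm f"
      unfolding l2_norm_dilate[OF R L2_measurable[OF VL]]
        l2_norm_dilate[OF R L2_measurable[OF L[OF smooth_laplacian[OF f(1)] csupp_laplacian[OF f(2)]]]]
        l2_norm_dilate[OF R L2_measurable[OF L[OF f]]]
      by (simp add: algebra_simps)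
    then show ?thesis using R by (simp add: field_simps)
  qed
  have "((\<lambda>R. a * l2_norm (laplacian f) + b * l2_norm f * inverse (R\<^sup>2)) \<longlongrightarrow>
      a * l2_norm (laplacian f) + b * l2_norm f * 0) at_top"
    by (intro tendsto_intros tendsto_inverse_0_at_top filterlim_pow_at_top filterlim_ident) auto
  then have "l2_norm (\<lambda>x. complex_of_real (V x) * f x) \<le> a * l2_norm (laplacian f) + b * l2_norm f * 0"
  proof (rule tendsto_lowerbound)
    show "\<forall>\<^sub>F R in at_top. l2_norm (\<lambda>x. complex_of_real (V x) * f x)
        \<le> a * l2_norm (laplacian f) + b * l2_norm f * inverse (R\<^sup>2)"
      using eventually_gt_at_top[of "0::real"] by eventually_elim (rule main)
  qed simp
  then show "l2_norm (\<lambda>x. complex_of_real (V x) * f x) \<le> a * l2_norm (laplacian f)" by simp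
qed

lemma inner_tlap: "inner (emb (tlap f)) (emb g) = - (\<Sum>b\<in>Basis. inner (emb (td b f)) (emb (td b g)))"
  by (simp add: tlap_def emb_sum inner_sum_left inner_td sum_negf)

text \<open>Expanding the square, the cross term is \<open>2 * l\<close> times the Dirichlet
  integral, hence nonnegative; either remaining square may then be discarded.\<close>

lemma norm_Helmholtz_ge:
  fixes f :: "'a::euclidean_space testf"
  assumes "l > 0"
  shows "norm (emb (tlap f)) \<le> norm (emb (l *\<^sub>R f - tlap f))" "l * norm (emb f) \<le> norm (emb (l *\<^sub>R f - tlap f))"
proof -
  have e: "(norm (emb (l *\<^sub>R f - tlap f)))\<^sup>2 = (l * norm (emb f))\<^sup>2 + 2 * l * (\<Sum>b\<in>Basis. (norm (emb (td b f)))\<^sup>2) + (norm (emb (tlap f)))\<^sup>2"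
  proof -
    have g: "(norm (l *\<^sub>R p - q))\<^sup>2 = (l * norm p)\<^sup>2 + 2 * l * (- inner q p) + (norm q)\<^sup>2" for p q :: "'a lsq"
      unfolding power2_norm_eq_inner power_mult_distrib
      by (simp add: inner_diff_left inner_diff_right inner_commute[of p q] power2_eq_square algebra_simps)
    have "- inner (emb (tlap f)) (emb f) = (\<Sum>b\<in>Basis. (norm (emb (td b f)))\<^sup>2)"
      by (simp add: inner_tlap power2_norm_eq_inner)
    with g[of "emb f" "emb (tlap f)"] show ?thesis
      by (simp only: emb_diff emb_scaleR)
  qed
  have n: "0 \<le> 2 * l * (\<Sum>b\<in>Basis. (norm (emb (td b f)))\<^sup>2)"
    using assms by (intro mult_nonneg_nonneg sum_nonneg) auto
  have "(norm (emb (tlap f)))\<^sup>2 \<le> (norm (emb (l *\<^sub>R f - tlap f)))\<^sup>2"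
    unfolding e using n by simp
  then show "norm (emb (tlap f)) \<le> norm (emb (l *\<^sub>R f - tlap f))" by (rule power2_le_imp_le) simp
  have "(l * norm (emb f))\<^sup>2 \<le> (norm (emb (l *\<^sub>R f - tlap f)))\<^sup>2"
    unfolding e using n by simp
  then show "l * norm (emb f) \<le> norm (emb (l *\<^sub>R f - tlap f))" by (rule power2_le_imp_le) simp
qed

text \<open>The scale-invariant relative bound, to be instantiated with \<open>c\<close> equal to
  \<open>a 0 / 2\<close>.\<close>

locale potential =
  fixes V :: "'a::euclidean_space \<Rightarrow> real" and c :: real
  assumes VL: "\<And>f. (\<lambda>x. complex_of_real (V x) * Rep_testf f x) \<in> L2"
    and V_bound: "\<And>f. l2_norm (\<lambda>x. complex_of_real (V x) * Rep_testf f x) \<le> c * l2_norm (laplacian (Rep_testf f))"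
    and c_half: "c < 1 / 2" and c_nonneg: "0 \<le> c"
begin

definition Vop :: "'a testf \<Rightarrow> 'a lsq" where
  "Vop f = cls (\<lambda>x. complex_of_real (V x) * Rep_testf f x)"

definition H0 :: "'a testf \<Rightarrow> 'a lsq" where "H0 f = Vop f - emb (tlap f)"

lemma linear_Vop: "linear Vop"
proof (rule linearI)
  show "Vop (f + g) = Vop f + Vop g" for f g
    unfolding Vop_def plus_testf.rep_eq distrib_left by (rule cls_add[OF VL VL])
  show "Vop (r *\<^sub>R f) = r *\<^sub>R Vop f" for r f
    unfolding Vop_def scaleR_testf.rep_eq cls_scaleR[OF VL, symmetric] by simp
qed

lemma linear_H0: "linear H0"
  unfolding H0_def[abs_def]
  by (intro linear_compose_sub linear_Vop linear_compose[OF linear_tlap linear_emb, unfolded o_def])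

lemma norm_Vop: "norm (Vop f) \<le> c * norm (emb (tlap f))"
  using V_bound[of f] unfolding Vop_def emb_def norm_cls[OF VL] norm_cls[OF Rep_testf_L2] by (simp add: Rep_testf_tlap)

lemma inner_Vop: "inner (Vop f) (emb g) = inner (emb f) (Vop g)"
  unfolding Vop_def emb_def inner_cls_inner[OF VL Rep_testf_L2] inner_cls_inner[OF Rep_testf_L2 VL]
  by (simp add: inner_complex_def mult_ac distrib_left)

text \<open>Kato-Rellich with a free coupling constant \<open>k\<close>: the value 1 produces the
  resolvents of the operator itself, the values 2 and -1 serve the energy comparison.\<close>

lemma dense_range:
  assumes l: "l > 0" and k: "\<bar>k\<bar> * c < 1"
  shows "closure (range (\<lambda>f. emb (l *\<^sub>R f - tlap f) + k *\<^sub>R Vop f)) = UNIV"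
proof -
  let ?Q = "range (\<lambda>f. (emb (l *\<^sub>R f - tlap f), k *\<^sub>R Vop f))"
  have "linear (\<lambda>f. (emb (l *\<^sub>R f - tlap f), k *\<^sub>R Vop f))"
    by (rule linearI) (simp_all add: linear_add[OF linear_Vop] linear_scale[OF linear_Vop]
        linear_add[OF linear_tlap] linear_scale[OF linear_tlap] emb_add emb_diff emb_scaleR algebra_simps)
  then have Q: "subspace ?Q" by (rule linear_subspace_image[OF _ subspace_UNIV])
  have le: "norm q \<le> (\<bar>k\<bar> * c) * norm p" if pq: "(p, q) \<in> ?Q" for p q
  proof -
    obtain f where f: "p = emb (l *\<^sub>R f - tlap f)" "q = k *\<^sub>R Vop f" using pq unfolding image_iff prod.inject by blast
    have "norm q \<le> \<bar>k\<bar> * (c * norm (emb (tlap f)))"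
      unfolding f by (simp add: mult_left_mono norm_Vop)
    also have "\<dots> \<le> \<bar>k\<bar> * (c * norm p)"
      unfolding f by (intro mult_left_mono norm_Helmholtz_ge l c_nonneg) auto
    finally show ?thesis by simp
  qed
  have "closure (fst ` ?Q) = UNIV"
    using dense_range_Helmholtz[OF l, where 'a = 'a] by (simp add: image_image)
  from Kato_Rellich_dense[OF Q this k le] show ?thesis by (simp add: image_image)
qed

text \<open>A relative bound below 1 makes the operator plus \<open>l\<close> bounded below by
  \<open>(1 - \<bar>k\<bar> * c) * l\<close> in norm for all \<open>l > 0\<close>. This constant is
  not sharp, but \<open>symmetric_graph_nonneg\<close> accepts any positive multiple of
  \<open>l\<close>.\<close>

lemma form_nonneg:
  assumes k: "\<bar>k\<bar> * c < 1"
  shows "0 \<le> inner (k *\<^sub>R Vop f - emb (tlap f)) (emb f)"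
proof (rule symmetric_graph_nonneg)
  let ?G = "range (\<lambda>f. (emb f, k *\<^sub>R Vop f - emb (tlap f)))"
  have "linear (\<lambda>f. (emb f, k *\<^sub>R Vop f - emb (tlap f)))"
    by (rule linearI) (simp_all add: linear_add[OF linear_Vop] linear_scale[OF linear_Vop]
        linear_add[OF linear_tlap] linear_scale[OF linear_tlap] emb_add emb_scaleR algebra_simps)
  then show "subspace ?G" by (rule linear_subspace_image[OF _ subspace_UNIV])
  show "0 < 1 - \<bar>k\<bar> * c" using k by simp
  show "inner g f' = inner f g'" if "(f, g) \<in> ?G" "(f', g') \<in> ?G" for f g f' g'
    using that by (auto simp: inner_diff_left inner_diff_right inner_Vop inner_tlap inner_commute[of "emb _" "emb (tlap _)"])
      (simp add: inner_commute)
  show "(1 - \<bar>k\<bar> * c) * l * norm f \<le> norm (g + l *\<^sub>R f)" if fg: "(f, g) \<in> ?G" and l: "l > 0" for f g l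
  proof -
    obtain h where h: "f = emb h" "g = k *\<^sub>R Vop h - emb (tlap h)" using fg unfolding image_iff prod.inject by blast
    let ?p = "emb (l *\<^sub>R h - tlap h)"
    have "norm (k *\<^sub>R Vop h) \<le> \<bar>k\<bar> * (c * norm (emb (tlap h)))"
      by (simp add: mult_left_mono norm_Vop)
    also have "\<dots> \<le> \<bar>k\<bar> * (c * norm ?p)"
      by (intro mult_left_mono norm_Helmholtz_ge l c_nonneg) auto
    finally have "norm (k *\<^sub>R Vop h) \<le> \<bar>k\<bar> * c * norm ?p" by simp
    moreover have "norm ?p \<le> norm (?p + k *\<^sub>R Vop h) + norm (k *\<^sub>R Vop h)"
      using norm_triangle_ineq4[of "?p + k *\<^sub>R Vop h" "k *\<^sub>R Vop h"] by simp
    ultimately have "(1 - \<bar>k\<bar> * c) * norm ?p \<le> norm (?p + k *\<^sub>R Vop h)"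
      by (simp add: algebra_simps)
    moreover have "(1 - \<bar>k\<bar> * c) * (l * norm f) \<le> (1 - \<bar>k\<bar> * c) * norm ?p"
      unfolding h using k by (intro mult_left_mono norm_Helmholtz_ge l) auto
    moreover have "?p + k *\<^sub>R Vop h = g + l *\<^sub>R f"
      by (simp add: h emb_diff emb_scaleR)
    ultimately show ?thesis by simp
  qed
  show "closure ((\<lambda>(f, g). g + l *\<^sub>R f) ` ?G) = UNIV" if "l > 0" for l
    using dense_range[OF that k] by (simp add: image_image emb_diff emb_scaleR algebra_simps)
  show "(emb f, k *\<^sub>R Vop f - emb (tlap f)) \<in> ?G" by blast
qed

lemma inner_H0: "inner (H0 f) (emb g) = inner (Vop f) (emb g) + (\<Sum>b\<in>Basis. inner (emb (td b f)) (emb (td b g)))"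
  by (simp add: H0_def inner_diff_left inner_tlap)

text \<open>Write D for the Dirichlet integral and v for the potential term, so that the energy is
  \<open>D + v\<close>. Coupling 2 gives \<open>0 \<le> D + 2 v\<close>, that is
  \<open>D \<le> 2 (D + v)\<close>; coupling -1 gives \<open>v \<le> D\<close>, that is
  \<open>D + v \<le> 2 D\<close>.\<close>

lemma energy_bounds:
  shows "(\<Sum>b\<in>Basis. (norm (emb (td b f)))\<^sup>2) \<le> 2 * inner (H0 f) (emb f)"
    and "inner (H0 f) (emb f) \<le> 2 * (\<Sum>b\<in>Basis. (norm (emb (td b f)))\<^sup>2)"
proof -
  have "0 \<le> inner (2 *\<^sub>R Vop f - emb (tlap f)) (emb f)"
    by (rule form_nonneg) (use c_half in simp)
  then show "(\<Sum>b\<in>Basis. (norm (emb (td b f)))\<^sup>2) \<le> 2 * inner (H0 f) (emb f)"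
    unfolding inner_H0 by (simp add: inner_diff_left inner_tlap power2_norm_eq_inner)
  have "0 \<le> inner ((-1) *\<^sub>R Vop f - emb (tlap f)) (emb f)"
    by (rule form_nonneg) (use c_half in simp)
  then show "inner (H0 f) (emb f) \<le> 2 * (\<Sum>b\<in>Basis. (norm (emb (td b f)))\<^sup>2)"
    unfolding inner_H0 by (simp add: inner_diff_left inner_tlap power2_norm_eq_inner)
qed

end

subsection \<open>The bounded dilation field\<close>

text \<open>The unbounded field $x$ is replaced by $X = \chi x$, $\chi = 1/(1 + \epsilon|x|^2)$;
  \<open>fld\<close> gives the components of $X$ and \<open>dv\<close> its divergence, both exact
  polynomials in $\chi$ because $\epsilon|x|^2\chi = 1 - \chi$.\<close>

definition chi :: "real \<Rightarrow> 'a::euclidean_space \<Rightarrow> real" where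
  "chi e x = inverse (1 + e * (x \<bullet> x))"

definition fld :: "real \<Rightarrow> 'a::euclidean_space \<Rightarrow> 'a \<Rightarrow> real" where
  "fld e b x = chi e x * (x \<bullet> b)"

definition dv :: "real \<Rightarrow> 'a::euclidean_space \<Rightarrow> real" where
  "dv e x = (real DIM('a) - 2) * chi e x + 2 * (chi e x)\<^sup>2"

context
  fixes e :: real
  assumes e: "e > 0"
begin

lemma chi_pos: "0 < chi e x" and chi_le_1: "chi e x \<le> 1"
  and chi_identity: "e * (x \<bullet> x) * chi e x = 1 - chi e x"
proof -
  have "0 \<le> e * (x \<bullet> x)" using e by simp
  then show "0 < chi e x" "chi e x \<le> 1" "e * (x \<bullet> x) * chi e x = 1 - chi e x"
    by (auto simp: chi_def inverse_le_1_iff field_simps)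
qed

lemma smooth_chi: "smooth (chi e :: 'a::euclidean_space \<Rightarrow> real)"
proof -
  have "smooth (\<lambda>x::'a. 1 + e * (\<Sum>b\<in>Basis. (x \<bullet> b) * (x \<bullet> b)))"
    by (intro smooth_add smooth_const smooth_cmult smooth_sum smooth_mult smooth_inner_left)
  moreover have "(\<Sum>b\<in>Basis. (x \<bullet> b) * (x \<bullet> b)) = x \<bullet> x" for x :: 'a
    by (rule euclidean_inner[symmetric])
  ultimately have s: "smooth (\<lambda>x::'a. 1 + e * (x \<bullet> x))" by (simp only:)
  have "1 + e * (x \<bullet> x) \<noteq> 0" for x :: 'a
  proof -
    have "0 \<le> e * (x \<bullet> x)" using e by simp
    then show ?thesis by linarith
  qed
  from smooth_inverse[OF s this] show ?thesis by (simp add: chi_def[abs_def])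
qed

lemma dir_deriv_chi: "dir_deriv b (chi e) x = - 2 * e * (x \<bullet> b) * (chi e x)\<^sup>2"
proof -
  have "0 \<le> e * (x \<bullet> x)" using e by simp
  then have nz: "1 + e * (x \<bullet> x) \<noteq> 0" by linarith
  have d: "((\<lambda>x. 1 + e * (x \<bullet> x)) has_derivative (\<lambda>h. e * (x \<bullet> h + h \<bullet> x))) (at x)"
    by (auto intro!: derivative_eq_intros)
  have "((\<lambda>x. inverse (1 + e * (x \<bullet> x))) has_derivative
      (\<lambda>h. - (inverse (1 + e * (x \<bullet> x)) * (e * (x \<bullet> h + h \<bullet> x)) * inverse (1 + e * (x \<bullet> x))))) (at x)"
    by (rule Deriv.has_derivative_inverse[OF nz d])
  from dir_deriv_eqI[OF this, of b] show ?thesis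
    by (simp add: chi_def[abs_def] power2_eq_square inner_commute)
qed

lemma smooth_fld: "smooth (fld e b)"
  unfolding fld_def[abs_def] by (intro smooth_mult smooth_chi smooth_inner_left)

lemma dir_deriv_inner: "dir_deriv c (\<lambda>x. x \<bullet> b) x = c \<bullet> b"
  by (rule dir_deriv_eqI[of _ "\<lambda>h. h \<bullet> b"]) (auto intro!: derivative_eq_intros)

lemma dir_deriv_fld: "dir_deriv c (fld e b) x = chi e x * (c \<bullet> b) - 2 * e * (x \<bullet> c) * (x \<bullet> b) * (chi e x)\<^sup>2"
proof -
  have "dir_deriv c (fld e b) = (\<lambda>x. chi e x * dir_deriv c (\<lambda>x. x \<bullet> b) x + dir_deriv c (chi e) x * (x \<bullet> b))"
    unfolding fld_def[abs_def]
    by (rule dir_deriv_bilinear[OF bounded_bilinear_mult]) (intro smooth_differentiable smooth_chi smooth_inner_left)+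
  then show ?thesis by (simp add: dir_deriv_inner dir_deriv_chi algebra_simps)
qed

lemma chi_square_identity: "2 * e * (x \<bullet> x) * (chi e x)\<^sup>2 = 2 * chi e x - 2 * (chi e x)\<^sup>2"
proof -
  have "2 * e * (x \<bullet> x) * (chi e x)\<^sup>2 = 2 * (e * (x \<bullet> x) * chi e x) * chi e x"
    by (simp add: power2_eq_square)
  also have "\<dots> = 2 * chi e x - 2 * (chi e x)\<^sup>2"
    unfolding chi_identity by (simp add: algebra_simps power2_eq_square)
  finally show ?thesis .
qed

lemma radial_sum: "(\<Sum>b\<in>Basis. 2 * e * (x \<bullet> b) * (x \<bullet> b) * (chi e x)\<^sup>2) = 2 * chi e x - 2 * (chi e x)\<^sup>2"
proof -
  have "(\<Sum>b\<in>Basis. 2 * e * (x \<bullet> b) * (x \<bullet> b) * (chi e x)\<^sup>2) = 2 * e * (x \<bullet> x) * (chi e x)\<^sup>2"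
    unfolding euclidean_inner[of x x] by (simp add: sum_distrib_left sum_distrib_right mult.assoc)
  then show ?thesis by (simp only: chi_square_identity)
qed

lemma dv_eq_divergence: "dv e x = (\<Sum>b\<in>Basis. dir_deriv b (fld e b) x)"
  unfolding dir_deriv_fld sum_subtractf radial_sum by (simp add: dv_def algebra_simps)

lemma smooth_dv: "smooth (dv e)"
  unfolding dv_def[abs_def] power2_eq_square
  by (intro smooth_add smooth_mult smooth_const smooth_chi)

lemma dir_deriv_dv: "dir_deriv b (dv e) x = ((real DIM('a) - 2) + 4 * chi e x) * dir_deriv b (chi e) (x :: 'a::euclidean_space)"
proof -
  have "(chi e has_derivative frechet_derivative (chi e) (at x)) (at x)"
    by (rule smooth_has_derivative[OF smooth_chi])
  then have "(dv e has_derivative (\<lambda>h. ((real DIM('a) - 2) + 4 * chi e x) * frechet_derivative (chi e) (at x) h)) (at x)"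
    unfolding dv_def[abs_def] by (auto intro!: derivative_eq_intros simp: algebra_simps)
  from dir_deriv_eqI[OF this] show ?thesis by (simp add: dir_deriv_def)
qed

text \<open>The arithmetic-geometric mean inequality for \<open>sqrt e * norm x\<close> and 1. It is
  the source both of the bound on the field and of the bound on the gradient of the cutoff.\<close>

lemma sqrt_norm_chi: "2 * sqrt e * norm x * chi e x \<le> 1"
proof -
  have "2 * (sqrt e * norm x) * 1 \<le> (sqrt e * norm x)\<^sup>2 + 1\<^sup>2" by (rule sum_squares_bound)
  also have "\<dots> = 1 + e * (x \<bullet> x)"
    using e by (simp add: power_mult_distrib power2_norm_eq_inner)
  finally have "2 * (sqrt e * norm x) * chi e x \<le> (1 + e * (x \<bullet> x)) * chi e x"
    using chi_pos[of x] by (intro mult_right_mono) auto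
  then show ?thesis using chi_pos[of x] by (simp add: chi_def)
qed

lemma fld_bound: "b \<in> Basis \<Longrightarrow> \<bar>fld e b x\<bar> \<le> 1 / (2 * sqrt e)"
proof -
  assume b: "b \<in> Basis"
  have "\<bar>fld e b x\<bar> \<le> norm x * chi e x"
    using mult_right_mono[OF Basis_le_norm[OF b, of x], of "chi e x"] chi_pos[of x]
    by (simp add: fld_def abs_mult mult.commute)
  also have "\<dots> \<le> 1 / (2 * sqrt e)"
    using sqrt_norm_chi[of x] e by (simp add: field_simps)
  finally show ?thesis .
qed

lemma fld_le_norm: "b \<in> Basis \<Longrightarrow> \<bar>fld e b x\<bar> \<le> norm x"
proof -
  assume b: "b \<in> Basis"
  have "\<bar>fld e b x\<bar> = chi e x * \<bar>x \<bullet> b\<bar>"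
    using chi_pos[of x] by (simp add: fld_def abs_mult)
  also have "\<dots> \<le> 1 * norm x"
    using chi_pos[of x] chi_le_1[of x] Basis_le_norm[OF b] by (intro mult_mono) auto
  finally show ?thesis by simp
qed

lemma dir_deriv_chi_bound: "b \<in> Basis \<Longrightarrow> \<bar>dir_deriv b (chi e) x\<bar> \<le> sqrt e"
proof -
  assume b: "b \<in> Basis"
  have "\<bar>dir_deriv b (chi e) x\<bar> = 2 * e * \<bar>x \<bullet> b\<bar> * (chi e x)\<^sup>2"
    unfolding dir_deriv_chi using e by (simp add: abs_mult)
  also have "\<dots> \<le> 2 * e * norm x * (chi e x * 1)"
    unfolding power2_eq_square
    using e chi_pos[of x] chi_le_1[of x] Basis_le_norm[OF b] by (intro mult_mono) auto
  also have "\<dots> = sqrt e * (2 * sqrt e * norm x * chi e x)"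
    using e by (simp add: algebra_simps flip: real_sqrt_mult)
  also have "\<dots> \<le> sqrt e * 1"
    using e by (intro mult_left_mono sqrt_norm_chi) auto
  finally show ?thesis by simp
qed

text \<open>The field grows as \<open>e\<close> decreases, but its derivatives do not: this
  independence of \<open>e\<close> supports both the removal of the cutoff and the weighted
  resolvent estimate.\<close>

lemma dir_deriv_fld_bound:
  assumes "b \<in> Basis" "c \<in> Basis"
  shows "\<bar>dir_deriv c (fld e b) x\<bar> \<le> 3"
proof -
  have "\<bar>2 * e * (x \<bullet> c) * (x \<bullet> b) * (chi e x)\<^sup>2\<bar> = 2 * e * (\<bar>x \<bullet> c\<bar> * \<bar>x \<bullet> b\<bar>) * (chi e x)\<^sup>2"
    using e by (simp add: abs_mult)
  also have "\<dots> \<le> 2 * e * (norm x * norm x) * (chi e x)\<^sup>2"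
    using e Basis_le_norm assms by (intro mult_right_mono mult_left_mono mult_mono) auto
  also have "\<dots> = 2 * chi e x - 2 * (chi e x)\<^sup>2"
    using chi_square_identity[of x] by (simp add: dot_square_norm power2_eq_square)
  also have "\<dots> \<le> 2" using chi_le_1[of x] by (smt (verit) zero_le_power2)
  finally have "\<bar>2 * e * (x \<bullet> c) * (x \<bullet> b) * (chi e x)\<^sup>2\<bar> \<le> 2" .
  moreover have "\<bar>chi e x * (c \<bullet> b)\<bar> \<le> 1"
    using assms chi_pos[of x] chi_le_1[of x] by (simp add: inner_Basis)
  ultimately show ?thesis unfolding dir_deriv_fld by linarith
qed

lemma dv_bound: "\<bar>dv e x\<bar> \<le> real DIM('a) + 4" for x :: "'a::euclidean_space"
proof -
  have "\<bar>(real DIM('a) - 2) * chi e x\<bar> \<le> (real DIM('a) + 2) * 1"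
    unfolding abs_mult using chi_pos[of x] chi_le_1[of x] by (intro mult_mono) auto
  moreover have "\<bar>2 * (chi e x)\<^sup>2\<bar> \<le> 2"
    using chi_pos[of x] chi_le_1[of x] by (simp add: power_le_one)
  ultimately have "\<bar>(real DIM('a) - 2) * chi e x\<bar> + \<bar>2 * (chi e x)\<^sup>2\<bar> \<le> real DIM('a) + 4" by simp
  then show ?thesis unfolding dv_def by (rule order_trans[OF abs_triangle_ineq])
qed

lemma dir_deriv_dv_bound:
  fixes x :: "'a::euclidean_space"
  assumes "b \<in> Basis"
  shows "\<bar>dir_deriv b (dv e) x\<bar> \<le> (real DIM('a) + 6) * sqrt e"
  unfolding dir_deriv_dv abs_mult
proof (intro mult_mono dir_deriv_chi_bound assms)
  have "4 * chi e x \<le> 4" "0 < chi e x" using chi_pos[of x] chi_le_1[of x] by auto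
  then show "\<bar>real DIM('a) - 2 + 4 * chi e x\<bar> \<le> real DIM('a) + 6" by linarith
qed auto

end

section \<open>The dilation generator and its commutator with the Laplacian\<close>

definition cm :: "('a::euclidean_space \<Rightarrow> real) \<Rightarrow> 'a lsq \<Rightarrow> 'a lsq" where
  "cm m = mul (\<lambda>x. complex_of_real (m x))"

lemma cm_scaleR: "cm m (r *\<^sub>R f) = r *\<^sub>R cm m f" by (simp add: cm_def mul_scaleR)

lemma tendsto_cm [tendsto_intros]: "(F \<longlongrightarrow> f) net \<Longrightarrow> ((\<lambda>k. cm m (F k)) \<longlongrightarrow> cm m f) net"
  unfolding cm_def by (rule tendsto_mul)

lemma norm_cm_le: "(\<And>x. \<bar>m x\<bar> \<le> B) \<Longrightarrow> norm (cm m f) \<le> B * norm f"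
  unfolding cm_def by (rule norm_mul_le) simp

lemma inner_cm:
  assumes "smooth m" "\<And>x. \<bar>m x\<bar> \<le> B"
  shows "inner (cm m f) g = inner f (cm m g)"
  unfolding cm_def inner_mul[OF bdd_meas_smooth[OF assms]] by simp

text \<open>$X\cdot\nabla + \frac12 \mathrm{div} X$, on test functions and on pairs of a function and its
  gradient.\<close>

definition tA :: "real \<Rightarrow> 'a::euclidean_space testf \<Rightarrow> 'a testf" where
  "tA e f = (\<Sum>b\<in>Basis. tm (fld e b) (td b f)) + (1/2) *\<^sub>R tm (dv e) f"

definition Aop :: "real \<Rightarrow> 'a::euclidean_space lsq \<Rightarrow> ('a \<Rightarrow> 'a lsq) \<Rightarrow> 'a lsq" where
  "Aop e f q = (\<Sum>b\<in>Basis. cm (fld e b) (q b)) + (1/2) *\<^sub>R cm (dv e) f"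

lemma emb_tm_cm: "smooth m \<Longrightarrow> (\<And>x. \<bar>m x\<bar> \<le> B) \<Longrightarrow> emb (tm m f) = cm m (emb f)"
  unfolding cm_def by (rule emb_tm)

lemma emb_tA: "e > 0 \<Longrightarrow> emb (tA e f) = Aop e (emb f) (\<lambda>b. emb (td b f))"
  unfolding tA_def Aop_def emb_add emb_sum emb_scaleR
  by (simp add: emb_tm_cm[OF smooth_fld fld_bound] emb_tm_cm[OF smooth_dv dv_bound])

lemma tm_sum_fun:
  assumes "\<And>i. i \<in> I \<Longrightarrow> smooth (m i)"
  shows "(\<Sum>i\<in>I. tm (m i) f) = tm (\<lambda>x. \<Sum>i\<in>I. m i x) f"
proof -
  have "Rep_testf (\<Sum>i\<in>I. tm (m i) f) = Rep_testf (tm (\<lambda>x. \<Sum>i\<in>I. m i x) f)"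
    using assms by (simp add: Rep_testf_sum tm.rep_eq smooth_sum scaleR_sum_left)
  then show ?thesis by (simp add: Rep_testf_inject)
qed

lemma sum_tm_dv:
  fixes f :: "'a::euclidean_space testf"
  assumes e: "e > 0"
  shows "(\<Sum>b\<in>Basis. tm (dir_deriv b (fld e b)) f) = tm (dv e) f"
proof -
  have "(\<lambda>x::'a. \<Sum>b\<in>Basis. dir_deriv b (fld e b) x) = dv e"
    by (simp add: fun_eq_iff dv_eq_divergence[OF e])
  moreover have "(\<Sum>b\<in>Basis. tm (dir_deriv b (fld e b)) f) = tm (\<lambda>x. \<Sum>b\<in>Basis. dir_deriv b (fld e b) x) f"
    by (rule tm_sum_fun) (rule smooth_dir_deriv[OF smooth_fld[OF e]])
  ultimately show ?thesis by (simp only:)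
qed

text \<open>Integration by parts of the field term produces minus its divergence; the added half
  divergence distributes this evenly and makes the operator skew.\<close>

lemma tA_antisym:
  assumes e: "e > 0"
  shows "inner (emb (tA e f)) (emb g) = - inner (emb f) (emb (tA e g))"
proof -
  have "inner (emb (tm (fld e b) (td b f))) (emb g)
      = - inner (emb f) (emb (tm (dir_deriv b (fld e b)) g)) - inner (emb f) (emb (tm (fld e b) (td b g)))"
    if "b \<in> Basis" for b
    unfolding inner_tm inner_td[OF that] td_tm[OF smooth_fld[OF e]] emb_add inner_add_right by simp
  then have "inner (emb (tA e f)) (emb g) =
     - inner (emb f) (emb (\<Sum>b\<in>Basis. tm (dir_deriv b (fld e b)) g))
     - inner (emb f) (emb (\<Sum>b\<in>Basis. tm (fld e b) (td b g))) + (1/2) * inner (emb (tm (dv e) f)) (emb g)"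
    unfolding tA_def emb_add emb_sum inner_add_left inner_sum_left inner_sum_right emb_scaleR
    by (simp add: sum_subtractf sum_negf)
  also have "\<dots> = - inner (emb f) (emb (tA e g))"
    unfolding sum_tm_dv[OF e] tA_def emb_add inner_add_right emb_scaleR inner_tm by simp
  finally show ?thesis .
qed

text \<open>One derivative is moved across and commuted with \<open>tA\<close>. The commutator
  consists of the derivatives of the field and of half its divergence; what remains pairs
  \<open>tA\<close> of each partial derivative with that same derivative and vanishes by
  skewness.\<close>

lemma inner_neg_tlap_tA:
  assumes e: "e > 0"
  shows "- inner (emb (tlap f)) (emb (tA e f)) =
    (\<Sum>c\<in>Basis. \<Sum>b\<in>Basis. inner (emb (tm (dir_deriv c (fld e b)) (td b f))) (emb (td c f)))
    + (1/2) * (\<Sum>c\<in>Basis. inner (emb (tm (dir_deriv c (dv e)) f)) (emb (td c f)))"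
proof -
  have com: "inner (emb (td c (tA e f))) (emb g) =
      (\<Sum>b\<in>Basis. inner (emb (tm (dir_deriv c (fld e b)) (td b f))) (emb g))
      + (1/2) * inner (emb (tm (dir_deriv c (dv e)) f)) (emb g) + inner (emb (tA e (td c f))) (emb g)"
    if c: "c \<in> Basis" for c g
  proof -
    have x: "inner (emb (tm (fld e b) (td c (td b f)))) (emb g) = inner (emb (tm (fld e b) (td b (td c f)))) (emb g)"
      if "b \<in> Basis" for b
      unfolding inner_tm emb_td_commute[OF c that] ..
    show ?thesis
      unfolding tA_def linear_add[OF linear_td] linear_sum[OF linear_td] linear_scale[OF linear_td]
        td_tm[OF smooth_fld[OF e]] td_tm[OF smooth_dv[OF e]] emb_add emb_sum emb_scaleR
        inner_add_left inner_sum_left inner_scaleR_left sum.distrib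
      using x by (simp add: algebra_simps)
  qed
  have z: "inner (emb (tA e (td c f))) (emb (td c f)) = 0" for c
    using tA_antisym[OF e, of "td c f" "td c f"] by (simp add: inner_commute)
  have "- inner (emb (tlap f)) (emb (tA e f)) = (\<Sum>c\<in>Basis. inner (emb (td c (tA e f))) (emb (td c f)))"
    by (simp add: inner_tlap inner_commute)
  also have "\<dots> = (\<Sum>c\<in>Basis. (\<Sum>b\<in>Basis. inner (emb (tm (dir_deriv c (fld e b)) (td b f))) (emb (td c f)))
      + (1/2) * inner (emb (tm (dir_deriv c (dv e)) f)) (emb (td c f)))"
    by (intro sum.cong refl) (simp add: com z)
  finally show ?thesis by (simp add: sum.distrib sum_distrib_left)
qed

locale repulsive_potential = potential +
  fixes W :: "'a \<Rightarrow> real"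
  assumes radial: "weak_radial V W" and repulsive: "AE x in lebesgue. - W x \<ge> 0"
begin

text \<open>Twice the pairing is the integral of \<open>V\<close> times the divergence of
  \<open>x \<psi>\<close>, where \<open>\<psi>\<close> is the cutoff times the squared modulus of
  \<open>f\<close>. By definition of the weak radial derivative this equals the integral of
  \<open>- W \<psi>\<close>, and \<open>\<psi>\<close> is a nonnegative test function.\<close>

lemma inner_Vop_tA_nonneg:
  assumes e: "e > 0"
  shows "0 \<le> inner (Vop f) (emb (tA e f))"
proof -
  let ?f = "Rep_testf f"
  define \<psi> where "\<psi> x = chi e x * (?f x \<bullet> ?f x)" for x
  have sf: "smooth ?f" by (rule Rep_testf_smooth)
  have sff: "smooth (\<lambda>x. ?f x \<bullet> ?f x)"
    using sf by (simp add: smooth_def C_k_bilinear[OF bounded_bilinear_inner])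
  have s\<psi>: "smooth \<psi>" unfolding \<psi>_def[abs_def] by (intro smooth_mult smooth_chi e sff)
  have c\<psi>: "csupp \<psi>" by (rule csupp_mono[OF Rep_testf_csupp[of f]]) (simp add: \<psi>_def)
  have d\<psi>: "dir_deriv b \<psi> x = dir_deriv b (chi e) x * (?f x \<bullet> ?f x) + 2 * chi e x * (?f x \<bullet> dir_deriv b ?f x)" for b x
  proof -
    have "dir_deriv b (\<lambda>x. ?f x \<bullet> ?f x) = (\<lambda>x. ?f x \<bullet> dir_deriv b ?f x + dir_deriv b ?f x \<bullet> ?f x)"
      by (rule dir_deriv_bilinear[OF bounded_bilinear_inner]) (intro smooth_differentiable sf)+
    moreover have "dir_deriv b \<psi> = (\<lambda>x. chi e x * dir_deriv b (\<lambda>x. ?f x \<bullet> ?f x) x + dir_deriv b (chi e) x * (?f x \<bullet> ?f x))"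
      unfolding \<psi>_def[abs_def]
      by (rule dir_deriv_bilinear[OF bounded_bilinear_mult]) (intro smooth_differentiable smooth_chi e sff)+
    ultimately show ?thesis by (simp add: inner_commute algebra_simps)
  qed
  have A: "Rep_testf (tA e f) x = (\<Sum>b\<in>Basis. fld e b x *\<^sub>R dir_deriv b ?f x) + (dv e x / 2) *\<^sub>R ?f x" for x
    by (simp add: tA_def plus_testf.rep_eq Rep_testf_sum scaleR_testf.rep_eq tm.rep_eq td.rep_eq
        smooth_fld[OF e] smooth_dv[OF e])
  \<comment> \<open>Both sides are the divergence of the vector field
    \<open>\<psi> x *\<^sub>R x\<close>: the generator supplies the derivative of the squared
    modulus along the cut-off field, and \<open>dv\<close> the divergence of that field.\<close>
  have key: "2 * (?f x \<bullet> Rep_testf (tA e f) x) = real DIM('a) * \<psi> x + dir_deriv x \<psi> x" for x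
  proof -
    have "(\<Sum>b\<in>Basis. (x \<bullet> b) * dir_deriv b (chi e) x) = - (2 * chi e x - 2 * (chi e x)\<^sup>2)"
      unfolding dir_deriv_chi[OF e] radial_sum[OF e, symmetric] sum_negf[symmetric] by (intro sum.cong) auto
    then have s: "(\<Sum>b\<in>Basis. (x \<bullet> b) * dir_deriv b (chi e) x) + real DIM('a) * chi e x = dv e x"
      by (simp add: dv_def algebra_simps)
    have "dir_deriv x \<psi> x = (\<Sum>b\<in>Basis. (x \<bullet> b) * dir_deriv b \<psi> x)"
      using dir_deriv_linear_Basis[OF smooth_differentiable[OF s\<psi>], of x x] by simp
    also have "\<dots> = (\<Sum>b\<in>Basis. (x \<bullet> b) * dir_deriv b (chi e) x) * (?f x \<bullet> ?f x) + 2 * (\<Sum>b\<in>Basis. fld e b x * (?f x \<bullet> dir_deriv b ?f x))"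
      unfolding d\<psi> fld_def sum_distrib_left sum_distrib_right sum.distrib[symmetric]
      by (intro sum.cong) (auto simp: algebra_simps)
    finally have "real DIM('a) * \<psi> x + dir_deriv x \<psi> x
      = ((\<Sum>b\<in>Basis. (x \<bullet> b) * dir_deriv b (chi e) x) + real DIM('a) * chi e x) * (?f x \<bullet> ?f x)
        + 2 * (\<Sum>b\<in>Basis. fld e b x * (?f x \<bullet> dir_deriv b ?f x))"
      by (simp add: \<psi>_def algebra_simps)
    then show ?thesis unfolding s A by (simp add: inner_add_right inner_sum_right)
  qed
  have "2 * inner (Vop f) (emb (tA e f)) = (LINT x|lebesgue. 2 * ((complex_of_real (V x) * ?f x) \<bullet> Rep_testf (tA e f) x))"
    unfolding Vop_def emb_def inner_cls_inner[OF VL Rep_testf_L2] by simp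
  also have "\<dots> = (LINT x|lebesgue. (real DIM('a) * \<psi> x + dir_deriv x \<psi> x) * V x)"
  proof (rule Bochner_Integration.integral_cong[OF refl])
    fix x
    have "2 * ((complex_of_real (V x) * ?f x) \<bullet> Rep_testf (tA e f) x) = V x * (2 * (?f x \<bullet> Rep_testf (tA e f) x))"
      by (simp add: inner_complex_def algebra_simps)
    then show "2 * ((complex_of_real (V x) * ?f x) \<bullet> Rep_testf (tA e f) x) = (real DIM('a) * \<psi> x + dir_deriv x \<psi> x) * V x"
      unfolding key by simp
  qed
  also have "\<dots> = (LINT x|lebesgue. \<psi> x * - W x)"
    using radial s\<psi> c\<psi> unfolding weak_radial_def test_functions_iff by simp
  also have "0 \<le> (LINT x|lebesgue. \<psi> x * - W x)"
  proof (rule integral_nonneg_AE)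
    show "AE x in lebesgue. 0 \<le> \<psi> x * - W x"
      using repulsive
    proof eventually_elim
      case (elim x)
      have "0 \<le> \<psi> x" unfolding \<psi>_def using chi_pos[OF e, of x] by simp
      then show ?case using elim by (intro mult_nonneg_nonneg)
    qed
  qed
  finally show ?thesis by simp
qed

end

subsection \<open>The closure of the operator on test functions\<close>

abbreviation J :: "'a::euclidean_space lsq \<Rightarrow> 'a lsq" where "J \<equiv> mul (\<lambda>x. \<i>)"

lemma J_J: "J (J f) = - f"
proof -
  have "J (J f) = mul (\<lambda>x. - 1) f" by (simp add: mul_mul bdd_meas_const)
  also have "\<dots> = - f"
  proof -
    obtain h where h: "h \<in> L2" "f = cls h" by (rule lsq_cases)
    show ?thesis unfolding h(2) mul_cls[OF bdd_meas_const h(1)] by (simp add: cls_uminus h)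
  qed
  finally show ?thesis .
qed

lemma inner_J: "inner (J f) g = - inner f (J g)"
proof -
  have "mul (\<lambda>x. cnj \<i>) g = - J g"
  proof -
    obtain h where h: "h \<in> L2" "g = cls h" by (rule lsq_cases)
    show ?thesis unfolding h(2) mul_cls[OF bdd_meas_const h(1)]
      by (simp add: cls_uminus L2_cmult h)
  qed
  then show ?thesis by (simp add: inner_mul bdd_meas_const)
qed

lemma norm_J: "norm (J f) = norm f"
  by (simp add: norm_eq_sqrt_inner inner_J J_J)

lemma cm_J:
  assumes "smooth m" "\<And>x. \<bar>m x\<bar> \<le> B"
  shows "cm m (J f) = J (cm m f)"
  unfolding cm_def mul_mul[OF bdd_meas_smooth[OF assms] bdd_meas_const] mul_mul[OF bdd_meas_const bdd_meas_smooth[OF assms]]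
  by (simp add: mult.commute)

text \<open>The commutator form of \<open>inner_neg_tlap_tA\<close>, written for a function together
  with its gradient. It contains first derivatives only and therefore makes sense beyond test
  functions.\<close>

definition vir :: "real \<Rightarrow> 'a::euclidean_space lsq \<Rightarrow> ('a \<Rightarrow> 'a lsq) \<Rightarrow> real" where
  "vir e f q = (\<Sum>c\<in>Basis. \<Sum>b\<in>Basis. inner (cm (dir_deriv c (fld e b)) (q b)) (q c))
    + (1/2) * (\<Sum>c\<in>Basis. inner (cm (dir_deriv c (dv e)) f) (q c))"

lemma tendsto_Aop:
  assumes "(F \<longlongrightarrow> f) net" "\<And>b. b \<in> Basis \<Longrightarrow> ((\<lambda>k. Q k b) \<longlongrightarrow> q b) net"
  shows "((\<lambda>k. Aop e (F k) (Q k)) \<longlongrightarrow> Aop e f q) net"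
  unfolding Aop_def by (intro tendsto_intros assms)

lemma tendsto_vir:
  assumes "(F \<longlongrightarrow> f) net" "\<And>b. b \<in> Basis \<Longrightarrow> ((\<lambda>k. Q k b) \<longlongrightarrow> q b) net"
  shows "((\<lambda>k. vir e (F k) (Q k)) \<longlongrightarrow> vir e f q) net"
  unfolding vir_def by (intro tendsto_intros assms)

lemma Aop_J: "e > 0 \<Longrightarrow> Aop e (J f) (\<lambda>b. J (q b)) = J (Aop e f q)"
  unfolding Aop_def by (simp add: cm_J[OF smooth_fld fld_bound] cm_J[OF smooth_dv dv_bound] mul_add mul_sum mul_scaleR)

context potential
begin

definition graph :: "('a lsq \<times> 'a lsq) set" where
  "graph = closure (range (\<lambda>f. (emb f, H0 f)))"

text \<open>A class has no pointwise derivatives, so a gradient is recorded through one sequence of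
  test functions along which the function, its image and its gradient all converge. Identities on
  test functions then pass to the limit together.\<close>

definition grad_at :: "'a lsq \<Rightarrow> 'a lsq \<Rightarrow> ('a \<Rightarrow> 'a lsq) \<Rightarrow> bool" where
  "grad_at f g q \<longleftrightarrow> (\<exists>\<phi>. (\<lambda>k. emb (\<phi> k)) \<longlonglongrightarrow> f \<and> (\<lambda>k. H0 (\<phi> k)) \<longlonglongrightarrow> g \<and>
     (\<forall>b\<in>Basis. (\<lambda>k. emb (td b (\<phi> k))) \<longlonglongrightarrow> q b))"

lemma subspace_graph: "subspace graph"
proof -
  have "linear (\<lambda>f. (emb f, H0 f))"
    by (rule linearI) (simp_all add: emb_add emb_scaleR linear_add[OF linear_H0] linear_scale[OF linear_H0])
  then show ?thesis unfolding graph_def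
    by (intro subspace_closure linear_subspace_image[OF _ subspace_UNIV])
qed

lemma emb_in_graph: "(emb f, H0 f) \<in> graph"
  unfolding graph_def by (rule subsetD[OF closure_subset]) blast

lemma grad_atE:
  assumes "grad_at f g q"
  obtains \<phi> where "(\<lambda>k. emb (\<phi> k)) \<longlonglongrightarrow> f" "(\<lambda>k. H0 (\<phi> k)) \<longlonglongrightarrow> g"
    "\<And>b. b \<in> Basis \<Longrightarrow> (\<lambda>k. emb (td b (\<phi> k))) \<longlonglongrightarrow> q b"
  using assms unfolding grad_at_def by blast

text \<open>The energy bound controls the gradient of a difference of test functions by the graph
  norm, so convergence in the graph forces convergence of the gradients.\<close>

lemma grad_at_exists:
  assumes "(f, g) \<in> graph"
  obtains q where "grad_at f g q"
proof -
  obtain z where z: "\<And>n. z n \<in> range (\<lambda>f. (emb f, H0 f))" "z \<longlonglongrightarrow> (f, g)"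
    using assms unfolding graph_def closure_sequential by blast
  have "\<exists>\<phi>. z n = (emb \<phi>, H0 \<phi>)" for n using z(1)[of n] by blast
  then obtain \<phi> where \<phi>: "\<And>n. z n = (emb (\<phi> n), H0 (\<phi> n))" by metis
  have bound: "norm (emb (td b (\<phi> m)) - emb (td b (\<phi> n))) \<le> 2 * dist (z m) (z n)" if b: "b \<in> Basis" for b m n
  proof -
    let ?d = "\<phi> m - \<phi> n"
    have zd: "z m - z n = (emb ?d, H0 ?d)" by (simp add: \<phi> emb_diff linear_diff[OF linear_H0])
    have "(norm (emb (td b ?d)))\<^sup>2 \<le> (\<Sum>b\<in>Basis. (norm (emb (td b ?d)))\<^sup>2)"
      using b by (intro member_le_sum) auto
    also have "\<dots> \<le> 2 * inner (H0 ?d) (emb ?d)" by (rule energy_bounds)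
    also have "inner (H0 ?d) (emb ?d) \<le> norm (H0 ?d) * norm (emb ?d)" by (rule inner_le_norm)
    also have "\<dots> \<le> norm (z m - z n) * norm (z m - z n)"
      unfolding zd by (intro mult_mono norm_fst_le norm_snd_le) (auto simp: norm_Pair)
    finally have "(norm (emb (td b ?d)))\<^sup>2 \<le> (2 * norm (z m - z n))\<^sup>2"
      by (simp add: power2_eq_square) (smt (verit) mult_nonneg_nonneg norm_ge_zero)
    then have "norm (emb (td b ?d)) \<le> 2 * norm (z m - z n)" by (rule power2_le_imp_le) simp
    then show ?thesis by (simp add: linear_diff[OF linear_td] emb_diff dist_norm)
  qed
  have "convergent (\<lambda>k. emb (td b (\<phi> k)))" if b: "b \<in> Basis" for b
    unfolding Cauchy_convergent_iff[symmetric]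
  proof (rule metric_CauchyI)
    fix e :: real assume "e > 0"
    then obtain N where N: "\<And>m n. m \<ge> N \<Longrightarrow> n \<ge> N \<Longrightarrow> dist (z m) (z n) < e / 2"
      using metric_CauchyD[OF LIMSEQ_imp_Cauchy[OF z(2)], of "e / 2"] by auto
    have "dist (emb (td b (\<phi> m))) (emb (td b (\<phi> n))) < e" if "m \<ge> N" "n \<ge> N" for m n
      using bound[OF b, of m n] N[OF that] by (simp add: dist_norm)
    then show "\<exists>M. \<forall>m\<ge>M. \<forall>n\<ge>M. dist (emb (td b (\<phi> m))) (emb (td b (\<phi> n))) < e" by blast
  qed
  then have "\<exists>q. \<forall>b\<in>Basis. (\<lambda>k. emb (td b (\<phi> k))) \<longlonglongrightarrow> q b"
    unfolding convergent_def by metis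
  then obtain q where q: "\<forall>b\<in>Basis. (\<lambda>k. emb (td b (\<phi> k))) \<longlonglongrightarrow> q b" by blast
  have "(\<lambda>k. emb (\<phi> k)) \<longlonglongrightarrow> f" "(\<lambda>k. H0 (\<phi> k)) \<longlonglongrightarrow> g"
    using tendsto_fst[OF z(2)] tendsto_snd[OF z(2)] by (simp_all add: \<phi>)
  with q that show ?thesis unfolding grad_at_def by blast
qed

lemma grad_at_diff:
  assumes "grad_at f g q" "grad_at f' g' q'"
  shows "grad_at (f - f') (g - g') (\<lambda>b. q b - q' b)"
proof -
  obtain \<phi> where \<phi>: "(\<lambda>k. emb (\<phi> k)) \<longlonglongrightarrow> f" "(\<lambda>k. H0 (\<phi> k)) \<longlonglongrightarrow> g"
    "\<And>b. b \<in> Basis \<Longrightarrow> (\<lambda>k. emb (td b (\<phi> k))) \<longlonglongrightarrow> q b" using grad_atE[OF assms(1)] by blast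
  obtain \<psi> where \<psi>: "(\<lambda>k. emb (\<psi> k)) \<longlonglongrightarrow> f'" "(\<lambda>k. H0 (\<psi> k)) \<longlonglongrightarrow> g'"
    "\<And>b. b \<in> Basis \<Longrightarrow> (\<lambda>k. emb (td b (\<psi> k))) \<longlonglongrightarrow> q' b" using grad_atE[OF assms(2)] by blast
  show ?thesis unfolding grad_at_def
    by (rule exI[of _ "\<lambda>k. \<phi> k - \<psi> k"])
      (auto simp: emb_diff linear_diff[OF linear_H0] linear_diff[OF linear_td] intro!: tendsto_diff \<phi> \<psi>)
qed

lemma H0_tj: "H0 (tj f) = J (H0 f)"
proof -
  have "tlap (tj f) = tj (tlap f)"
    by (simp add: tlap_def td_tj linear_sum[OF linear_tj])
  moreover have "Vop (tj f) = J (Vop f)"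
    unfolding Vop_def mul_cls[OF bdd_meas_const VL] by (simp add: tj.rep_eq mult.left_commute)
  ultimately show ?thesis by (simp add: H0_def emb_tj mul_diff)
qed

lemma grad_at_J:
  assumes "grad_at f g q"
  shows "grad_at (J f) (J g) (\<lambda>b. J (q b))"
proof -
  obtain \<phi> where \<phi>: "(\<lambda>k. emb (\<phi> k)) \<longlonglongrightarrow> f" "(\<lambda>k. H0 (\<phi> k)) \<longlonglongrightarrow> g"
    "\<And>b. b \<in> Basis \<Longrightarrow> (\<lambda>k. emb (td b (\<phi> k))) \<longlonglongrightarrow> q b" using grad_atE[OF assms] by blast
  show ?thesis unfolding grad_at_def
    by (rule exI[of _ "\<lambda>k. tj (\<phi> k)"]) (auto simp: emb_tj H0_tj td_tj intro!: tendsto_mul \<phi>)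
qed

lemma grad_at_energy:
  assumes "grad_at f g q"
  shows "(\<Sum>b\<in>Basis. (norm (q b))\<^sup>2) \<le> 2 * inner g f" "inner g f \<le> 2 * (\<Sum>b\<in>Basis. (norm (q b))\<^sup>2)"
proof -
  obtain \<phi> where \<phi>: "(\<lambda>k. emb (\<phi> k)) \<longlonglongrightarrow> f" "(\<lambda>k. H0 (\<phi> k)) \<longlonglongrightarrow> g"
    "\<And>b. b \<in> Basis \<Longrightarrow> (\<lambda>k. emb (td b (\<phi> k))) \<longlonglongrightarrow> q b" using grad_atE[OF assms] by blast
  have 1: "(\<lambda>k. \<Sum>b\<in>Basis. (norm (emb (td b (\<phi> k))))\<^sup>2) \<longlonglongrightarrow> (\<Sum>b\<in>Basis. (norm (q b))\<^sup>2)"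
    by (intro tendsto_intros \<phi>)
  have 2: "(\<lambda>k. inner (H0 (\<phi> k)) (emb (\<phi> k))) \<longlonglongrightarrow> inner g f"
    by (intro tendsto_intros \<phi>)
  show "(\<Sum>b\<in>Basis. (norm (q b))\<^sup>2) \<le> 2 * inner g f"
    by (rule LIMSEQ_le[OF 1 tendsto_mult[OF tendsto_const 2]]) (use energy_bounds in blast)
  show "inner g f \<le> 2 * (\<Sum>b\<in>Basis. (norm (q b))\<^sup>2)"
    by (rule LIMSEQ_le[OF 2 tendsto_mult[OF tendsto_const 1]]) (use energy_bounds in blast)
qed

lemma grad_at_norm_le:
  assumes "grad_at f g q" "b \<in> Basis"
  shows "(norm (q b))\<^sup>2 \<le> 2 * inner g f"
proof -
  have "(norm (q b))\<^sup>2 \<le> (\<Sum>b\<in>Basis. (norm (q b))\<^sup>2)"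
    using assms(2) by (intro member_le_sum) auto
  with grad_at_energy(1)[OF assms(1)] show ?thesis by linarith
qed

lemma graph_inner_nonneg: "(f, g) \<in> graph \<Longrightarrow> 0 \<le> inner g f"
proof -
  assume "(f, g) \<in> graph"
  then obtain q where q: "grad_at f g q" by (rule grad_at_exists)
  have "0 \<le> (\<Sum>b\<in>Basis. (norm (q b))\<^sup>2)" by (intro sum_nonneg) simp
  with grad_at_energy(1)[OF q] show ?thesis by linarith
qed

text \<open>Pairing with \<open>f\<close> and using nonnegative energy gives the sharp constant 1,
  so that \<open>l\<close> times the resolvent is a contraction.\<close>

lemma graph_low:
  assumes "(f, g) \<in> graph" "l > 0"
  shows "l * norm f \<le> norm (g + l *\<^sub>R f)"
proof (cases "f = 0")
  case False
  have "l * norm f * norm f \<le> inner (g + l *\<^sub>R f) f"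
    using graph_inner_nonneg[OF assms(1)] by (simp add: inner_add_left dot_square_norm power2_eq_square)
  also have "\<dots> \<le> norm (g + l *\<^sub>R f) * norm f" by (rule inner_le_norm)
  finally show ?thesis using False by simp
qed simp

lemma resolvent_exists:
  assumes l: "l > 0"
  obtains f where "(f, u - l *\<^sub>R f) \<in> graph"
proof -
  let ?G = "range (\<lambda>f. (emb f, H0 f))"
  have "linear (\<lambda>f. (emb f, H0 f))"
    by (rule linearI) (simp_all add: emb_add emb_scaleR linear_add[OF linear_H0] linear_scale[OF linear_H0])
  then have G: "subspace ?G" by (rule linear_subspace_image[OF _ subspace_UNIV])
  have low: "l * norm f \<le> norm (g + l *\<^sub>R f)" if "(f, g) \<in> ?G" for f g
    by (rule graph_low[OF _ l]) (use that emb_in_graph in auto)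
  have "closure ((\<lambda>(f, g). g + l *\<^sub>R f) ` ?G) = UNIV"
    using dense_range[OF l, of 1] c_half by (simp add: image_image H0_def emb_diff emb_scaleR algebra_simps)
  from closure_range_graph[OF G l l low this, of u] that show ?thesis
    unfolding graph_def by blast
qed

lemma grad_at_antisym:
  assumes e: "e > 0" and "grad_at f g q" "grad_at f' g' q'"
  shows "inner (Aop e f q) f' = - inner f (Aop e f' q')"
proof -
  obtain \<phi> where \<phi>: "(\<lambda>k. emb (\<phi> k)) \<longlonglongrightarrow> f"
    "\<And>b. b \<in> Basis \<Longrightarrow> (\<lambda>k. emb (td b (\<phi> k))) \<longlonglongrightarrow> q b" using grad_atE[OF assms(2)] by blast
  obtain \<psi> where \<psi>: "(\<lambda>k. emb (\<psi> k)) \<longlonglongrightarrow> f'"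
    "\<And>b. b \<in> Basis \<Longrightarrow> (\<lambda>k. emb (td b (\<psi> k))) \<longlonglongrightarrow> q' b" using grad_atE[OF assms(3)] by blast
  have "(\<lambda>k. inner (emb (tA e (\<phi> k))) (emb (\<psi> k))) \<longlonglongrightarrow> inner (Aop e f q) f'"
    unfolding emb_tA[OF e] by (intro tendsto_inner tendsto_Aop \<phi> \<psi>)
  moreover have "(\<lambda>k. - inner (emb (\<phi> k)) (emb (tA e (\<psi> k)))) \<longlonglongrightarrow> - inner f (Aop e f' q')"
    unfolding emb_tA[OF e] by (intro tendsto_inner tendsto_minus tendsto_Aop \<phi> \<psi>)
  ultimately show ?thesis unfolding tA_antisym[OF e] by (rule LIMSEQ_unique)
qed

text \<open>The IMS localisation formula. The potential commutes with the multiplier, and the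
  product rule leaves only the squares containing derivatives of \<open>m\<close>.\<close>

lemma inner_H0_square:
  assumes m: "smooth m"
  shows "inner (H0 f) (emb (tm m (tm m f))) = inner (H0 (tm m f)) (emb (tm m f))
    - (\<Sum>b\<in>Basis. (norm (emb (tm (dir_deriv b m) f)))\<^sup>2)"
proof -
  have V: "inner (Vop f) (emb (tm m (tm m f))) = inner (Vop (tm m f)) (emb (tm m f))"
    unfolding Vop_def emb_def inner_cls_inner[OF VL Rep_testf_L2]
    by (simp add: tm.rep_eq m inner_complex_def algebra_simps)
  have T: "inner (emb (td b f)) (emb (td b (tm m (tm m f)))) = inner (emb (td b (tm m f))) (emb (td b (tm m f)))
     - (norm (emb (tm (dir_deriv b m) f)))\<^sup>2" if "b \<in> Basis" for b
  proof -
    let ?p = "emb (tm (dir_deriv b m) f)" and ?q = "emb (tm m (td b f))"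
    have 1: "inner (emb (td b f)) (emb (tm m (tm (dir_deriv b m) f))) = inner ?q ?p"
      by (simp only: inner_tm)
    have 2: "inner (emb (td b f)) (emb (tm (dir_deriv b m) (tm m f))) = inner ?q ?p"
      using 1 smooth_dir_deriv[OF m that] by (simp add: tm_tm m mult.commute)
    have 3: "inner (emb (td b f)) (emb (tm m (tm m (td b f)))) = inner ?q ?q"
      by (simp only: inner_tm)
    show ?thesis
      unfolding td_tm[OF m] linear_add[OF linear_tm] emb_add inner_add_left inner_add_right power2_norm_eq_inner 1 2 3
      by (simp add: inner_commute)
  qed
  show ?thesis unfolding inner_H0 V by (simp add: T sum_subtractf)
qed

text \<open>In the localisation formula the localised energy is nonnegative, and each of the
  \<open>DIM('a)\<close> error terms is at most \<open>(3 * norm f)\<^sup>2\<close> by the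
  derivative bound for the field.\<close>

lemma graph_weighted_low:
  assumes fg: "(f, g) \<in> graph" and e: "e > 0" and b: "b \<in> Basis"
  shows "- (9 * real DIM('a)) * (norm f)\<^sup>2 \<le> inner g (cm (fld e b) (cm (fld e b) f))"
proof -
  obtain q where "grad_at f g q" using grad_at_exists[OF fg] by blast
  then obtain \<phi> where \<phi>: "(\<lambda>k. emb (\<phi> k)) \<longlonglongrightarrow> f" "(\<lambda>k. H0 (\<phi> k)) \<longlonglongrightarrow> g" by (rule grad_atE)
  have "- (9 * real DIM('a)) * (norm (emb h))\<^sup>2 \<le> inner (H0 h) (cm (fld e b) (cm (fld e b) (emb h)))" for h
  proof -
    have "0 \<le> inner (H0 (tm (fld e b) h)) (emb (tm (fld e b) h))"
      by (rule graph_inner_nonneg[OF emb_in_graph])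
    moreover have "(\<Sum>c\<in>Basis. (norm (emb (tm (dir_deriv c (fld e b)) h)))\<^sup>2) \<le> (\<Sum>c\<in>(Basis :: 'a set). (3 * norm (emb h))\<^sup>2)"
      by (intro sum_mono power_mono)
        (use emb_tm_cm[OF smooth_dir_deriv[OF smooth_fld[OF e]] dir_deriv_fld_bound[OF e b]]
          norm_cm_le[OF dir_deriv_fld_bound[OF e b]] in auto)
    ultimately show ?thesis
      using inner_H0_square[OF smooth_fld[OF e], of h b]
      by (simp add: emb_tm_cm[OF smooth_fld[OF e] fld_bound[OF e b]] power_mult_distrib algebra_simps)
  qed
  moreover have "(\<lambda>k. - (9 * real DIM('a)) * (norm (emb (\<phi> k)))\<^sup>2) \<longlonglongrightarrow> - (9 * real DIM('a)) * (norm f)\<^sup>2"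
    by (intro tendsto_intros \<phi>)
  moreover have "(\<lambda>k. inner (H0 (\<phi> k)) (cm (fld e b) (cm (fld e b) (emb (\<phi> k))))) \<longlonglongrightarrow> inner g (cm (fld e b) (cm (fld e b) f))"
    by (intro tendsto_intros \<phi>)
  ultimately show ?thesis by (intro LIMSEQ_le) auto
qed

text \<open>Pairing the resolvent equation with the twice weighted solution gives a quadratic
  inequality for the weighted norm. The outcome is that the resolvent loses localisation only at
  order \<open>1 / sqrt l\<close>, uniformly in \<open>e\<close>.\<close>

lemma resolvent_weighted_bound:
  assumes fg: "(f, u - l *\<^sub>R f) \<in> graph" and l: "l > 0" and e: "e > 0" and b: "b \<in> Basis"
  shows "l * norm (cm (fld e b) f) \<le> norm (cm (fld e b) u) + 3 * sqrt (real DIM('a)) * norm u / sqrt l"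
proof -
  define y where "y = l * norm (cm (fld e b) f)"
  define p where "p = norm (cm (fld e b) u)"
  define r where "r = 3 * sqrt (real DIM('a)) * norm u / sqrt l"
  have i: "inner (cm (fld e b) g) h = inner g (cm (fld e b) h)" for g h
    by (rule inner_cm[OF smooth_fld[OF e] fld_bound[OF e b]])
  have fu: "l * norm f \<le> norm u" using graph_low[OF fg l] by simp
  have "- (9 * real DIM('a)) * (norm f)\<^sup>2 \<le> inner (cm (fld e b) u) (cm (fld e b) f) - l * (norm (cm (fld e b) f))\<^sup>2"
    using graph_weighted_low[OF fg e b] by (simp add: inner_diff_left i power2_norm_eq_inner)
  also have "inner (cm (fld e b) u) (cm (fld e b) f) \<le> p * norm (cm (fld e b) f)"
    unfolding p_def by (rule inner_le_norm)
  finally have "l * (norm (cm (fld e b) f))\<^sup>2 \<le> p * norm (cm (fld e b) f) + 9 * real DIM('a) * (norm f)\<^sup>2"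
    by simp
  then have "l * (l * (norm (cm (fld e b) f))\<^sup>2) \<le> l * (p * norm (cm (fld e b) f) + 9 * real DIM('a) * (norm f)\<^sup>2)"
    using l by (intro mult_left_mono) auto
  then have "y\<^sup>2 \<le> p * y + 9 * real DIM('a) * (l * (norm f)\<^sup>2)"
    by (simp add: y_def power2_eq_square algebra_simps)
  also have "l * (norm f)\<^sup>2 \<le> (norm u)\<^sup>2 / l"
  proof -
    have "(l * norm f)\<^sup>2 \<le> (norm u)\<^sup>2" using fu l by (intro power_mono) auto
    then show ?thesis using l by (simp add: field_simps power2_eq_square)
  qed
  also have "9 * real DIM('a) * ((norm u)\<^sup>2 / l) = r\<^sup>2"
    using l by (simp add: r_def power_mult_distrib power_divide)
  finally have yy: "y\<^sup>2 \<le> p * y + r\<^sup>2" by simp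
  have "0 \<le> p" "0 \<le> r" using l by (auto simp: p_def r_def)
  \<comment> \<open>For nonnegative \<open>p\<close> and \<open>r\<close>,
    \<open>y\<^sup>2 \<le> p * y + r\<^sup>2\<close> is incompatible with \<open>y > p + r\<close>,
    since then \<open>y * y > p * y + r * y\<close> and \<open>r * y \<ge> r * r\<close>.\<close>
  have "y \<le> p + r"
  proof (rule ccontr)
    assume "\<not> y \<le> p + r"
    then have a: "p + r < y" by simp
    have "(p + r) * y + r * 0 < y * y" using a \<open>0 \<le> p\<close> \<open>0 \<le> r\<close> by (simp add: mult_strict_right_mono)
    moreover have "r * r \<le> r * y" using a \<open>0 \<le> p\<close> \<open>0 \<le> r\<close> by (intro mult_left_mono) auto
    ultimately show False using yy by (simp add: power2_eq_square algebra_simps)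
  qed
  then show ?thesis by (simp add: y_def p_def r_def)
qed

end

text \<open>The kinetic part of the pairing is exactly \<open>vir\<close>; the potential part is
  nonnegative by repulsivity and is dropped.\<close>

lemma (in repulsive_potential) grad_at_virial:
  assumes e: "e > 0" and K: "grad_at f g q"
  shows "vir e f q \<le> inner g (Aop e f q)"
proof -
  obtain \<phi> where \<phi>: "(\<lambda>k. emb (\<phi> k)) \<longlonglongrightarrow> f" "(\<lambda>k. H0 (\<phi> k)) \<longlonglongrightarrow> g"
    "\<And>b. b \<in> Basis \<Longrightarrow> (\<lambda>k. emb (td b (\<phi> k))) \<longlonglongrightarrow> q b" using grad_atE[OF K] by blast
  have "vir e (emb h) (\<lambda>b. emb (td b h)) \<le> inner (H0 h) (emb (tA e h))" for h
  proof -
    have "vir e (emb h) (\<lambda>b. emb (td b h)) = - inner (emb (tlap h)) (emb (tA e h))"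
      unfolding vir_def inner_neg_tlap_tA[OF e]
      by (simp add: emb_tm_cm[OF smooth_dir_deriv[OF smooth_fld[OF e]] dir_deriv_fld_bound[OF e]]
          emb_tm_cm[OF smooth_dir_deriv[OF smooth_dv[OF e]] dir_deriv_dv_bound[OF e]])
    then show ?thesis
      using inner_Vop_tA_nonneg[OF e, of h] by (simp add: H0_def inner_diff_left)
  qed
  moreover have "(\<lambda>k. vir e (emb (\<phi> k)) (\<lambda>b. emb (td b (\<phi> k)))) \<longlonglongrightarrow> vir e f q"
    by (intro tendsto_vir \<phi>)
  moreover have "(\<lambda>k. inner (H0 (\<phi> k)) (emb (tA e (\<phi> k)))) \<longlonglongrightarrow> inner g (Aop e f q)"
    unfolding emb_tA[OF e] by (intro tendsto_inner tendsto_Aop \<phi>)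
  ultimately show ?thesis by (intro LIMSEQ_le) auto
qed

subsection \<open>The escape estimate\<close>

lemma chi_seq_tendsto: "(\<lambda>k. chi (inverse (real (Suc k))) x) \<longlonglongrightarrow> 1"
proof -
  have "(\<lambda>k. inverse (1 + inverse (real (Suc k)) * (x \<bullet> x))) \<longlonglongrightarrow> inverse (1 + 0 * (x \<bullet> x))"
    by (intro tendsto_intros LIMSEQ_inverse_real_of_nat) auto
  then show ?thesis by (simp add: chi_def)
qed

lemma tendsto_cm_strong:
  assumes "\<And>k. smooth (m k)" "\<And>k x. \<bar>m k x\<bar> \<le> B" "\<And>x. (\<lambda>k. m k x) \<longlonglongrightarrow> c"
  shows "(\<lambda>k. cm (m k) f) \<longlonglongrightarrow> c *\<^sub>R f"
proof -
  have "(\<lambda>k. mul (\<lambda>x. complex_of_real (m k x)) f) \<longlonglongrightarrow> mul (\<lambda>x. complex_of_real c) f"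
  proof (rule tendsto_mul_strong[where B = B])
    show "(\<lambda>x. complex_of_real (m k x)) \<in> borel_measurable lebesgue" for k
      using bdd_meas_smooth[OF assms(1) assms(2)] by (simp add: bdd_meas_def)
  qed (use assms in \<open>auto intro: tendsto_of_real\<close>)
  then show ?thesis by (simp add: cm_def mul_of_real)
qed

abbreviation eps :: "nat \<Rightarrow> real" where "eps k \<equiv> inverse (real (Suc k))"

lemma eps_pos: "eps k > 0" and eps_le_1: "eps k \<le> 1"
  by (auto simp: inverse_le_1_iff)

lemma cm_fld_deriv_tendsto:
  assumes "b \<in> Basis" "c \<in> Basis"
  shows "(\<lambda>k. cm (dir_deriv c (fld (eps k) b)) f) \<longlonglongrightarrow> (c \<bullet> b) *\<^sub>R f"
proof (rule tendsto_cm_strong)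
  show "smooth (dir_deriv c (fld (eps k) b))" for k
    by (rule smooth_dir_deriv[OF smooth_fld[OF eps_pos] assms(2)])
  show "\<bar>dir_deriv c (fld (eps k) b) x\<bar> \<le> 3" for k x
    by (rule dir_deriv_fld_bound[OF eps_pos assms])
  show "(\<lambda>k. dir_deriv c (fld (eps k) b) x) \<longlonglongrightarrow> c \<bullet> b" for x
  proof -
    have "(\<lambda>k. chi (eps k) x * (c \<bullet> b) - 2 * eps k * (x \<bullet> c) * (x \<bullet> b) * (chi (eps k) x)\<^sup>2)
      \<longlonglongrightarrow> 1 * (c \<bullet> b) - 2 * 0 * (x \<bullet> c) * (x \<bullet> b) * 1\<^sup>2"
      by (intro tendsto_intros chi_seq_tendsto LIMSEQ_inverse_real_of_nat)
    then show ?thesis unfolding dir_deriv_fld[OF eps_pos] by simp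
  qed
qed

lemma dir_deriv_dv_eps_bound:
  fixes x :: "'a::euclidean_space"
  assumes "c \<in> Basis"
  shows "\<bar>dir_deriv c (dv (eps k)) x\<bar> \<le> real DIM('a) + 6"
proof (rule order_trans[OF dir_deriv_dv_bound[OF eps_pos assms]])
  have "(real DIM('a) + 6) * sqrt (eps k) \<le> (real DIM('a) + 6) * 1"
    using eps_le_1[of k] by (intro mult_left_mono) auto
  then show "(real DIM('a) + 6) * sqrt (eps k) \<le> real DIM('a) + 6" by (simp only: mult_1_right)
qed

lemma cm_dv_deriv_tendsto:
  fixes f :: "'a::euclidean_space lsq"
  assumes c: "c \<in> Basis"
  shows "(\<lambda>k. cm (dir_deriv c (dv (eps k))) f) \<longlonglongrightarrow> 0 *\<^sub>R f"
proof (rule tendsto_cm_strong)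
  show "smooth (dir_deriv c (dv (eps k)))" for k
    by (rule smooth_dir_deriv[OF smooth_dv[OF eps_pos] c])
  show "\<bar>dir_deriv c (dv (eps k)) x\<bar> \<le> (real DIM('a) + 6)" for k and x :: 'a
    by (rule dir_deriv_dv_eps_bound[OF c])
  show "(\<lambda>k. dir_deriv c (dv (eps k)) x) \<longlonglongrightarrow> 0" for x :: 'a
  proof -
    have "(\<lambda>k. ((real DIM('a) - 2) + 4 * chi (eps k) x) * (- 2 * eps k * (x \<bullet> c) * (chi (eps k) x)\<^sup>2))
      \<longlonglongrightarrow> ((real DIM('a) - 2) + 4 * 1) * (- 2 * 0 * (x \<bullet> c) * 1\<^sup>2)"
      by (intro tendsto_intros chi_seq_tendsto LIMSEQ_inverse_real_of_nat)
    then show ?thesis unfolding dir_deriv_dv[OF eps_pos] dir_deriv_chi[OF eps_pos] by simp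
  qed
qed

lemma cm_dv_tendsto: "(\<lambda>k. cm (dv (eps k)) f) \<longlonglongrightarrow> real DIM('a) *\<^sub>R f" for f :: "'a::euclidean_space lsq"
proof (rule tendsto_cm_strong)
  show "smooth (dv (eps k) :: 'a \<Rightarrow> real)" for k by (rule smooth_dv[OF eps_pos])
  show "\<bar>dv (eps k) x\<bar> \<le> (real DIM('a) + 4)" for k and x :: 'a by (rule dv_bound[OF eps_pos])
  show "(\<lambda>k. dv (eps k) x) \<longlonglongrightarrow> real DIM('a)" for x :: 'a
  proof -
    have "(\<lambda>k. (real DIM('a) - 2) * chi (eps k) x + 2 * (chi (eps k) x)\<^sup>2) \<longlonglongrightarrow> (real DIM('a) - 2) * 1 + 2 * 1\<^sup>2"
      by (intro tendsto_intros chi_seq_tendsto)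
    then show ?thesis by (simp add: dv_def)
  qed
qed

text \<open>As the cutoff is removed, the derivative matrix of the field tends to the identity and
  the gradient of its divergence to 0, so that only the Dirichlet integral survives.\<close>

lemma vir_tendsto: "(\<lambda>k. vir (eps k) f q) \<longlonglongrightarrow> (\<Sum>b\<in>Basis. (norm (q b))\<^sup>2)"
proof -
  have "(\<lambda>k. vir (eps k) f q) \<longlonglongrightarrow> (\<Sum>c\<in>Basis. \<Sum>b\<in>Basis. inner ((c \<bullet> b) *\<^sub>R q b) (q c))
      + (1/2) * (\<Sum>c\<in>Basis. inner (0 *\<^sub>R f) (q c))"
    unfolding vir_def
    by (intro tendsto_add tendsto_sum tendsto_mult tendsto_const tendsto_inner cm_fld_deriv_tendsto cm_dv_deriv_tendsto)
  also have "(\<Sum>c\<in>Basis. \<Sum>b\<in>Basis. inner ((c \<bullet> b) *\<^sub>R q b) (q c)) = (\<Sum>c\<in>Basis. (norm (q c))\<^sup>2)"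
  proof (intro sum.cong refl)
    fix c :: 'a assume c: "c \<in> Basis"
    have "(\<Sum>b\<in>Basis. inner ((c \<bullet> b) *\<^sub>R q b) (q c)) = (\<Sum>b\<in>Basis. if b = c then inner (q c) (q c) else 0)"
      using c by (intro sum.cong) (auto simp: inner_Basis)
    also have "\<dots> = (norm (q c))\<^sup>2" using c by (simp add: power2_norm_eq_inner)
    finally show "(\<Sum>b\<in>Basis. inner ((c \<bullet> b) *\<^sub>R q b) (q c)) = (norm (q c))\<^sup>2" .
  qed
  finally show ?thesis by simp
qed

text \<open>A bound independent of \<open>k\<close>, used as the majorant when the cutoff is removed
  under the time integral.\<close>

lemma vir_bound:
  fixes f :: "'a::euclidean_space lsq"
  assumes f: "norm f \<le> N" and q: "\<And>b. b \<in> Basis \<Longrightarrow> norm (q b) \<le> Q" and N: "0 \<le> N" "0 \<le> Q"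
  shows "\<bar>vir (eps k) f q\<bar> \<le> real DIM('a) * (real DIM('a) * (3 * Q * Q)) + (1/2) * (real DIM('a) * ((real DIM('a) + 6) * N * Q))"
proof -
  have 1: "\<bar>inner (cm (dir_deriv c (fld (eps k) b)) (q b)) (q c)\<bar> \<le> 3 * Q * Q" if "b \<in> Basis" "c \<in> Basis" for b c
  proof -
    have "\<bar>inner (cm (dir_deriv c (fld (eps k) b)) (q b)) (q c)\<bar> \<le> norm (cm (dir_deriv c (fld (eps k) b)) (q b)) * norm (q c)"
      by (rule Cauchy_Schwarz_ineq2)
    also have "\<dots> \<le> (3 * norm (q b)) * norm (q c)"
      by (intro mult_right_mono norm_cm_le dir_deriv_fld_bound eps_pos that) auto
    also have "\<dots> \<le> 3 * Q * Q" using q that N by (intro mult_mono) auto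
    finally show ?thesis .
  qed
  have 2: "\<bar>inner (cm (dir_deriv c (dv (eps k))) f) (q c)\<bar> \<le> (real DIM('a) + 6) * N * Q" if c: "c \<in> Basis" for c
  proof -
    have b: "\<bar>dir_deriv c (dv (eps k)) x\<bar> \<le> (real DIM('a) + 6)" for x :: 'a
    by (rule dir_deriv_dv_eps_bound[OF c])
    have "\<bar>inner (cm (dir_deriv c (dv (eps k))) f) (q c)\<bar> \<le> norm (cm (dir_deriv c (dv (eps k))) f) * norm (q c)"
      by (rule Cauchy_Schwarz_ineq2)
    also have "\<dots> \<le> ((real DIM('a) + 6) * norm f) * norm (q c)"
      by (intro mult_right_mono norm_cm_le b) auto
    also have "\<dots> \<le> (real DIM('a) + 6) * N * Q" using q c f N by (intro mult_mono) auto
    finally show ?thesis .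
  qed
  have "\<bar>\<Sum>c\<in>Basis. \<Sum>b\<in>Basis. inner (cm (dir_deriv c (fld (eps k) b)) (q b)) (q c)\<bar> \<le> (\<Sum>c\<in>(Basis::'a set). \<Sum>b\<in>(Basis::'a set). 3 * Q * Q)"
    by (rule order_trans[OF sum_abs], rule sum_mono, rule order_trans[OF sum_abs], rule sum_mono, rule 1)
  moreover have "\<bar>\<Sum>c\<in>Basis. inner (cm (dir_deriv c (dv (eps k))) f) (q c)\<bar> \<le> (\<Sum>c\<in>(Basis::'a set). (real DIM('a) + 6) * N * Q)"
    by (rule order_trans[OF sum_abs], rule sum_mono, rule 2)
  ultimately show ?thesis unfolding vir_def by simp
qed

text \<open>What the escape estimate uses of the unitary group, on the level of classes. The sign in
  \<open>Ul_deriv\<close> is that of \<open>u' = - i H u\<close>, required at every time and not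
  only at 0.\<close>

locale repulsive_flow = repulsive_potential +
  fixes Ul :: "real \<Rightarrow> 'a lsq \<Rightarrow> 'a lsq"
  assumes Ul_diff: "\<And>t f g. Ul t (f - g) = Ul t f - Ul t g"
    and norm_Ul: "\<And>t f. norm (Ul t f) = norm f"
    and Ul_0: "\<And>f. Ul 0 f = f"
    and Ul_continuous: "\<And>f. continuous_on UNIV (\<lambda>s. Ul s f)"
    and Ul_graph: "\<And>t f g. (f, g) \<in> graph \<Longrightarrow> (Ul t f, Ul t g) \<in> graph"
    and Ul_deriv: "\<And>t f g. (f, g) \<in> graph \<Longrightarrow> ((\<lambda>r. (Ul r f - Ul t f) /\<^sub>R (r - t)) \<longlongrightarrow> - J (Ul t g)) (at t)"
begin

lemma inner_Ul: "inner (Ul t f) (Ul t g) = inner f g"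
proof -
  have p: "inner x y = ((norm x)\<^sup>2 + (norm y)\<^sup>2 - (norm (x - y))\<^sup>2) / 2" for x y :: "'a lsq"
    unfolding power2_norm_eq_inner by (simp add: inner_diff_left inner_diff_right inner_commute)
  show ?thesis by (simp add: p[of "Ul t f"] p[of f] norm_Ul flip: Ul_diff)
qed

text \<open>The quadratic form of the cut-off dilation generator grows linearly in time at a rate
  bounded below by the energy, whereas at the endpoints it is at most the position bound times
  the square root of the energy.\<close>

lemma escape_estimate:
  assumes FG: "(F, G) \<in> graph" and t: "t > 0"
    and B0: "\<And>k b. b \<in> Basis \<Longrightarrow> norm (cm (fld (eps k) b) F) \<le> B0"
    and B1: "\<And>k b. b \<in> Basis \<Longrightarrow> norm (cm (fld (eps k) b) (Ul t F)) \<le> B1"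
  shows "t * (norm F)\<^sup>2 \<le> 4 * real DIM('a) * B0 * (B0 + B1)"
proof -
  define w where "w s = Ul s F" for s
  define g where "g s = Ul s G" for s
  have wg: "(w s, g s) \<in> graph" for s unfolding w_def g_def by (rule Ul_graph[OF FG])
  have "\<exists>q. grad_at (w s) (g s) q" for s using grad_at_exists[OF wg] by metis
  then obtain q where q: "\<And>s. grad_at (w s) (g s) (q s)" by metis
  define E where "E = inner G F"
  have E: "inner (g s) (w s) = E" for s by (simp add: g_def w_def E_def inner_Ul)
  have E0: "0 \<le> E" using graph_inner_nonneg[OF FG] by (simp add: E_def)
  have qE: "norm (q s b) \<le> sqrt (2 * E)" if "b \<in> Basis" for s b
    using grad_at_norm_le[OF q that, of s] E by (simp add: real_le_rsqrt)
  have wc: "continuous_on UNIV w" and gc: "continuous_on UNIV g"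
    unfolding w_def[abs_def] g_def[abs_def] by (rule Ul_continuous)+
  have wl: "(w \<longlongrightarrow> w s) (at s)" and gl: "(g \<longlongrightarrow> g s) (at s)" for s
    using wc gc by (auto simp: continuous_on_def)
  \<comment> \<open>Continuity of the gradient in time: the energy bound applied to the difference
    of two states reduces it to continuity of \<open>w\<close> and \<open>g\<close>.\<close>
  have ql: "((\<lambda>r. q r b) \<longlongrightarrow> q s b) (at s)" if b: "b \<in> Basis" for s b
  proof (rule LIM_zero_cancel, rule tendsto_norm_zero_cancel)
    have lim: "((\<lambda>r. sqrt (2 * inner (g r - g s) (w r - w s))) \<longlongrightarrow> sqrt (2 * inner (g s - g s) (w s - w s))) (at s)"
      by (intro tendsto_intros wl gl)
    show "((\<lambda>r. norm (q r b - q s b)) \<longlongrightarrow> 0) (at s)"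
    proof (rule tendsto_sandwich[OF _ _ tendsto_const])
      show "\<forall>\<^sub>F r in at s. norm (q r b - q s b) \<le> sqrt (2 * inner (g r - g s) (w r - w s))"
        using grad_at_norm_le[OF grad_at_diff[OF q q] b] by (intro always_eventually allI real_le_rsqrt) simp
      show "((\<lambda>r. sqrt (2 * inner (g r - g s) (w r - w s))) \<longlongrightarrow> 0) (at s)" using lim by simp
    qed auto
  qed
  define A where "A e s = Aop e (w s) (q s)" for e s
  \<comment> \<open>The expectation of the self-adjoint generator of dilations, with the imaginary
    unit moved onto the state.\<close>
  define a where "a e s = inner (J (w s)) (A e s)" for e s
  have Al: "((\<lambda>r. A e r) \<longlongrightarrow> A e s) (at s)" for e s
    unfolding A_def by (intro tendsto_Aop wl ql)
  \<comment> \<open>\<open>J\<close> commutes with the skew operator, so the form is symmetric.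
    Hence \<open>a e r - a e s\<close> factors as the pairing of \<open>J (w r - w s)\<close> with
    \<open>A e r + A e s\<close>: differentiability of \<open>w\<close> and mere continuity of
    \<open>A e\<close> suffice to differentiate \<open>a e\<close>.\<close>
  have sym: "inner (J (w r)) (A e s) = inner (J (w s)) (A e r)" if e: "e > 0" for e r s
  proof -
    have "inner (J (w r)) (A e s) = - inner (Aop e (J (w r)) (\<lambda>b. J (q r b))) (w s)"
      unfolding A_def using grad_at_antisym[OF e grad_at_J[OF q] q] by simp
    also have "\<dots> = inner (A e r) (J (w s))"
      unfolding Aop_J[OF e] A_def inner_J by simp
    finally show ?thesis by (simp add: inner_commute)
  qed
  have a_deriv: "(a e has_real_derivative 2 * inner (g s) (A e s)) (at s)" if e: "e > 0" for e s
    unfolding has_field_derivative_iff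
  proof (rule Lim_transform_eventually)
    have "((\<lambda>r. (w r - w s) /\<^sub>R (r - s)) \<longlongrightarrow> - J (g s)) (at s)"
      using Ul_deriv[OF FG, of s] unfolding w_def g_def .
    then have "((\<lambda>r. inner (J ((w r - w s) /\<^sub>R (r - s))) (A e r + A e s)) \<longlongrightarrow> inner (J (- J (g s))) (A e s + A e s)) (at s)"
      by (intro tendsto_intros tendsto_mul Al)
    then show "((\<lambda>r. inner (J ((w r - w s) /\<^sub>R (r - s))) (A e r + A e s)) \<longlongrightarrow> 2 * inner (g s) (A e s)) (at s)"
      by (simp add: mul_minus J_J inner_add_right)
    show "\<forall>\<^sub>F r in at s. inner (J ((w r - w s) /\<^sub>R (r - s))) (A e r + A e s) = (a e r - a e s) / (r - s)"
    proof (intro always_eventually allI)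
      fix r
      have "inner (J (w r - w s)) (A e r + A e s) = a e r - a e s"
        using sym[OF e, of r s] by (simp add: a_def mul_diff inner_diff_left inner_add_right)
      then show "inner (J ((w r - w s) /\<^sub>R (r - s))) (A e r + A e s) = (a e r - a e s) / (r - s)"
        by (simp add: mul_scaleR divide_inverse mult.commute)
    qed
  qed
  have a_le: "\<bar>a e s\<bar> \<le> real DIM('a) * B * sqrt (2 * E)"
    if e: "e > 0" and B: "\<And>b. b \<in> Basis \<Longrightarrow> norm (cm (fld e b) (w s)) \<le> B" for e s B
  proof -
    \<comment> \<open>A real multiplier is symmetric and commutes with the skew map
      \<open>J\<close>, so the divergence term does not contribute. The field can then be moved from
      the gradient to the state, where the position bound applies.\<close>
    have z: "inner (J (w s)) (cm (dv e) (w s)) = 0"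
      using inner_J[of "w s" "cm (dv e) (w s)"] inner_cm[OF smooth_dv[OF e] dv_bound[OF e], of "w s" "J (w s)"]
      by (simp add: cm_J[OF smooth_dv[OF e] dv_bound[OF e]] inner_commute)
    have x: "inner (J (w s)) (cm (fld e b) (q s b)) = inner (J (cm (fld e b) (w s))) (q s b)" if "b \<in> Basis" for b
      using inner_cm[OF smooth_fld[OF e] fld_bound[OF e that]] cm_J[OF smooth_fld[OF e] fld_bound[OF e that]] by metis
    have "a e s = (\<Sum>b\<in>Basis. inner (J (cm (fld e b) (w s))) (q s b))"
      unfolding a_def A_def Aop_def by (simp add: inner_add_right inner_sum_right z x)
    also have "\<bar>\<dots>\<bar> \<le> (\<Sum>b\<in>(Basis :: 'a set). B * sqrt (2 * E))"
    proof (rule order_trans[OF sum_abs], rule sum_mono)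
      fix b :: 'a assume b: "b \<in> Basis"
      have "\<bar>inner (J (cm (fld e b) (w s))) (q s b)\<bar> \<le> norm (cm (fld e b) (w s)) * norm (q s b)"
        using Cauchy_Schwarz_ineq2[of "J (cm (fld e b) (w s))" "q s b"] by (simp add: norm_J)
      also have "\<dots> \<le> B * sqrt (2 * E)"
        using B[OF b] qE[OF b] order_trans[OF norm_ge_zero B[OF b]] by (intro mult_mono) auto
      finally show "\<bar>inner (J (cm (fld e b) (w s))) (q s b)\<bar> \<le> B * sqrt (2 * E)" .
    qed
    finally show ?thesis by simp
  qed
  \<comment> \<open>The conserved energy is at most twice the Dirichlet integral, which is the limit
    of \<open>2 * vir\<close>; the latter is at most the time derivative of \<open>a\<close>.
    Integrating over \<open>{0..t}\<close> leaves the two endpoint values of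
    \<open>a\<close>.\<close>
  have growth: "E * t \<le> real DIM('a) * (B0 + B1) * sqrt (2 * E)"
  proof -
    define C where "C = real DIM('a) * (real DIM('a) * (3 * sqrt (2 * E) * sqrt (2 * E)))
      + (1/2) * (real DIM('a) * ((real DIM('a) + 6) * norm F * sqrt (2 * E)))"
    have C: "\<bar>vir (eps k) (w s) (q s)\<bar> \<le> C" for k s
      unfolding C_def by (rule vir_bound) (use qE E0 in \<open>auto simp: w_def norm_Ul\<close>)
    have vc: "continuous_on {0..t} (\<lambda>s. 2 * vir (eps k) (w s) (q s))" for k
      unfolding continuous_on_def
      by (intro ballI tendsto_mult tendsto_const tendsto_vir tendsto_within_subset[OF wl] tendsto_within_subset[OF ql]) auto
    have vi: "(\<lambda>s. 2 * vir (eps k) (w s) (q s)) integrable_on {0..t}" for k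
      by (rule integrable_continuous_real[OF vc])
    have "norm (2 * vir (eps k) (w s) (q s)) \<le> 2 * C" for k s
      using C[of k s] by (simp only: real_norm_def abs_mult abs_numeral mult_le_cancel_left_pos zero_less_numeral)
    moreover have "(\<lambda>k. 2 * vir (eps k) (w s) (q s)) \<longlonglongrightarrow> 2 * (\<Sum>b\<in>Basis. (norm (q s b))\<^sup>2)" for s
      by (intro tendsto_mult tendsto_const vir_tendsto)
    ultimately have conv: "(\<lambda>s. 2 * (\<Sum>b\<in>Basis. (norm (q s b))\<^sup>2)) integrable_on {0..t}"
      "(\<lambda>k. integral {0..t} (\<lambda>s. 2 * vir (eps k) (w s) (q s))) \<longlonglongrightarrow> integral {0..t} (\<lambda>s. 2 * (\<Sum>b\<in>Basis. (norm (q s b))\<^sup>2))"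
      using dominated_convergence[of "\<lambda>k s. 2 * vir (eps k) (w s) (q s)" "{0..t}" "\<lambda>s. 2 * C"
          "\<lambda>s. 2 * (\<Sum>b\<in>Basis. (norm (q s b))\<^sup>2)"] vi integrable_const_ivl[of "2 * C" 0 t] by blast+
    have "E * t = integral {0..t} (\<lambda>s. E)" using t by simp
    also have "\<dots> \<le> integral {0..t} (\<lambda>s. 2 * (\<Sum>b\<in>Basis. (norm (q s b))\<^sup>2))"
      using conv(1) grad_at_energy(2)[OF q] E by (intro integral_le) auto
    also have "\<dots> \<le> real DIM('a) * (B0 + B1) * sqrt (2 * E)"
    proof (rule LIMSEQ_le_const2[OF conv(2)], intro exI allI impI)
      fix k
      have FTC: "((\<lambda>s. 2 * inner (g s) (A (eps k) s)) has_integral (a (eps k) t - a (eps k) 0)) {0..t}"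
        using t a_deriv[OF eps_pos]
        by (intro fundamental_theorem_of_calculus)
          (auto simp: has_real_derivative_iff_has_vector_derivative[symmetric] intro: has_field_derivative_at_within)
      have "integral {0..t} (\<lambda>s. 2 * vir (eps k) (w s) (q s)) \<le> a (eps k) t - a (eps k) 0"
        unfolding integral_unique[OF FTC, symmetric]
        using grad_at_virial[OF eps_pos q] by (intro integral_le vi has_integral_integrable[OF FTC]) (simp add: A_def)
      also have "\<dots> \<le> \<bar>a (eps k) t\<bar> + \<bar>a (eps k) 0\<bar>" by linarith
      also have "\<dots> \<le> real DIM('a) * B1 * sqrt (2 * E) + real DIM('a) * B0 * sqrt (2 * E)"
        by (intro add_mono a_le eps_pos) (simp_all only: w_def Ul_0 B0 B1)
      finally show "integral {0..t} (\<lambda>s. 2 * vir (eps k) (w s) (q s)) \<le> real DIM('a) * (B0 + B1) * sqrt (2 * E)"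
        by (simp add: algebra_simps)
    qed
    finally show ?thesis .
  qed
  \<comment> \<open>The Heisenberg inequality: skewness gives that
    \<open>inner (A (eps k) 0) F\<close> is 0, so the divergence term equals -2 times the field
    term, and the divergence tends to the dimension.\<close>
  have heis: "real DIM('a) * (norm F)\<^sup>2 \<le> 2 * real DIM('a) * B0 * sqrt (2 * E)"
  proof (rule LIMSEQ_le_const2)
    have "(\<lambda>k. inner (cm (dv (eps k)) F) F) \<longlonglongrightarrow> inner (real DIM('a) *\<^sub>R F) F"
      by (intro tendsto_intros cm_dv_tendsto)
    then show "(\<lambda>k. inner (cm (dv (eps k)) F) F) \<longlonglongrightarrow> real DIM('a) * (norm F)\<^sup>2"
      by (simp add: power2_norm_eq_inner)
    have "inner (cm (dv (eps k)) F) F \<le> 2 * real DIM('a) * B0 * sqrt (2 * E)" for k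
    proof -
      have w0: "w 0 = F" by (simp add: w_def Ul_0)
      have "inner (A (eps k) 0) F = 0"
        using grad_at_antisym[OF eps_pos q[of 0] q[of 0]] by (simp add: A_def w0 inner_commute)
      then have "inner (cm (dv (eps k)) F) F = - 2 * (\<Sum>b\<in>Basis. inner (cm (fld (eps k) b) (q 0 b)) F)"
        by (simp add: A_def Aop_def w0 inner_add_left inner_sum_left)
      also have "\<dots> \<le> 2 * (\<Sum>b\<in>Basis. \<bar>inner (cm (fld (eps k) b) (q 0 b)) F\<bar>)"
        using sum_abs[of "\<lambda>b. inner (cm (fld (eps k) b) (q 0 b)) F" Basis] by linarith
      also have "\<dots> \<le> 2 * (\<Sum>b\<in>(Basis :: 'a set). B0 * sqrt (2 * E))"
      proof (intro mult_left_mono sum_mono)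
        fix b :: 'a assume b: "b \<in> Basis"
        have "\<bar>inner (cm (fld (eps k) b) (q 0 b)) F\<bar> = \<bar>inner (cm (fld (eps k) b) F) (q 0 b)\<bar>"
          using inner_cm[OF smooth_fld[OF eps_pos] fld_bound[OF eps_pos b], of k "q 0 b" F] by (metis inner_commute)
        also have "\<dots> \<le> norm (cm (fld (eps k) b) F) * norm (q 0 b)" by (rule Cauchy_Schwarz_ineq2)
        also have "\<dots> \<le> B0 * sqrt (2 * E)"
          using B0[OF b, of k] qE[OF b] order_trans[OF norm_ge_zero B0[OF b, of k]] by (intro mult_mono) auto
        finally show "\<bar>inner (cm (fld (eps k) b) (q 0 b)) F\<bar> \<le> B0 * sqrt (2 * E)" .
      qed simp
      finally show ?thesis by simp
    qed
    then show "\<exists>N. \<forall>k\<ge>N. inner (cm (dv (eps k)) F) F \<le> 2 * real DIM('a) * B0 * sqrt (2 * E)" by blast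
  qed
  obtain b :: 'a where b: "b \<in> Basis" using nonempty_Basis by blast
  have B: "0 \<le> B0" "0 \<le> B1"
    using order_trans[OF norm_ge_zero B0[OF b]] order_trans[OF norm_ge_zero B1[OF b]] by auto
  \<comment> \<open>The energy is eliminated: growth reads \<open>z * t \<le> 2 n (B0 + B1)\<close>
    for \<open>z > 0\<close> and dimension \<open>n\<close>, Heisenberg reads
    \<open>(norm F)\<^sup>2 \<le> 2 * B0 * z\<close>; their combination gives the constant
    \<open>4 n\<close>.\<close>
  define z where "z = sqrt (2 * E)"
  have z: "0 \<le> z" "z * z = 2 * E" using E0 by (auto simp: z_def)
  have F: "(norm F)\<^sup>2 \<le> 2 * B0 * z" using heis by (simp add: z_def)
  show ?thesis
  proof (cases "z = 0")
    case True
    then have "(norm F)\<^sup>2 \<le> 0" using F by simp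
    then show ?thesis using B by simp
  next
    case False
    have "z * (z * t) \<le> z * (2 * (real DIM('a) * (B0 + B1)))"
      using growth z unfolding z_def[symmetric] by (simp add: mult_ac)
    then have zt: "z * t \<le> 2 * (real DIM('a) * (B0 + B1))" using False z by simp
    have "t * (norm F)\<^sup>2 \<le> t * (2 * B0 * z)" using F t by (intro mult_left_mono) auto
    also have "\<dots> = 2 * B0 * (z * t)" by simp
    also have "\<dots> \<le> 2 * B0 * (2 * (real DIM('a) * (B0 + B1)))" using zt B by (intro mult_left_mono) auto
    finally show ?thesis by (simp add: mult_ac)
  qed
qed

end

subsection \<open>The unitary group\<close>

lemma l2_inner_cmult_left: "l2_inner (\<lambda>x. c * f x) g = c * l2_inner f g"
  by (simp add: l2_inner_def mult.assoc)

lemma l2_inner_cmult_right: "l2_inner f (\<lambda>x. c * g x) = cnj c * l2_inner f g"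
  by (simp add: l2_inner_def mult.left_commute)

lemma self_adjoint_L2: "self_adjoint H \<Longrightarrow> (f, g) \<in> H \<Longrightarrow> f \<in> L2 \<and> g \<in> L2"
  by (auto simp: self_adjoint_def l2_adjoint_def)

lemma self_adjoint_cmult:
  assumes H: "self_adjoint H" and fg: "(f, g) \<in> H"
  shows "((\<lambda>x. c * f x), (\<lambda>x. c * g x)) \<in> H"
proof -
  have "(f, g) \<in> l2_adjoint H" using assms by (simp add: self_adjoint_def)
  then have "((\<lambda>x. c * f x), (\<lambda>x. c * g x)) \<in> l2_adjoint H"
    by (auto simp: l2_adjoint_def L2_cmult l2_inner_cmult_right)
  then show ?thesis using H by (simp add: self_adjoint_def)
qed

text \<open>The real parts determine the complex adjoint relation, because \<open>H\<close> is
  closed under multiplication by the imaginary unit and testing with the multiplied pair yields the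
  imaginary parts.\<close>

lemma self_adjoint_iff_real:
  assumes H: "self_adjoint H" and L: "f \<in> L2" "g \<in> L2"
  shows "(f, g) \<in> H \<longleftrightarrow> (\<forall>\<phi> \<psi>. (\<phi>, \<psi>) \<in> H \<longrightarrow> inner (cls \<psi>) (cls f) = inner (cls \<phi>) (cls g))"
proof
  assume "(f, g) \<in> H"
  then have "(f, g) \<in> l2_adjoint H" using H by (simp add: self_adjoint_def)
  then show "\<forall>\<phi> \<psi>. (\<phi>, \<psi>) \<in> H \<longrightarrow> inner (cls \<psi>) (cls f) = inner (cls \<phi>) (cls g)"
    using self_adjoint_L2[OF H] L by (auto simp: l2_adjoint_def inner_cls)
next
  assume R: "\<forall>\<phi> \<psi>. (\<phi>, \<psi>) \<in> H \<longrightarrow> inner (cls \<psi>) (cls f) = inner (cls \<phi>) (cls g)"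
  have "l2_inner \<psi> f = l2_inner \<phi> g" if "(\<phi>, \<psi>) \<in> H" for \<phi> \<psi>
  proof -
    have "inner (cls \<psi>) (cls f) = inner (cls \<phi>) (cls g)" using R that by blast
    moreover have "inner (cls (\<lambda>x. \<i> * \<psi> x)) (cls f) = inner (cls (\<lambda>x. \<i> * \<phi> x)) (cls g)"
      using R self_adjoint_cmult[OF H that] by blast
    ultimately show ?thesis
      using self_adjoint_L2[OF H that] L by (simp add: inner_cls L2_cmult l2_inner_cmult_left complex_eq_iff)
  qed
  then have "(f, g) \<in> l2_adjoint H" using L by (auto simp: l2_adjoint_def)
  then show "(f, g) \<in> H" using H by (simp add: self_adjoint_def)
qed

context potential
begin

text \<open>Since \<open>H\<close> is its own adjoint, membership in \<open>H\<close> is symmetry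
  against all of \<open>H\<close>. This holds for test functions and is preserved under limits in
  the graph.\<close>

lemma graph_subset_extension:
  assumes H: "schrodinger_operator V H" and L: "f \<in> L2" "g \<in> L2" and fg: "(cls f, cls g) \<in> graph"
  shows "(f, g) \<in> H"
proof -
  have sa: "self_adjoint H" using H by (simp add: schrodinger_operator_def)
  have test: "(Rep_testf \<phi>, \<lambda>x. - laplacian (Rep_testf \<phi>) x + complex_of_real (V x) * Rep_testf \<phi> x) \<in> H" for \<phi>
    using H Rep_testf[of \<phi>] by (auto simp: schrodinger_operator_def)
  have H0: "cls (\<lambda>x. - laplacian (Rep_testf \<phi>) x + complex_of_real (V x) * Rep_testf \<phi> x) = H0 \<phi>" for \<phi>
  proof -
    have "cls (\<lambda>x. complex_of_real (V x) * Rep_testf \<phi> x - Rep_testf (tlap \<phi>) x) = H0 \<phi>"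
      unfolding H0_def Vop_def emb_def by (rule cls_diff[OF VL Rep_testf_L2])
    then show ?thesis by (simp add: Rep_testf_tlap)
  qed
  obtain z where z: "\<And>n. z n \<in> range (\<lambda>f. (emb f, H0 f))" "z \<longlonglongrightarrow> (cls f, cls g)"
    using fg unfolding graph_def closure_sequential by blast
  show ?thesis unfolding self_adjoint_iff_real[OF sa L]
  proof (intro allI impI)
    fix p r assume pr: "(p, r) \<in> H"
    have "inner (cls r) (fst (z n)) = inner (cls p) (snd (z n))" for n
    proof -
      obtain \<phi> where "z n = (emb \<phi>, H0 \<phi>)" using z(1)[of n] by blast
      moreover have "inner (cls r) (emb \<phi>) = inner (cls p) (H0 \<phi>)"
        using self_adjoint_iff_real[OF sa conjunct1[OF self_adjoint_L2[OF sa test]]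
            conjunct2[OF self_adjoint_L2[OF sa test]], THEN iffD1, OF test] pr
        unfolding H0 emb_def by blast
      ultimately show ?thesis by simp
    qed
    moreover have "(\<lambda>n. inner (cls r) (fst (z n))) \<longlonglongrightarrow> inner (cls r) (fst (cls f, cls g))"
      by (intro tendsto_intros z)
    moreover have "(\<lambda>n. inner (cls p) (snd (z n))) \<longlonglongrightarrow> inner (cls p) (snd (cls f, cls g))"
      by (intro tendsto_intros z)
    ultimately show "inner (cls r) (cls f) = inner (cls p) (cls g)"
      using LIMSEQ_unique by (simp add: fun_eq_iff) fastforce
  qed
qed

text \<open>Test functions form a core. For \<open>(f, g)\<close> in \<open>H\<close> the resolvent
  of the closure solves the equation with the same right-hand side \<open>f + g\<close>; the
  difference of the two solutions lies in \<open>H\<close> at eigenvalue -1 and vanishes by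
  nonnegativity.\<close>

lemma extension_iff_graph:
  assumes H: "schrodinger_operator V H" and L: "f \<in> L2" "g \<in> L2"
  shows "(f, g) \<in> H \<longleftrightarrow> (cls f, cls g) \<in> graph"
proof
  assume fg: "(f, g) \<in> H"
  have sa: "self_adjoint H" and nn: "nonnegative_op H" using H by (auto simp: schrodinger_operator_def)
  obtain F' where F': "(F', (cls f + cls g) - 1 *\<^sub>R F') \<in> graph" using resolvent_exists[of 1 "cls f + cls g"] by auto
  obtain f' where f': "f' \<in> L2" "F' = cls f'" by (rule lsq_cases)
  define g' where "g' x = f x + g x - f' x" for x
  have g'L: "g' \<in> L2" unfolding g'_def by (intro L2_diff L2_add L f')
  have g': "cls g' = cls f + cls g - cls f'"
    unfolding g'_def by (simp add: cls_diff cls_add L2_add L f')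
  have fg': "(f', g') \<in> H"
    by (rule graph_subset_extension[OF H f'(1) g'L]) (use F' in \<open>simp add: g' f'(2)\<close>)
  have d: "((\<lambda>x. f x - f' x), (\<lambda>x. g x - g' x)) \<in> H"
    unfolding self_adjoint_iff_real[OF sa L2_diff[OF L(1) f'(1)] L2_diff[OF L(2) g'L]]
    using fg fg' self_adjoint_iff_real[OF sa L] self_adjoint_iff_real[OF sa f'(1) g'L]
    by (auto simp: cls_diff L f' g'L inner_diff_right)
  have "0 \<le> Re (l2_inner (\<lambda>x. g x - g' x) (\<lambda>x. f x - f' x))"
    using nn d unfolding nonnegative_op_def by (auto simp: complex_nonneg_Reals_iff)
  then have "0 \<le> inner (cls g - cls g') (cls f - cls f')"
    using inner_cls[OF L2_diff[OF L(2) g'L] L2_diff[OF L(1) f'(1)]] by (simp add: cls_diff L f' g'L)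
  moreover have "cls g - cls g' = - (cls f - cls f')" by (simp add: g')
  ultimately have "0 \<le> inner (- (cls f - cls f')) (cls f - cls f')" by (simp only:)
  then have "inner (cls f - cls f') (cls f - cls f') \<le> 0" by (simp only: inner_minus_left neg_0_le_iff_le)
  then have e: "cls f = cls f'" by (metis inner_ge_zero inner_eq_zero_iff eq_iff right_minus_eq)
  then have "cls g' = cls g" by (simp add: g')
  with e F' show "(cls f, cls g) \<in> graph" by (simp add: f'(2) g')
qed (rule graph_subset_extension[OF H L])

end

text \<open>The group acts on functions, so a representative has to be chosen;
  \<open>flow_cls\<close> shows that the choice is immaterial.\<close>

definition flow :: "(real \<Rightarrow> ('a \<Rightarrow> complex) \<Rightarrow> 'a \<Rightarrow> complex) \<Rightarrow> real \<Rightarrow> 'a::euclidean_space lsq \<Rightarrow> 'a lsq" where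
  "flow U t F = cls (U t (SOME f. f \<in> L2 \<and> F = cls f))"

context
  fixes H :: "'a::euclidean_space l2_operator" and U
  assumes U: "unitary_group H U"
begin

lemma U_L2: "f \<in> L2 \<Longrightarrow> U t f \<in> L2"
  and U_norm: "f \<in> L2 \<Longrightarrow> l2_norm (U t f) = l2_norm f"
  using U by (auto simp: unitary_group_def)

lemma U_linear:
  assumes "f \<in> L2" "g \<in> L2"
  shows "cls (U t (\<lambda>y. f y + c * g y)) = cls (U t f) + mul (\<lambda>x. c) (cls (U t g))"
proof -
  have "AE x in lebesgue. U t (\<lambda>y. f y + c * g y) x = U t f x + c * U t g x"
    using U assms unfolding unitary_group_def by blast
  then have "cls (U t (\<lambda>y. f y + c * g y)) = cls (\<lambda>x. U t f x + c * U t g x)"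
    by (subst cls_eq_iff) (auto intro!: U_L2 L2_add L2_cmult assms)
  then show ?thesis
    by (simp add: cls_add U_L2 L2_cmult assms mul_cls bdd_meas_const)
qed

lemma flow_cls:
  assumes f: "f \<in> L2"
  shows "flow U t (cls f) = cls (U t f)"
proof -
  define f' where "f' = (SOME f'. f' \<in> L2 \<and> cls f = cls f')"
  have f': "f' \<in> L2" "cls f = cls f'"
    using someI[of "\<lambda>f'. f' \<in> L2 \<and> cls f = cls f'" f] f by (auto simp: f'_def)
  have L: "(\<lambda>y. f y + (- 1) * f' y) \<in> L2" by (intro L2_add L2_cmult f f')
  have m: "mul (\<lambda>x. - 1) (cls h) = - cls h" if "h \<in> L2" for h :: "'a \<Rightarrow> complex"
    using that by (simp add: mul_cls bdd_meas_const cls_uminus)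
  \<comment> \<open>Linearity and isometry on the difference of two representatives, which has norm
    0.\<close>
  have "norm (cls (U t f) - cls (U t f')) = norm (cls (U t (\<lambda>y. f y + (- 1) * f' y)))"
    unfolding U_linear[OF f f'(1)] by (simp add: m U_L2 f')
  also have "\<dots> = norm (cls (\<lambda>y. f y + (- 1) * f' y))"
    unfolding norm_cls[OF U_L2[OF L]] norm_cls[OF L] by (rule U_norm[OF L])
  also have "\<dots> = 0"
    using f f' by (simp add: cls_diff)
  finally show ?thesis by (simp add: flow_def f'_def[symmetric])
qed

lemma norm_flow: "norm (flow U t F) = norm F"
proof -
  obtain f where f: "f \<in> L2" "F = cls f" by (rule lsq_cases)
  then show ?thesis by (simp add: flow_cls norm_cls U_L2 U_norm)
qed

lemma flow_linear: "flow U t (F + mul (\<lambda>x. c) G) = flow U t F + mul (\<lambda>x. c) (flow U t G)"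
proof -
  obtain f where f: "f \<in> L2" "F = cls f" by (rule lsq_cases)
  obtain g where g: "g \<in> L2" "G = cls g" by (rule lsq_cases)
  have "F + mul (\<lambda>x. c) G = cls (\<lambda>y. f y + c * g y)"
    by (simp add: f g cls_add L2_cmult mul_cls bdd_meas_const)
  then show ?thesis
    using U_linear[OF f(1) g(1)] by (simp add: flow_cls L2_add L2_cmult f g)
qed

lemma flow_add: "flow U t (F + G) = flow U t F + flow U t G"
  using flow_linear[of t F 1 G] by (simp add: mul_one)

lemma flow_mul: "flow U t (mul (\<lambda>x. c) F) = mul (\<lambda>x. c) (flow U t F)"
  using flow_linear[of t F c F] by (simp add: flow_add)

lemma flow_scaleR: "flow U t (r *\<^sub>R F) = r *\<^sub>R flow U t F"
  using flow_mul[of t "complex_of_real r" F] by (simp only: mul_of_real)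

lemma flow_diff: "flow U t (F - G) = flow U t F - flow U t G"
  using flow_add[of t F "(- 1) *\<^sub>R G"] flow_scaleR[of t "- 1" G] by simp

lemma flow_0: "flow U 0 F = F"
proof -
  obtain f where f: "f \<in> L2" "F = cls f" by (rule lsq_cases)
  have "AE x in lebesgue. U 0 f x = f x" using U f unfolding unitary_group_def by blast
  then show ?thesis by (simp add: f flow_cls cls_eq_iff U_L2)
qed

lemma flow_plus: "flow U (s + t) F = flow U s (flow U t F)"
proof -
  obtain f where f: "f \<in> L2" "F = cls f" by (rule lsq_cases)
  have "AE x in lebesgue. U (s + t) f x = U s (U t f) x" using U f unfolding unitary_group_def by blast
  then show ?thesis by (simp add: f flow_cls cls_eq_iff U_L2)
qed

lemma flow_tendsto_0: "((\<lambda>t. flow U t F) \<longlongrightarrow> F) (at 0)"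
proof -
  obtain f where f: "f \<in> L2" "F = cls f" by (rule lsq_cases)
  have "((\<lambda>t. l2_norm (\<lambda>x. U t f x - f x)) \<longlongrightarrow> 0) (at 0)"
    using U f unfolding unitary_group_def by blast
  moreover have "l2_norm (\<lambda>x. U t f x - f x) = norm (flow U t F - F)" for t
    by (simp add: f flow_cls norm_cls U_L2 L2_diff flip: cls_diff)
  ultimately have "((\<lambda>t. norm (flow U t F - F)) \<longlongrightarrow> 0) (at 0)" by simp
  then show ?thesis by (rule LIM_zero_cancel[OF tendsto_norm_zero_cancel])
qed

lemma flow_continuous: "continuous_on UNIV (\<lambda>s. flow U s F)"
  unfolding continuous_on_def
proof
  fix s :: real
  have "((\<lambda>h. norm (flow U h F - F)) \<longlongrightarrow> norm (F - F)) (at 0)"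
    by (intro tendsto_intros flow_tendsto_0)
  moreover have "norm (flow U (s + h) F - flow U s F) = norm (flow U h F - F)" for h
    by (simp add: flow_plus norm_flow flip: flow_diff)
  ultimately have "((\<lambda>h. norm (flow U (s + h) F - flow U s F)) \<longlongrightarrow> 0) (at 0)" by simp
  then have "((\<lambda>h. flow U (s + h) F) \<longlongrightarrow> flow U s F) (at 0)"
    by (rule LIM_zero_cancel[OF tendsto_norm_zero_cancel])
  then show "((\<lambda>s. flow U s F) \<longlongrightarrow> flow U s F) (at s within UNIV)"
    by (simp add: LIM_offset_zero_iff)
qed

lemma generator_iff:
  assumes f: "f \<in> L2" and g: "g \<in> L2"
  shows "(f, g) \<in> H \<longleftrightarrow> ((\<lambda>t. (flow U t (cls f) - cls f) /\<^sub>R t) \<longlongrightarrow> - J (cls g)) (at 0)"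
proof -
  have "l2_norm (\<lambda>x. (U t f x - f x) / complex_of_real t - (- \<i> * g x))
      = norm ((flow U t (cls f) - cls f) /\<^sub>R t - - J (cls g))" for t
  proof -
    have L: "(\<lambda>x. inverse t *\<^sub>R (U t f x - f x)) \<in> L2" "(\<lambda>x. \<i> * g x) \<in> L2"
      by (intro L2_scaleR L2_diff L2_cmult U_L2 f g)+
    have "(\<lambda>x. (U t f x - f x) / complex_of_real t - (- \<i> * g x)) = (\<lambda>x. inverse t *\<^sub>R (U t f x - f x) + \<i> * g x)"
      by (simp add: fun_eq_iff scaleR_conv_of_real divide_inverse mult.commute)
    then have "l2_norm (\<lambda>x. (U t f x - f x) / complex_of_real t - (- \<i> * g x))
       = norm (cls (\<lambda>x. inverse t *\<^sub>R (U t f x - f x) + \<i> * g x))"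
      by (simp add: norm_cls L2_add L)
    also have "cls (\<lambda>x. inverse t *\<^sub>R (U t f x - f x) + \<i> * g x) = inverse t *\<^sub>R (flow U t (cls f) - cls f) + J (cls g)"
      unfolding cls_add[OF L] cls_scaleR[OF L2_diff[OF U_L2[OF f] f]] cls_diff[OF U_L2[OF f] f]
        flow_cls[OF f] mul_cls[OF bdd_meas_const g] ..
    finally show ?thesis by simp
  qed
  moreover have "(f, g) \<in> H \<longleftrightarrow>
        ((\<lambda>t. l2_norm (\<lambda>x. (U t f x - f x) / complex_of_real t - (- \<i> * g x))) \<longlongrightarrow> 0) (at 0)"
    using U f g unfolding unitary_group_def by blast
  ultimately have "(f, g) \<in> H \<longleftrightarrow> ((\<lambda>t. norm ((flow U t (cls f) - cls f) /\<^sub>R t - - J (cls g))) \<longlongrightarrow> 0) (at 0)"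
    by simp
  then show ?thesis by (simp only: tendsto_norm_zero_iff LIM_zero_iff)
qed

end

lemma bounded_linear_isometry:
  fixes T :: "'h::real_normed_vector \<Rightarrow> 'h"
  assumes "\<And>x y. T (x + y) = T x + T y" "\<And>r x. T (r *\<^sub>R x) = r *\<^sub>R T x" "\<And>x. norm (T x) = norm x"
  shows "bounded_linear T"
  by (rule bounded_linear_intro[of _ 1]) (auto simp: assms)

text \<open>The generator is characterised at time 0 only. Applying the isometry
  \<open>flow U t\<close> to the difference quotients there gives both the derivative at time
  \<open>t\<close> and the invariance of the graph.\<close>

lemma (in repulsive_potential) repulsive_flow_unitary_group:
  assumes H: "schrodinger_operator V H" and U: "unitary_group H U"
  shows "repulsive_flow V c W (flow U)"
proof
  have gen: "(F, G) \<in> graph \<longleftrightarrow> ((\<lambda>t. (flow U t F - F) /\<^sub>R t) \<longlongrightarrow> - J G) (at 0)" for F G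
  proof -
    obtain f where f: "f \<in> L2" "F = cls f" by (rule lsq_cases)
    obtain g where g: "g \<in> L2" "G = cls g" by (rule lsq_cases)
    show ?thesis
      unfolding f(2) g(2) extension_iff_graph[OF H f(1) g(1), symmetric] by (rule generator_iff[OF U f(1) g(1)])
  qed
  have lim: "((\<lambda>h. (flow U (t + h) F - flow U t F) /\<^sub>R h) \<longlongrightarrow> - J (flow U t G)) (at 0)" if FG: "(F, G) \<in> graph" for t F G
  proof -
    have bl: "bounded_linear (flow U t)"
      by (rule bounded_linear_isometry) (auto simp: flow_add[OF U] flow_scaleR[OF U] norm_flow[OF U])
    have "((\<lambda>h. flow U t ((flow U h F - F) /\<^sub>R h)) \<longlongrightarrow> flow U t (- J G)) (at 0)"
      using FG unfolding gen by (rule bounded_linear.tendsto[OF bl])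
    moreover have "flow U t (- J G) = - J (flow U t G)"
      using flow_mul[OF U, of t \<i> G] flow_scaleR[OF U, of t "-1" "J G"] by simp
    ultimately show ?thesis
      by (simp add: flow_scaleR[OF U] flow_diff[OF U] flow_plus[OF U])
  qed
  show "flow U t (f - g) = flow U t f - flow U t g" for t f g by (rule flow_diff[OF U])
  show "norm (flow U t f) = norm f" for t f by (rule norm_flow[OF U])
  show "flow U 0 f = f" for f by (rule flow_0[OF U])
  show "continuous_on UNIV (\<lambda>s. flow U s f)" for f by (rule flow_continuous[OF U])
  show "(flow U t f, flow U t g) \<in> graph" if "(f, g) \<in> graph" for t f g
    unfolding gen using lim[OF that, of t] by (simp add: flow_plus[OF U, symmetric] add.commute)
  show "((\<lambda>r. (flow U r f - flow U t f) /\<^sub>R (r - t)) \<longlongrightarrow> - J (flow U t g)) (at t)" if "(f, g) \<in> graph" for t f g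
    using lim[OF that, of t] by (subst LIM_offset_zero_iff) simp_all
qed

subsection \<open>Localised initial data\<close>

text \<open>Each point outside the ball has a neighbourhood on which the function vanishes almost
  everywhere; by Lindelof countably many of them cover the complement, so the exceptional sets have
  a null union.\<close>

lemma ess_support_AE_zero:
  fixes u :: "'a::euclidean_space \<Rightarrow> complex"
  assumes "ess_support u \<subseteq> ball 0 \<rho>"
  shows "AE x in lebesgue. \<rho> \<le> norm x \<longrightarrow> u x = 0"
proof -
  have "\<exists>e>0. AE y in lebesgue. y \<in> ball x e \<longrightarrow> u y = 0" if "x \<in> - ball 0 \<rho>" for x
  proof -
    have "x \<notin> ess_support u" using that assms by blast
    then show ?thesis by (simp add: ess_support_def)
  qed
  then obtain e where e: "\<And>x. x \<in> - ball 0 \<rho> \<Longrightarrow> e x > 0 \<and> (AE y in lebesgue. y \<in> ball x (e x) \<longrightarrow> u y = 0)"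
    by metis
  define F where "F = (\<lambda>x. ball x (e x)) ` (- ball 0 \<rho>)"
  have "\<And>S. S \<in> F \<Longrightarrow> open S" by (auto simp: F_def)
  then obtain F' where F': "F' \<subseteq> F" "countable F'" "\<Union>F' = \<Union>F" using Lindelof by metis
  have "AE y in lebesgue. \<forall>S\<in>F'. y \<in> S \<longrightarrow> u y = 0"
    unfolding AE_ball_countable[OF F'(2)] using F'(1) e by (auto simp: F_def)
  then show ?thesis
  proof eventually_elim
    case (elim y)
    show ?case
    proof
      assume "\<rho> \<le> norm y"
      then have y: "y \<in> - ball 0 \<rho>" by simp
      then have "y \<in> ball y (e y)" using e[OF y] by simp
      then have "y \<in> \<Union>F'" unfolding F' F_def using y by blast
      with elim show "u y = 0" by blast
    qed
  qed
qed

text \<open>The components of the cut-off field never exceed \<open>norm x\<close>, so the bound is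
  uniform in \<open>k\<close>.\<close>

lemma cm_fld_support_bound:
  assumes u: "u \<in> L2" and s: "AE x in lebesgue. \<rho> \<le> norm x \<longrightarrow> u x = 0" and \<rho>: "0 \<le> \<rho>"
    and b: "b \<in> Basis"
  shows "norm (cm (fld (eps k) b) (cls u)) \<le> \<rho> * norm (cls u)"
proof -
  let ?m = "\<lambda>x. complex_of_real (fld (eps k) b x)"
  note bm = bdd_meas_smooth[OF smooth_fld[OF eps_pos] fld_bound[OF eps_pos b], of k]
  have L: "(\<lambda>x. ?m x * u x) \<in> L2" by (rule L2_mult_bdd_meas[OF bm u])
  have "(LINT x|lebesgue. (cmod (?m x * u x))\<^sup>2) \<le> (LINT x|lebesgue. \<rho>\<^sup>2 * (cmod (u x))\<^sup>2)"
  proof (rule integral_mono_AE)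
    show "integrable lebesgue (\<lambda>x. (cmod (?m x * u x))\<^sup>2)" by (rule L2_integrable[OF L])
    show "integrable lebesgue (\<lambda>x. \<rho>\<^sup>2 * (cmod (u x))\<^sup>2)" using L2_integrable[OF u] by simp
    show "AE x in lebesgue. (cmod (?m x * u x))\<^sup>2 \<le> \<rho>\<^sup>2 * (cmod (u x))\<^sup>2"
      using s
    proof eventually_elim
      case (elim x)
      show ?case
      proof (cases "\<rho> \<le> norm x")
        case False
        then have "\<bar>fld (eps k) b x\<bar> \<le> \<rho>" using fld_le_norm[OF eps_pos b, of k x] by linarith
        then have "\<bar>fld (eps k) b x\<bar>\<^sup>2 \<le> \<rho>\<^sup>2" by (intro power_mono) auto
        then show ?thesis by (simp add: norm_mult power_mult_distrib mult_right_mono)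
      qed (use elim in simp)
    qed
  qed
  then have "l2_norm (\<lambda>x. ?m x * u x) \<le> sqrt (\<rho>\<^sup>2 * (LINT x|lebesgue. (cmod (u x))\<^sup>2))"
    unfolding l2_norm_def by (intro real_sqrt_le_mono) simp
  also have "\<dots> = \<rho> * l2_norm u" using \<rho> by (simp add: real_sqrt_mult l2_norm_def)
  finally show ?thesis
    unfolding cm_def mul_cls[OF bm u] norm_cls[OF L] norm_cls[OF u] .
qed

text \<open>Since $u$ itself need not have finite energy, the escape estimate is applied to
  $\lambda(H+\lambda)^{-1}u$, which stays localised up to $O(\lambda^{-1/2})$ and converges to $u$
  as $\lambda \to \infty$.\<close>

lemma (in repulsive_flow) escape_estimate_L2:
  assumes t: "t > 0" and r: "0 \<le> r0" "0 \<le> r1"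
    and dense: "\<And>e. e > 0 \<Longrightarrow> \<exists>f h. (f, h) \<in> graph \<and> norm (u - f) < e"
    and B0: "\<And>k b. b \<in> Basis \<Longrightarrow> norm (cm (fld (eps k) b) u) \<le> r0 * norm u"
    and B1: "\<And>k b. b \<in> Basis \<Longrightarrow> norm (cm (fld (eps k) b) (Ul t u)) \<le> r1 * norm u"
  shows "t * (norm u)\<^sup>2 \<le> 4 * real DIM('a) * r0 * (r0 + r1) * (norm u)\<^sup>2"
proof -
  define C where "C = 3 * sqrt (real DIM('a))"
  have "\<exists>F. (F, u - l *\<^sub>R F) \<in> graph" if "l > 0" for l
    using resolvent_exists[OF that, of u] by metis
  then obtain R where R: "\<And>l. l > 0 \<Longrightarrow> (R l, u - l *\<^sub>R R l) \<in> graph" by metis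
  \<comment> \<open>Homogeneity follows from preservation of inner products: the squared norm of the
    defect expands to 0.\<close>
  have Ul_scaleR: "Ul t (l *\<^sub>R x) = l *\<^sub>R Ul t x" for l x
  proof -
    have "(norm (Ul t (l *\<^sub>R x) - l *\<^sub>R Ul t x))\<^sup>2 = 0"
      unfolding power2_norm_eq_inner
      by (simp add: inner_diff_left inner_diff_right inner_Ul)
    then show ?thesis by simp
  qed
  have est: "t * (l * norm (R l))\<^sup>2 \<le> 4 * real DIM('a) * ((r0 + C / sqrt l) * norm u) * ((r0 + C / sqrt l) * norm u + (r1 + C / sqrt l) * norm u)"
    if l: "l > 0" for l
  proof -
    have sc: "norm (cm m (l *\<^sub>R x)) = l * norm (cm m x)" for m and x :: "'a lsq"
      using l by (simp add: cm_scaleR)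
    \<comment> \<open>The flow carries the resolvent of \<open>u\<close> to the resolvent of the
      evolved state, so the weighted resolvent bound can use the localisation at time
      \<open>t\<close> as well.\<close>
    have UR: "(Ul t (R l), Ul t u - l *\<^sub>R Ul t (R l)) \<in> graph"
      using Ul_graph[OF R[OF l], of t] by (simp add: Ul_diff Ul_scaleR)
    have "(l *\<^sub>R R l, l *\<^sub>R (u - l *\<^sub>R R l)) \<in> graph"
      using subspace_scale[OF subspace_graph R[OF l], of l] by simp
    note ee = escape_estimate[OF this t, of "(r0 + C / sqrt l) * norm u" "(r1 + C / sqrt l) * norm u"]
    have "t * (norm (l *\<^sub>R R l))\<^sup>2 \<le> 4 * real DIM('a) * ((r0 + C / sqrt l) * norm u) * ((r0 + C / sqrt l) * norm u + (r1 + C / sqrt l) * norm u)"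
    proof (rule ee)
      fix k and b :: 'a assume b: "b \<in> Basis"
      show "norm (cm (fld (eps k) b) (l *\<^sub>R R l)) \<le> (r0 + C / sqrt l) * norm u"
        using resolvent_weighted_bound[OF R[OF l] l eps_pos b, of k] B0[OF b, of k]
        unfolding sc C_def by (simp add: algebra_simps)
      show "norm (cm (fld (eps k) b) (Ul t (l *\<^sub>R R l))) \<le> (r1 + C / sqrt l) * norm u"
        using resolvent_weighted_bound[OF UR l eps_pos b, of k] B1[OF b, of k]
        unfolding Ul_scaleR sc C_def by (simp add: algebra_simps norm_Ul)
    qed
    then show ?thesis using l by simp
  qed
  \<comment> \<open>Convergence of \<open>l *\<^sub>R R l\<close> to \<open>u\<close>: for
    \<open>f\<close> in the domain the difference to \<open>f\<close> solves the resolvent equation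
    with right-hand side \<open>l *\<^sub>R (u - f) - h\<close>, and \<open>graph_low\<close> bounds
    it after division by \<open>l\<close>.\<close>
  have near: "norm (l *\<^sub>R R l - u) \<le> 2 * norm (u - f) + norm h / l" if l: "l > 0" and fh: "(f, h) \<in> graph" for l f h
  proof -
    have "(l *\<^sub>R R l - f, l *\<^sub>R (u - l *\<^sub>R R l) - h) \<in> graph"
      using subspace_diff[OF subspace_graph subspace_scale[OF subspace_graph R[OF l], of l] fh] by simp
    from graph_low[OF this l] have "l * norm (l *\<^sub>R R l - f) \<le> norm (l *\<^sub>R (u - f) - h)"
      by (simp add: algebra_simps)
    also have "\<dots> \<le> l * norm (u - f) + norm h"
      using norm_triangle_ineq4[of "l *\<^sub>R (u - f)" h] l by simp
    finally have "norm (l *\<^sub>R R l - f) \<le> norm (u - f) + norm h / l"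
      using l by (simp add: field_simps)
    moreover have "norm (l *\<^sub>R R l - u) \<le> norm (l *\<^sub>R R l - f) + norm (u - f)"
      using norm_triangle_ineq4[of "l *\<^sub>R R l - f" "u - f"] by simp
    ultimately show ?thesis by linarith
  qed
  have "((\<lambda>l. l *\<^sub>R R l) \<longlongrightarrow> u) at_top"
  proof (rule tendstoI)
    fix e :: real assume e: "e > 0"
    obtain f h where fh: "(f, h) \<in> graph" "norm (u - f) < e / 4" using dense[of "e / 4"] e by auto
    show "\<forall>\<^sub>F l in at_top. dist (l *\<^sub>R R l) u < e"
      using eventually_gt_at_top[of "max 0 (2 * norm h / e)"]
    proof eventually_elim
      case (elim l)
      have l: "l > 0" using elim by simp
      have "2 * norm h < e * l" using elim e by (simp add: field_simps)
      then have "norm h / l < e / 2" using l by (simp add: field_simps)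
      with near[OF l fh(1)] fh(2) show ?case unfolding dist_norm by linarith
    qed
  qed
  then have "((\<lambda>l. norm (l *\<^sub>R R l)) \<longlongrightarrow> norm u) at_top" by (rule tendsto_norm)
  moreover have "\<forall>\<^sub>F l in at_top. norm (l *\<^sub>R R l) = l * norm (R l)"
    using eventually_gt_at_top[of 0] by eventually_elim simp
  ultimately have lim: "((\<lambda>l. l * norm (R l)) \<longlongrightarrow> norm u) at_top"
    by (rule Lim_transform_eventually)
  have Cl: "((\<lambda>l. C / sqrt l) \<longlongrightarrow> 0) at_top"
    by (rule tendsto_divide_0[OF tendsto_const]) (rule filterlim_at_top_imp_at_infinity[OF sqrt_at_top])
  have "t * (norm u)\<^sup>2 \<le> 4 * real DIM('a) * ((r0 + 0) * norm u) * ((r0 + 0) * norm u + (r1 + 0) * norm u)"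
  proof (rule tendsto_le)
    show "((\<lambda>l. t * (l * norm (R l))\<^sup>2) \<longlongrightarrow> t * (norm u)\<^sup>2) at_top"
      by (intro tendsto_intros lim)
    show "((\<lambda>l. 4 * real DIM('a) * ((r0 + C / sqrt l) * norm u) * ((r0 + C / sqrt l) * norm u + (r1 + C / sqrt l) * norm u))
      \<longlongrightarrow> 4 * real DIM('a) * ((r0 + 0) * norm u) * ((r0 + 0) * norm u + (r1 + 0) * norm u)) at_top"
      by (intro tendsto_intros Cl)
    show "\<forall>\<^sub>F l in at_top. t * (l * norm (R l))\<^sup>2
      \<le> 4 * real DIM('a) * ((r0 + C / sqrt l) * norm u) * ((r0 + C / sqrt l) * norm u + (r1 + C / sqrt l) * norm u)"
      using eventually_gt_at_top[of 0] by eventually_elim (rule est)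
  qed simp
  then show ?thesis by (simp add: power2_eq_square algebra_simps)
qed

theorem corollary4p1:
  fixes V :: "real ^ 'n::finite \<Rightarrow> real"
    and H :: "(real ^ 'n) l2_operator"
    and U :: "real \<Rightarrow> (real ^ 'n \<Rightarrow> complex) \<Rightarrow> real ^ 'n \<Rightarrow> complex"
    and a b :: "nat \<Rightarrow> real"
  assumes "CARD('n) \<ge> 3"
    and "V \<in> borel_measurable lebesgue"
    and "kato_class (\<lambda>x. max (V x) 0)"
    and "kato_norm (\<lambda>x. max (- V x) 0)
           < ennreal (4 * pi powr (real CARD('n) / 2) / Gamma (real CARD('n) / 2 - 1))"
    and "\<forall>k\<le>2. a k > 0 \<and> b k > 0"
    and "a 0 < 1"
    and "\<forall>R>0. \<forall>k\<le>2. \<exists>W. (weak_radial ^^ k) (rescale R V) W \<and>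
           (\<forall>f\<in>H2. \<forall>g\<in>L2. weak_laplacian f g \<longrightarrow>
              (\<lambda>x. complex_of_real (W x) * f x) \<in> L2 \<and>
              l2_norm (\<lambda>x. complex_of_real (W x) * f x) \<le> a k / 2 * l2_norm g + b k * l2_norm f)"
    and "\<forall>R>0. \<exists>W. weak_radial (rescale R V) W \<and> (AE x in lebesgue. - W x \<ge> 0)"
    and "schrodinger_operator V H"
    and "unitary_group H U"
  shows "\<exists>\<sigma>>0. \<exists>T\<^sub>0>0. \<forall>u\<^sub>0\<in>L2. \<forall>r t.
           r > 0 \<and> t > r\<^sup>2 \<and>
           ess_support u\<^sub>0 \<subseteq> ball 0 (r / sqrt T\<^sub>0) \<and>
           ess_support (U t u\<^sub>0) \<subseteq> ball 0 (sqrt T\<^sub>0 * \<sigma> * t / r)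
           \<longrightarrow> (\<forall>s. AE x in lebesgue. U s u\<^sub>0 x = 0)"
proof -
  have a0: "0 < a 0" using assms(5) by simp
  have bnd: "(\<lambda>x. complex_of_real (rescale R V x) * f x) \<in> L2 \<and>
      l2_norm (\<lambda>x. complex_of_real (rescale R V x) * f x) \<le> a 0 / 2 * l2_norm g + b 0 * l2_norm f"
    if R: "R > 0" and fg: "f \<in> H2" "g \<in> L2" "weak_laplacian f g" for R f g
  proof -
    obtain W where "(weak_radial ^^ 0) (rescale R V) W"
      "\<forall>f\<in>H2. \<forall>g\<in>L2. weak_laplacian f g \<longrightarrow> (\<lambda>x. complex_of_real (W x) * f x) \<in> L2 \<and>
        l2_norm (\<lambda>x. complex_of_real (W x) * f x) \<le> a 0 / 2 * l2_norm g + b 0 * l2_norm f"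
      using assms(7) R by blast
    then show ?thesis using fg by simp
  qed
  have "rescale 1 V = V" by (simp add: rescale_def fun_eq_iff)
  then obtain W where W: "weak_radial V W" "AE x in lebesgue. - W x \<ge> 0"
    using assms(8) zero_less_one by metis
  note pot = scale_invariant_potential_bound[OF bnd Rep_testf_smooth Rep_testf_csupp]
  interpret repulsive_potential V "a 0 / 2" W
  proof
    show "(\<lambda>x. complex_of_real (V x) * Rep_testf f x) \<in> L2" for f by (rule pot(1))
    show "l2_norm (\<lambda>x. complex_of_real (V x) * Rep_testf f x) \<le> a 0 / 2 * l2_norm (laplacian (Rep_testf f))" for f
      by (rule pot(2))
    show "a 0 / 2 < 1 / 2" "0 \<le> a 0 / 2" using a0 assms(6) by auto
  qed (rule W)+
  interpret repulsive_flow V "a 0 / 2" W "flow U"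
    by (rule repulsive_flow_unitary_group[OF assms(9,10)])
  define n where "n = real DIM(real ^ 'n)"
  have n: "n > 0" by (simp add: n_def)
  have main: "\<forall>s. AE x in lebesgue. U s u\<^sub>0 x = 0"
    if u: "u\<^sub>0 \<in> L2" and r: "r > 0" and t: "t > r\<^sup>2"
      and s0: "ess_support u\<^sub>0 \<subseteq> ball 0 (r / sqrt (16 * n))"
      and s1: "ess_support (U t u\<^sub>0) \<subseteq> ball 0 (sqrt (16 * n) * (1 / (16 * n)) * t / r)" for u\<^sub>0 r t
  proof -
    define \<rho> where "\<rho> = r / sqrt (16 * n)"
    define L where "L = sqrt (16 * n) * (1 / (16 * n)) * t / r"
    have t0: "t > 0" using t r by (meson less_trans zero_less_power)
    have \<rho>: "0 \<le> \<rho>" "0 \<le> L" using r n t0 by (auto simp: \<rho>_def L_def)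
    have nf: "norm (cls (U t u\<^sub>0)) = norm (cls u\<^sub>0)"
      using norm_flow[OF assms(10), of t "cls u\<^sub>0"] by (simp add: flow_cls[OF assms(10) u])
    \<comment> \<open>The domain of \<open>H\<close> is dense by self-adjointness and agrees with
      that of the closed graph.\<close>
    have dense: "\<exists>f h. (f, h) \<in> graph \<and> norm (cls u\<^sub>0 - f) < e" if e: "e > 0" for e
    proof -
      have "l2_dense (Domain H)" using assms(9) by (simp add: schrodinger_operator_def self_adjoint_def)
      then obtain f where f: "f \<in> Domain H" "l2_norm (\<lambda>x. u\<^sub>0 x - f x) < e"
        using u e unfolding l2_dense_def by blast
      then obtain h where fh: "(f, h) \<in> H" by blast
      then have L2: "f \<in> L2" "h \<in> L2"
        using self_adjoint_L2 assms(9) unfolding schrodinger_operator_def by blast+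
      then have "(cls f, cls h) \<in> graph" using extension_iff_graph[OF assms(9)] fh by blast
      moreover have "norm (cls u\<^sub>0 - cls f) < e"
        using f(2) by (simp add: norm_cls L2_diff u L2 flip: cls_diff)
      ultimately show ?thesis by blast
    qed
    have "t * (norm (cls u\<^sub>0))\<^sup>2 \<le> 4 * real DIM(real ^ 'n) * \<rho> * (\<rho> + L) * (norm (cls u\<^sub>0))\<^sup>2"
    proof (rule escape_estimate_L2[OF t0 \<rho> dense])
      show "norm (cm (fld (eps k) b) (cls u\<^sub>0)) \<le> \<rho> * norm (cls u\<^sub>0)" if "b \<in> Basis" for k b
        using s0 by (intro cm_fld_support_bound ess_support_AE_zero u \<rho> that) (simp add: \<rho>_def)
      show "norm (cm (fld (eps k) b) (flow U t (cls u\<^sub>0))) \<le> L * norm (cls u\<^sub>0)" if "b \<in> Basis" for k b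
        unfolding flow_cls[OF assms(10) u] nf[symmetric]
        using s1 by (intro cm_fld_support_bound ess_support_AE_zero U_L2[OF assms(10) u] \<rho> that) (simp add: L_def)
    qed
    \<comment> \<open>The square roots cancel in the product of the two radii, which is
      \<open>t / (16 * n)\<close>, and the first radius has square
      \<open>r\<^sup>2 / (16 * n)\<close>. So the left side is \<open>(r\<^sup>2 + t) / 4\<close>,
      less than \<open>t / 2\<close> because \<open>r\<^sup>2 < t\<close>; a strict inequality
      leaves 0 as the only possible norm.\<close>
    moreover have "4 * real DIM(real ^ 'n) * \<rho> * (\<rho> + L) < t"
    proof -
      have "\<rho> * \<rho> = r\<^sup>2 / (16 * n)" using n by (simp add: \<rho>_def power2_eq_square flip: real_sqrt_mult)
      moreover have "\<rho> * L = t / (16 * n)" using n r by (simp add: \<rho>_def L_def)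
      ultimately have "4 * n * \<rho> * (\<rho> + L) = (r\<^sup>2 + t) / 4"
        using n by (simp add: distrib_left field_simps)
      also have "\<dots> < t" using t t0 by simp
      finally show ?thesis by (simp only: n_def)
    qed
    ultimately have "norm (cls u\<^sub>0) = 0"
      by (metis mult_less_cancel_right_pos not_less zero_eq_power2 zero_less_power2)
    then have "norm (cls (U s u\<^sub>0)) = 0" for s
      using norm_flow[OF assms(10), of s "cls u\<^sub>0"] unfolding flow_cls[OF assms(10) u] by simp
    then have "cls (U s u\<^sub>0) = cls (\<lambda>x. 0)" for s by (simp add: cls_zero)
    then show ?thesis using cls_eq_iff[OF U_L2[OF assms(10) u] L2_zero] by blast
  qed
  show ?thesis
    by (intro exI[of _ "1 / (16 * n)"] exI[of _ "16 * n"] conjI ballI allI impI) (use n main in auto)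
qed

end
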